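(* Let $\nu\geq 1$ be an integer and let $V\in L^1_{\mathrm{loc}}(\mathbb{R}^\nu)$ with $V\geq 0$. For $M>0$ define $$\Omega_M(V)=\{x\in\mathbb{R}^\nu \mid 0\leq V(x)<M\}.$$ If $|\Omega_M(V)|<\infty$ for all $M$, where $|\cdot|$ denotes Lebesgue measure, then the Schrödinger operator $H=-\Delta+V$ on $L^2(\mathbb{R}^\nu)$ has purely discrete spectrum.
   Context: $H=-\Delta+V$ is the selfadjoint operator on $L^2(\mathbb{R}^\nu)$ defined as a form sum, i.e. the operator associated with the closed quadratic form $u\mapsto \int |\nabla u|^2\,d^\nu x+\int V|u|^2\,d^\nu x$ with form domain $\{u\in H^1(\mathbb{R}^\nu)\mid \int V|u|^2\,d^\nu x<\infty\}$. A selfadjoint operator $H$ has purely discrete spectrum if its essential spectrum $\sigma_{\mathrm{ess}}(H)$ is empty; for nonnegative $H$, this is equivalent to compactness of $(H+1)^{-1}$, or of $e^{-sH}$ for any (and so all) $s>0$. *)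

theory Defs
  imports "HOL-Analysis.Analysis"
begin

definition locally_integrable ::
    "(real^'n \<Rightarrow> 'b::{banach, second_countable_topology}) \<Rightarrow> bool" where
  "locally_integrable f \<longleftrightarrow> (\<forall>K. compact K \<longrightarrow> f absolutely_integrable_on K)"

(* Elements of L^2 are represented by functions; everything below that refers to
   equality in L^2 is stated modulo Lebesgue null sets. *)

definition L2 :: "(real^'n \<Rightarrow> complex) set" where
  "L2 = {u \<in> borel_measurable lebesgue. integrable lebesgue (\<lambda>x. (cmod (u x))\<^sup>2)}"

definition L2_inner :: "(real^'n \<Rightarrow> complex) \<Rightarrow> (real^'n \<Rightarrow> complex) \<Rightarrow> complex" where
  "L2_inner u v = (LINT x|lebesgue. u x * cnj (v x))"

definition L2_norm :: "(real^'n \<Rightarrow> complex) \<Rightarrow> real" where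
  "L2_norm u = sqrt (LINT x|lebesgue. (cmod (u x))\<^sup>2)"

definition partial_deriv :: "'n \<Rightarrow> (real^'n \<Rightarrow> real) \<Rightarrow> real^'n \<Rightarrow> real" where
  "partial_deriv i f x = frechet_derivative f (at x) (axis i 1)"

primrec times_cont_diff :: "nat \<Rightarrow> (real^'n \<Rightarrow> real) \<Rightarrow> bool" where
  "times_cont_diff 0 f \<longleftrightarrow> continuous_on UNIV f"
| "times_cont_diff (Suc k) f \<longleftrightarrow>
     (\<forall>x. f differentiable (at x)) \<and> (\<forall>i. times_cont_diff k (partial_deriv i f))"

(* Real-valued test functions; by linearity, testing against these is the same as
   testing against complex-valued ones. *)
definition test_function :: "(real^'n \<Rightarrow> real) \<Rightarrow> bool" where
  "test_function \<phi> \<longleftrightarrow>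
     (\<forall>k. times_cont_diff k \<phi>) \<and> compact (closure {x. \<phi> x \<noteq> 0})"

definition has_weak_partial_deriv ::
    "'n \<Rightarrow> (real^'n \<Rightarrow> complex) \<Rightarrow> (real^'n \<Rightarrow> complex) \<Rightarrow> bool" where
  "has_weak_partial_deriv i u g \<longleftrightarrow>
     locally_integrable u \<and> locally_integrable g \<and>
     (\<forall>\<phi>. test_function \<phi> \<longrightarrow>
        (LINT x|lebesgue. of_real (partial_deriv i \<phi> x) * u x) =
        - (LINT x|lebesgue. of_real (\<phi> x) * g x))"

(* A representative; weak derivatives are unique up to null sets. *)
definition weak_partial_deriv :: "'n \<Rightarrow> (real^'n \<Rightarrow> complex) \<Rightarrow> real^'n \<Rightarrow> complex" where
  "weak_partial_deriv i u = (SOME g. has_weak_partial_deriv i u g)"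

definition H1 :: "(real^'n \<Rightarrow> complex) set" where
  "H1 = {u \<in> L2. \<forall>i. \<exists>g \<in> L2. has_weak_partial_deriv i u g}"

definition form_domain :: "(real^'n \<Rightarrow> real) \<Rightarrow> (real^'n \<Rightarrow> complex) set" where
  "form_domain V = {u \<in> H1. integrable lebesgue (\<lambda>x. V x * (cmod (u x))\<^sup>2)}"

(* The sesquilinear form (linear in the first argument) whose diagonal values are
   the quadratic form of - Laplacian + V. *)
definition schrodinger_form ::
    "(real^'n \<Rightarrow> real) \<Rightarrow> (real^'n \<Rightarrow> complex) \<Rightarrow> (real^'n \<Rightarrow> complex) \<Rightarrow> complex" where
  "schrodinger_form V u v =
     (\<Sum>i\<in>UNIV. L2_inner (weak_partial_deriv i u) (weak_partial_deriv i v)) +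
     (LINT x|lebesgue. of_real (V x) * (u x * cnj (v x)))"

(* Unbounded operators on L^2 are represented by their graphs. *)
type_synonym 'n L2_operator = "((real^'n \<Rightarrow> complex) \<times> (real^'n \<Rightarrow> complex)) set"

definition schrodinger_operator :: "(real^'n \<Rightarrow> real) \<Rightarrow> 'n L2_operator" where
  "schrodinger_operator V =
     {(u, f). u \<in> form_domain V \<and> f \<in> L2 \<and>
        (\<forall>v \<in> form_domain V. schrodinger_form V u v = L2_inner f v)}"

(* (u, f + z u) in H says that (H - z) u = f; so z is in the resolvent set iff
   H - z is a bijection from its domain onto L^2 with bounded inverse. *)
definition resolvent_set :: "'n::finite L2_operator \<Rightarrow> complex set" where
  "resolvent_set H =
     {z. \<exists>C. \<forall>f \<in> L2. \<exists>u.
           (u, \<lambda>x. f x + z * u x) \<in> H \<and> L2_norm u \<le> C * L2_norm f \<and>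
           (\<forall>w. (w, \<lambda>x. f x + z * w x) \<in> H \<longrightarrow> (AE x in lebesgue. w x = u x))}"

definition op_spectrum :: "'n::finite L2_operator \<Rightarrow> complex set" where
  "op_spectrum H = - resolvent_set H"

definition eigenspace :: "'n::finite L2_operator \<Rightarrow> complex \<Rightarrow> (real^'n \<Rightarrow> complex) set" where
  "eigenspace H z = {u. (u, \<lambda>x. z * u x) \<in> H}"

definition is_eigenvalue :: "'n::finite L2_operator \<Rightarrow> complex \<Rightarrow> bool" where
  "is_eigenvalue H z \<longleftrightarrow> (\<exists>u \<in> eigenspace H z. \<not> (AE x in lebesgue. u x = 0))"

definition L2_finite_dim :: "(real^'n \<Rightarrow> complex) set \<Rightarrow> bool" where
  "L2_finite_dim E \<longleftrightarrow>
     (\<exists>B. finite B \<and> B \<subseteq> L2 \<and>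
        (\<forall>u \<in> E. \<exists>c. AE x in lebesgue. u x = (\<Sum>b\<in>B. c b * b x)))"

definition discrete_spectrum :: "'n::finite L2_operator \<Rightarrow> complex set" where
  "discrete_spectrum H =
     {z. z isolated_in op_spectrum H \<and> is_eigenvalue H z \<and> L2_finite_dim (eigenspace H z)}"

(* For selfadjoint H, geometric and algebraic multiplicities agree, so this is the
   usual complement of the isolated eigenvalues of finite multiplicity. *)
definition essential_spectrum :: "'n::finite L2_operator \<Rightarrow> complex set" where
  "essential_spectrum H = op_spectrum H - discrete_spectrum H"

definition purely_discrete_spectrum :: "'n::finite L2_operator \<Rightarrow> bool" where
  "purely_discrete_spectrum H \<longleftrightarrow> essential_spectrum H = {}"

definition Omega :: "real \<Rightarrow> (real^'n \<Rightarrow> real) \<Rightarrow> (real^'n) set" where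
  "Omega M V = {x. 0 \<le> V x \<and> V x < M}"

end

theory Submission
  imports Defs "HOL-Complex_Analysis.Great_Picard"
begin

text \<open>
Let \<open>q(u,v) = \<langle>\<nabla>u, \<nabla>v\<rangle> + \<langle>\<surd>V u, \<surd>V v\<rangle> + \<langle>u, v\<rangle>\<close> on the form domain \<open>D\<close>; it is the form of
\<open>H + 1\<close>. Two facts about \<open>q\<close> give the result: \<open>D\<close> is complete in the norm of \<open>q\<close>, and sequences
bounded in that norm have subsequences that converge in \<open>L\<^sup>2\<close>.

From these two facts the spectrum is found without an abstract spectral theorem
(locale \<open>compactly_embedded_form\<close>). Minimizing \<open>q\<close> on the unit sphere of the orthogonal complement of
finitely many eigenvectors gives the next eigenvector (\<open>ground_state\<close>). An infinite orthonormal family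
of eigenvectors with bounded eigenvalues would be a bounded sequence in \<open>D\<close> without convergent
subsequence, so finitely many steps reach any level \<open>\<Lambda>\<close>: outside a finite-dimensional space spanned
by eigenvectors, \<open>q \<ge> \<Lambda>\<close> (\<open>eigensystem_exhausts_low_energies\<close>). On that complement \<open>H + 1 - \<mu>\<close> is
inverted for all \<open>\<bar>\<mu>\<bar> < \<Lambda>\<close> by a fixed-point iteration with \<open>\<mu>\<close> times the inverse of \<open>H
    + 1\<close>, a contraction there with factor
\<open>\<bar>\<mu>\<bar> / \<Lambda>\<close>; on the finite-dimensional space it is diagonal (\<open>resolvent_bound\<close>). Hence in the disc of
radius \<open>\<Lambda>\<close> about \<open>-1\<close> the spectrum consists of finitely many eigenvalues of finite multiplicity.

Completeness of \<open>D\<close> is the Riesz-Fischer theorem (\<open>L2_complete\<close>), applied to the functions, their weak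
derivatives and their products with \<open>\<surd>V\<close>. Compactness is where the hypothesis on the sublevel sets
enters. Let \<open>A\<^sub>\<epsilon> u\<close> be the function that on each cube of a grid of mesh \<open>\<epsilon>\<close> is the mean of \<open>u\<close>
there. Since translating \<open>u\<close> by \<open>h\<close> changes it by at most \<open>\<bar>h\<bar> \<parallel>\<nabla>u\<parallel>\<close> in \<open>L\<^sup>2\<close>
(\<open>translation_estimate\<close>), \<open>\<parallel>u - A\<^sub>\<epsilon> u\<parallel>\<close> is of order \<open>\<epsilon> \<parallel>\<nabla>u\<parallel>\<close> (\<open>cube_average_error\<close>), while
\<open>\<bar>A\<^sub>\<epsilon> u\<bar>\<close> is bounded pointwise by a multiple of \<open>\<parallel>u\<parallel>\<close>. Where \<open>V \<ge> M\<close>, the mass of \<open>u\<close> is at most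
\<open>1/M\<close> times its potential energy; where \<open>V < M\<close>, it is controlled by the error of the
averages and by \<open>A\<^sub>\<epsilon> u\<close> (\<open>mass_splitting\<close>). If all cube means of a bounded sequence tend to \<open>0\<close>, then
\<open>A\<^sub>\<epsilon> u\<^sub>n \<rightarrow> 0\<close> pointwise and boundedly, so its mass on the set \<open>V < M\<close> of finite measure tends to \<open>0\<close>
by dominated convergence. So \<open>\<parallel>u\<^sub>n\<parallel> \<rightarrow> 0\<close> (\<open>energy_bounded_vanishing\<close>). A diagonal subsequence makes
the countably many cube means converge, and the argument applies to differences of its members.

The translation estimate, and the uniqueness of weak derivatives, rest on the fundamental lemma of the
calculus of variations, for which explicit smooth bumps approximating indicators of boxes are built.
\<close>

section \<open>Semi-inner product spaces of functions\<close>

text \<open>Elements of \<open>L\<^sup>2\<close> and of the form domain are functions, not classes modulo null sets. So a carrier set of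
functions is used, and the inner product is only semidefinite; functions that agree almost
everywhere differ by a function of seminorm zero.\<close>

locale semi_inner_product =
  fixes S :: "('x \<Rightarrow> complex) set" and ip :: "('x \<Rightarrow> complex) \<Rightarrow> ('x \<Rightarrow> complex) \<Rightarrow> complex"
  assumes zero_mem: "(\<lambda>x. 0) \<in> S"
    and comb_mem: "u \<in> S \<Longrightarrow> v \<in> S \<Longrightarrow> (\<lambda>x. u x + c * v x) \<in> S"
    and ip_comb_left: "u \<in> S \<Longrightarrow> v \<in> S \<Longrightarrow> w \<in> S \<Longrightarrow> ip (\<lambda>x. u x + c * v x) w = ip u w + c * ip v w"
    and ip_herm: "u \<in> S \<Longrightarrow> v \<in> S \<Longrightarrow> ip v u = cnj (ip u v)"
    and ip_nonneg: "u \<in> S \<Longrightarrow> 0 \<le> Re (ip u u)"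
begin

text \<open>Squared norms are kept alongside norms because forms, eigenvalues and integrals are quadratic.\<close>

definition sqn :: "('x \<Rightarrow> complex) \<Rightarrow> real" where "sqn u = Re (ip u u)"

definition nrm :: "('x \<Rightarrow> complex) \<Rightarrow> real" where "nrm u = sqrt (sqn u)"

lemma sqn_nonneg: "u \<in> S \<Longrightarrow> 0 \<le> sqn u"
  by (simp add: sqn_def ip_nonneg)

lemma nrm_nonneg: "u \<in> S \<Longrightarrow> 0 \<le> nrm u"
  by (simp add: nrm_def sqn_nonneg)

lemma nrm_sq: "u \<in> S \<Longrightarrow> (nrm u)\<^sup>2 = sqn u"
  by (simp add: nrm_def sqn_nonneg)

lemma ip_self: "u \<in> S \<Longrightarrow> ip u u = of_real (sqn u)"
  using ip_herm[of u u] by (simp add: complex_eq_iff sqn_def)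

lemma ip_comb_right:
  assumes "u \<in> S" "v \<in> S" "w \<in> S"
  shows "ip w (\<lambda>x. u x + c * v x) = ip w u + cnj c * ip w v"
  using assms ip_herm[of "\<lambda>x. u x + c * v x" w] ip_herm[of u w] ip_herm[of v w]
  by (simp add: comb_mem ip_comb_left)

lemma diff_mem: "u \<in> S \<Longrightarrow> v \<in> S \<Longrightarrow> (\<lambda>x. u x - v x) \<in> S"
  using comb_mem[of u v "-1"] by simp

lemma add_mem: "u \<in> S \<Longrightarrow> v \<in> S \<Longrightarrow> (\<lambda>x. u x + v x) \<in> S"
  using comb_mem[of u v "1"] by simp

lemma scale_mem: "u \<in> S \<Longrightarrow> (\<lambda>x. c * u x) \<in> S"
  using comb_mem[of "\<lambda>x. 0" u c] by (simp add: zero_mem)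

lemma ip_diff_left: "u \<in> S \<Longrightarrow> v \<in> S \<Longrightarrow> w \<in> S \<Longrightarrow> ip (\<lambda>x. u x - v x) w = ip u w - ip v w"
  using ip_comb_left[of u v w "-1"] by simp

lemma ip_add_left: "u \<in> S \<Longrightarrow> v \<in> S \<Longrightarrow> w \<in> S \<Longrightarrow> ip (\<lambda>x. u x + v x) w = ip u w + ip v w"
  using ip_comb_left[of u v w "1"] by simp

lemma ip_zero_left: "w \<in> S \<Longrightarrow> ip (\<lambda>x. 0) w = 0"
  using ip_diff_left[of w w w] by simp

lemma ip_scale_left: "u \<in> S \<Longrightarrow> w \<in> S \<Longrightarrow> ip (\<lambda>x. c * u x) w = c * ip u w"
  using ip_comb_left[of "\<lambda>x. 0" u w c] by (simp add: zero_mem ip_zero_left)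

lemma ip_scale_right: "u \<in> S \<Longrightarrow> w \<in> S \<Longrightarrow> ip w (\<lambda>x. c * u x) = cnj c * ip w u"
  using ip_herm[of "\<lambda>x. c * u x" w] ip_herm[of u w] by (simp add: scale_mem ip_scale_left)

lemma ip_add_right: "u \<in> S \<Longrightarrow> v \<in> S \<Longrightarrow> w \<in> S \<Longrightarrow> ip w (\<lambda>x. u x + v x) = ip w u + ip w v"
  using ip_comb_right[of u v w "1"] by simp

lemma ip_diff_right: "u \<in> S \<Longrightarrow> v \<in> S \<Longrightarrow> w \<in> S \<Longrightarrow> ip w (\<lambda>x. u x - v x) = ip w u - ip w v"
  using ip_comb_right[of u v w "-1"] by simp

lemma sum_mem: "finite E \<Longrightarrow> E \<subseteq> S \<Longrightarrow> (\<lambda>x. \<Sum>e\<in>E. c e * e x) \<in> S"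
proof (induction E rule: finite_induct)
  case empty show ?case by (simp add: zero_mem)
next
  case (insert e E)
  then have "(\<lambda>x. (\<Sum>e\<in>E. c e * e x) + c e * e x) \<in> S" by (intro comb_mem) auto
  then show ?case using insert by (simp add: add.commute)
qed

lemma ip_sum_left:
  "finite E \<Longrightarrow> E \<subseteq> S \<Longrightarrow> w \<in> S \<Longrightarrow> ip (\<lambda>x. \<Sum>e\<in>E. c e * e x) w = (\<Sum>e\<in>E. c e * ip e w)"
proof (induction E rule: finite_induct)
  case empty then show ?case by (simp add: ip_zero_left)
next
  case (insert e E)
  then have "ip (\<lambda>x. (\<Sum>e\<in>E. c e * e x) + c e * e x) w
      = ip (\<lambda>x. \<Sum>e\<in>E. c e * e x) w + c e * ip e w"
    by (intro ip_comb_left sum_mem) auto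
  then show ?case using insert by (simp add: add.commute)
qed

lemma sqn_comb:
  assumes "u \<in> S" "v \<in> S"
  shows "sqn (\<lambda>x. u x + c * v x) = sqn u + 2 * Re (cnj c * ip u v) + (cmod c)\<^sup>2 * sqn v"
proof -
  have "ip (\<lambda>x. u x + c * v x) (\<lambda>x. u x + c * v x)
      = ip u u + cnj c * ip u v + (c * cnj (ip u v) + c * cnj c * ip v v)"
    using assms by (simp add: ip_comb_left ip_comb_right comb_mem ip_herm[of u v] algebra_simps)
  also have "c * cnj c = of_real ((cmod c)\<^sup>2)"
    by (metis complex_norm_square)
  finally show ?thesis
    unfolding sqn_def using assms by (simp add: ip_self)
qed

lemma sqn_scale: "u \<in> S \<Longrightarrow> sqn (\<lambda>x. c * u x) = (cmod c)\<^sup>2 * sqn u"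
  using sqn_comb[of "\<lambda>x. 0" u c] by (simp add: zero_mem ip_zero_left sqn_def)

lemma nrm_scale: "u \<in> S \<Longrightarrow> nrm (\<lambda>x. c * u x) = cmod c * nrm u"
  by (simp add: nrm_def sqn_scale real_sqrt_mult)

lemma sqn_diff: "u \<in> S \<Longrightarrow> v \<in> S \<Longrightarrow> sqn (\<lambda>x. u x - v x) = sqn u - 2 * Re (ip u v) + sqn v"
  using sqn_comb[of u v "-1"] by simp

lemma sqn_add: "u \<in> S \<Longrightarrow> v \<in> S \<Longrightarrow> sqn (\<lambda>x. u x + v x) = sqn u + 2 * Re (ip u v) + sqn v"
  using sqn_comb[of u v "1"] by simp

lemma nrm_diff_commute: "u \<in> S \<Longrightarrow> v \<in> S \<Longrightarrow> nrm (\<lambda>x. u x - v x) = nrm (\<lambda>x. v x - u x)"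
  by (simp add: nrm_def sqn_diff ip_herm[of u v])

lemma Cauchy_Schwarz_sqn:
  assumes u: "u \<in> S" and v: "v \<in> S"
  shows "(cmod (ip u v))\<^sup>2 \<le> sqn u * sqn v"
proof -
  define z where "z = ip u v"
  have *: "0 \<le> sqn u + 2 * Re (cnj c * z) + (cmod c)\<^sup>2 * sqn v" for c
    using sqn_nonneg[OF comb_mem[OF u v, of c]] unfolding sqn_comb[OF u v] z_def .
  have zz: "Re (cnj (of_real t * z) * z) = t * (cmod z)\<^sup>2" for t
    by (simp add: cmod_power2) (simp add: power2_eq_square algebra_simps)
  have **: "0 \<le> sqn u + 2 * t * (cmod z)\<^sup>2 + t\<^sup>2 * (cmod z)\<^sup>2 * sqn v" for t
    using *[of "of_real t * z", unfolded zz] by (simp add: norm_mult power_mult_distrib mult.assoc)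
  show ?thesis
  proof (cases "sqn v = 0")
    case True
    have "cmod z = 0"
    proof (rule ccontr)
      assume "cmod z \<noteq> 0"
      then show False
        \<comment> \<open>the bound is affine in t here, and this t makes it equal to -1\<close>
        using **[of "- (sqn u + 1) / (2 * (cmod z)\<^sup>2)"] True sqn_nonneg[OF u] by (simp add: field_simps)
    qed
    then show ?thesis using True by (simp add: z_def)
  next
    case False
    then have "0 < sqn v" using sqn_nonneg[OF v] by simp
    then show ?thesis
      using **[of "- 1 / sqn v"] by (simp add: z_def field_simps power2_eq_square)
  qed
qed

lemma Cauchy_Schwarz: "u \<in> S \<Longrightarrow> v \<in> S \<Longrightarrow> cmod (ip u v) \<le> nrm u * nrm v"
  unfolding nrm_def real_sqrt_mult[symmetric]
  by (rule real_le_rsqrt) (rule Cauchy_Schwarz_sqn)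

lemma nrm_triangle:
  assumes u: "u \<in> S" and v: "v \<in> S"
  shows "nrm (\<lambda>x. u x + v x) \<le> nrm u + nrm v"
proof -
  have "sqn (\<lambda>x. u x + v x) \<le> (nrm u + nrm v)\<^sup>2"
    using Cauchy_Schwarz[OF u v] abs_Re_le_cmod[of "ip u v"] sqn_add[OF u v] nrm_sq[OF u] nrm_sq[OF v]
    by (simp add: power2_sum)
  then show ?thesis
    unfolding nrm_def[of "\<lambda>x. u x + v x"]
    using nrm_nonneg[OF u] nrm_nonneg[OF v] by (intro real_le_lsqrt) auto
qed

lemma nrm_triangle_diff:
  assumes "u \<in> S" "v \<in> S" "w \<in> S"
  shows "nrm (\<lambda>x. u x - w x) \<le> nrm (\<lambda>x. u x - v x) + nrm (\<lambda>x. v x - w x)"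
  using nrm_triangle[OF diff_mem[OF assms(1,2)] diff_mem[OF assms(2,3)]] by simp

lemma nrm_diff_triangle:
  assumes "u \<in> S" "v \<in> S"
  shows "nrm u \<le> nrm (\<lambda>x. u x - v x) + nrm v"
  using nrm_triangle[OF diff_mem[OF assms] assms(2)] by simp

lemma parallelogram:
  assumes "u \<in> S" "v \<in> S"
  shows "sqn (\<lambda>x. u x + v x) + sqn (\<lambda>x. u x - v x) = 2 * sqn u + 2 * sqn v"
  using sqn_add[OF assms] sqn_diff[OF assms] by simp

lemma nrm_sum_le:
  "finite E \<Longrightarrow> E \<subseteq> S \<Longrightarrow> nrm (\<lambda>x. \<Sum>e\<in>E. c e * e x) \<le> (\<Sum>e\<in>E. cmod (c e) * nrm e)"
proof (induction E rule: finite_induct)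
  case empty then show ?case by (simp add: nrm_def sqn_def ip_zero_left zero_mem)
next
  case (insert e E)
  then have "nrm (\<lambda>x. c e * e x + (\<Sum>e\<in>E. c e * e x)) \<le> nrm (\<lambda>x. c e * e x) + nrm (\<lambda>x. \<Sum>e\<in>E. c e * e x)"
    by (intro nrm_triangle scale_mem sum_mem) auto
  then show ?case using insert by (simp add: nrm_scale)
qed

definition ip_cauchy :: "(nat \<Rightarrow> 'x \<Rightarrow> complex) \<Rightarrow> bool" where
  "ip_cauchy X \<longleftrightarrow> (\<forall>\<epsilon>>0. \<exists>N. \<forall>m\<ge>N. \<forall>n\<ge>N. nrm (\<lambda>x. X m x - X n x) < \<epsilon>)"

definition ip_lim :: "(nat \<Rightarrow> 'x \<Rightarrow> complex) \<Rightarrow> ('x \<Rightarrow> complex) \<Rightarrow> bool" where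
  "ip_lim X u \<longleftrightarrow> (\<lambda>n. nrm (\<lambda>x. X n x - u x)) \<longlonglongrightarrow> 0"

lemma ip_lim_ip:
  assumes X: "\<And>n. X n \<in> S" and u: "u \<in> S" and lim: "ip_lim X u" and v: "v \<in> S"
  shows "(\<lambda>n. ip (X n) v) \<longlonglongrightarrow> ip u v"
proof (rule LIM_zero_cancel, rule Lim_null_comparison)
  show "\<forall>\<^sub>F n in sequentially. norm (ip (X n) v - ip u v) \<le> nrm (\<lambda>x. X n x - u x) * nrm v"
    using Cauchy_Schwarz[OF diff_mem[OF X u] v] by (simp add: ip_diff_left X u v)
  show "(\<lambda>n. nrm (\<lambda>x. X n x - u x) * nrm v) \<longlonglongrightarrow> 0"
    by (rule tendsto_mult_left_zero[OF lim[unfolded ip_lim_def]])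
qed

lemma ip_lim_nrm:
  assumes X: "\<And>n. X n \<in> S" and u: "u \<in> S" and lim: "ip_lim X u"
  shows "(\<lambda>n. nrm (X n)) \<longlonglongrightarrow> nrm u"
proof (rule LIM_zero_cancel, rule Lim_null_comparison)
  have "\<bar>nrm (X n) - nrm u\<bar> \<le> nrm (\<lambda>x. X n x - u x)" for n
    using nrm_diff_triangle[OF X u, of n] nrm_diff_triangle[OF u X, of n] nrm_diff_commute[OF u X, of n]
    by simp
  then show "\<forall>\<^sub>F n in sequentially. norm (nrm (X n) - nrm u) \<le> nrm (\<lambda>x. X n x - u x)"
    by simp
qed (use lim in \<open>auto simp: ip_lim_def\<close>)

lemma ip_lim_sqn:
  assumes "\<And>n. X n \<in> S" and "u \<in> S" and "ip_lim X u"
  shows "(\<lambda>n. sqn (X n)) \<longlonglongrightarrow> sqn u"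
  using tendsto_power[OF ip_lim_nrm[OF assms], of 2] assms by (simp add: nrm_sq)

lemma ip_cauchy_sqnI:
  assumes X: "\<And>n. X n \<in> S"
    and "\<And>\<epsilon>. \<epsilon> > 0 \<Longrightarrow> \<exists>N. \<forall>m\<ge>N. \<forall>n\<ge>N. sqn (\<lambda>x. X m x - X n x) < \<epsilon>"
  shows "ip_cauchy X"
  unfolding ip_cauchy_def
proof (intro allI impI)
  fix \<epsilon> :: real assume "\<epsilon> > 0"
  then obtain N where N: "\<forall>m\<ge>N. \<forall>n\<ge>N. sqn (\<lambda>x. X m x - X n x) < \<epsilon>\<^sup>2"
    using assms(2)[of "\<epsilon>\<^sup>2"] by auto
  then have "nrm (\<lambda>x. X m x - X n x) < \<epsilon>" if "m \<ge> N" "n \<ge> N" for m n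
    using that \<open>\<epsilon> > 0\<close> nrm_sq[OF diff_mem[OF X X], of m n]
    by (intro power2_less_imp_less[of _ \<epsilon>]) auto
  then show "\<exists>N. \<forall>m\<ge>N. \<forall>n\<ge>N. nrm (\<lambda>x. X m x - X n x) < \<epsilon>" by blast
qed

lemma ip_cauchy_sqnD:
  assumes X: "\<And>n. X n \<in> S" and c: "ip_cauchy X" and "\<epsilon> > 0"
  shows "\<exists>N. \<forall>m\<ge>N. \<forall>n\<ge>N. sqn (\<lambda>x. X m x - X n x) < \<epsilon>"
proof -
  obtain N where N: "\<forall>m\<ge>N. \<forall>n\<ge>N. nrm (\<lambda>x. X m x - X n x) < sqrt \<epsilon>"
    using c \<open>\<epsilon> > 0\<close> unfolding ip_cauchy_def by (meson real_sqrt_gt_zero)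
  then show ?thesis unfolding nrm_def by auto
qed

text \<open>The criterion used for fixed-point iterations of a contraction with factor \<open>r\<close>.\<close>

lemma ip_cauchy_geometric:
  assumes X: "\<And>n. X n \<in> S" and r: "0 \<le> r" "r < 1" and "0 \<le> K"
    and step: "\<And>n. nrm (\<lambda>x. X (Suc n) x - X n x) \<le> K * r ^ n"
  shows "ip_cauchy X"
proof -
  have *: "nrm (\<lambda>x. X (n + k) x - X n x) \<le> K * r ^ n * (1 - r ^ k) / (1 - r)" for n k
  proof (induction k)
    case 0 show ?case by (simp add: nrm_def sqn_def ip_zero_left zero_mem)
  next
    case (Suc k)
    have "nrm (\<lambda>x. X (n + Suc k) x - X n x) \<le> K * r ^ (n + k) + K * r ^ n * (1 - r ^ k) / (1 - r)"
      using nrm_triangle_diff[OF X[of "n + Suc k"] X[of "n + k"] X[of n]] step[of "n + k"] Suc by simp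
    also have "\<dots> = K * r ^ n * (1 - r ^ Suc k) / (1 - r)"
      using r by (simp add: field_simps power_add)
    finally show ?case .
  qed
  have bound: "nrm (\<lambda>x. X n x - X N x) \<le> K * r ^ N / (1 - r)" if "N \<le> n" for n N
  proof -
    have "K * r ^ N * (1 - r ^ (n - N)) / (1 - r) \<le> K * r ^ N * 1 / (1 - r)"
      using r \<open>0 \<le> K\<close> by (intro divide_right_mono mult_left_mono) auto
    then show ?thesis using *[of N "n - N"] that by simp
  qed
  have "(\<lambda>N. K * r ^ N / (1 - r)) \<longlonglongrightarrow> K * 0 / (1 - r)"
    using r by (intro tendsto_intros LIMSEQ_power_zero) auto
  then have lim: "(\<lambda>N. K * r ^ N / (1 - r)) \<longlonglongrightarrow> 0" by simp
  show ?thesis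
    unfolding ip_cauchy_def
  proof (intro allI impI)
    fix \<epsilon> :: real assume "\<epsilon> > 0"
    then have "\<forall>\<^sub>F N in sequentially. K * r ^ N / (1 - r) < \<epsilon> / 2"
      by (intro order_tendstoD(2)[OF lim]) simp
    then obtain N where N: "K * r ^ N / (1 - r) < \<epsilon> / 2"
      unfolding eventually_sequentially by blast
    have "nrm (\<lambda>x. X m x - X n x) < \<epsilon>" if "m \<ge> N" "n \<ge> N" for m n
      using nrm_triangle_diff[OF X[of m] X[of N] X[of n]] bound[OF that(1)] bound[OF that(2)] N
        nrm_diff_commute[OF X X, of N n] by linarith
    then show "\<exists>N. \<forall>m\<ge>N. \<forall>n\<ge>N. nrm (\<lambda>x. X m x - X n x) < \<epsilon>" by blast
  qed
qed

lemma ip_cauchy_subseq: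
  assumes "ip_cauchy X" "strict_mono r"
  shows "ip_cauchy (X \<circ> r)"
  unfolding ip_cauchy_def
proof (intro allI impI)
  fix \<epsilon> :: real assume "\<epsilon> > 0"
  then obtain N where N: "\<forall>m\<ge>N. \<forall>n\<ge>N. nrm (\<lambda>x. X m x - X n x) < \<epsilon>"
    using assms(1) unfolding ip_cauchy_def by blast
  then show "\<exists>N. \<forall>m\<ge>N. \<forall>n\<ge>N. nrm (\<lambda>x. (X \<circ> r) m x - (X \<circ> r) n x) < \<epsilon>"
    using seq_suble[OF assms(2)] by (intro exI[of _ N]) (auto intro: order_trans)
qed

lemma ip_lim_of_subseq:
  assumes X: "\<And>n. X n \<in> S" and u: "u \<in> S" and c: "ip_cauchy X" and r: "strict_mono r"
    and lim: "ip_lim (X \<circ> r) u"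
  shows "ip_lim X u"
  unfolding ip_lim_def
proof (rule LIMSEQ_I)
  fix \<epsilon> :: real assume e: "\<epsilon> > 0"
  then obtain N where N: "\<forall>m\<ge>N. \<forall>n\<ge>N. nrm (\<lambda>x. X m x - X n x) < \<epsilon> / 2"
    using c unfolding ip_cauchy_def by (meson half_gt_zero)
  obtain N' where N': "\<And>n. n \<ge> N' \<Longrightarrow> norm (nrm (\<lambda>x. (X \<circ> r) n x - u x) - 0) < \<epsilon> / 2"
    using LIMSEQ_D[OF lim[unfolded ip_lim_def], of "\<epsilon> / 2"] e by auto
  have "norm (nrm (\<lambda>x. X n x - u x) - 0) < \<epsilon>" if n: "n \<ge> max N N'" for n
  proof -
    have rn: "n \<le> r n" by (rule seq_suble[OF r])
    have "nrm (\<lambda>x. X n x - X (r n) x) < \<epsilon> / 2" using N n rn by simp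
    moreover have "nrm (\<lambda>x. X (r n) x - u x) < \<epsilon> / 2" using N'[of n] n by simp
    ultimately have "nrm (\<lambda>x. X n x - u x) < \<epsilon>"
      using nrm_triangle_diff[OF X[of n] X[of "r n"] u] by linarith
    then show ?thesis using nrm_nonneg[OF diff_mem[OF X u]] by simp
  qed
  then show "\<exists>no. \<forall>n\<ge>no. norm (nrm (\<lambda>x. X n x - u x) - 0) < \<epsilon>" by blast
qed

end

lemma minimizing_sequence:
  fixes J :: "'a \<Rightarrow> real"
  assumes "A \<noteq> {}" and "\<And>u. u \<in> A \<Longrightarrow> B \<le> J u"
  obtains m X where "\<And>u. u \<in> A \<Longrightarrow> m \<le> J u" "\<And>n. X n \<in> A" "(\<lambda>n. J (X n)) \<longlonglongrightarrow> m"
proof -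
  define m where "m = Inf (J ` A)"
  have bdd: "bdd_below (J ` A)" using assms(2) by (intro bdd_belowI[of _ B]) auto
  have "\<exists>u\<in>A. J u < m + inverse (real (Suc n))" for n
    using cInf_lessD[of "J ` A" "m + inverse (real (Suc n))"] assms(1) by (auto simp: m_def)
  then obtain X where X: "\<And>n. X n \<in> A" "\<And>n. J (X n) < m + inverse (real (Suc n))"
    by metis
  have low: "m \<le> J u" if "u \<in> A" for u
    unfolding m_def using bdd that by (intro cInf_lower) auto
  have "(\<lambda>n. J (X n)) \<longlonglongrightarrow> m"
  proof (rule tendsto_sandwich[OF _ _ tendsto_const])
    show "(\<lambda>n. m + inverse (real (Suc n))) \<longlonglongrightarrow> m"
      using tendsto_add[OF tendsto_const LIMSEQ_inverse_real_of_nat, of m] by simp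
    show "\<forall>\<^sub>F n in sequentially. m \<le> J (X n)"
      using X low by simp
    show "\<forall>\<^sub>F n in sequentially. J (X n) \<le> m + inverse (real (Suc n))"
      using X(2) less_imp_le by (intro always_eventually) blast
  qed
  with X low that show thesis by blast
qed

section \<open>Forms with a compact embedding have discrete spectrum\<close>

text \<open>The situation of a form \<open>q \<ge> 1\<close> that is closed (its domain \<open>D\<close> is complete) and whose domain embeds
compactly into the ambient space \<open>L\<close>. The operator of the form maps \<open>u\<close> to \<open>f\<close> when
\<open>q(u,v) = \<langle>f,v\<rangle>\<close> for all \<open>v \<in> D\<close>.\<close>

locale compactly_embedded_form = L: semi_inner_product L ip + Q: semi_inner_product D q
  for L :: "('x \<Rightarrow> complex) set" and ip and D :: "('x \<Rightarrow> complex) set" and q +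
  assumes D_subset: "D \<subseteq> L"
    and sqn_le: "u \<in> D \<Longrightarrow> L.sqn u \<le> Q.sqn u"
    and form_complete: "(\<And>n::nat. X n \<in> D) \<Longrightarrow> Q.ip_cauchy X \<Longrightarrow> \<exists>u\<in>D. Q.ip_lim X u"
    and form_compact: "(\<And>n::nat. X n \<in> D) \<Longrightarrow> (\<And>n. Q.sqn (X n) \<le> C)
      \<Longrightarrow> \<exists>r. strict_mono r \<and> L.ip_cauchy (X \<circ> r)"
begin

lemma D_L: "u \<in> D \<Longrightarrow> u \<in> L"
  using D_subset by blast

lemma nrm_le: "u \<in> D \<Longrightarrow> L.nrm u \<le> Q.nrm u"
  by (simp add: L.nrm_def Q.nrm_def sqn_le)

lemma form_lim_imp_lim:
  assumes X: "\<And>n. X n \<in> D" and u: "u \<in> D" and lim: "Q.ip_lim X u"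
  shows "L.ip_lim X u"
  unfolding L.ip_lim_def
proof (rule Lim_null_comparison)
  show "\<forall>\<^sub>F n in sequentially. norm (L.nrm (\<lambda>x. X n x - u x)) \<le> Q.nrm (\<lambda>x. X n x - u x)"
    using nrm_le[OF Q.diff_mem[OF X u]] L.nrm_nonneg[OF D_L[OF Q.diff_mem[OF X u]]] by simp
qed (use lim in \<open>simp add: Q.ip_lim_def\<close>)

text \<open>This inverts the operator of \<open>q\<close>. The solution minimizes \<open>J(u) = q(u,u) - 2 Re \<langle>f,u\<rangle>\<close>: by the
parallelogram law minimizing sequences are Cauchy for \<open>q\<close>, and the equation is the vanishing of the
first variation at the minimum.\<close>

lemma form_representation:
  assumes f: "f \<in> L"
  shows "\<exists>u\<in>D. \<forall>v\<in>D. q u v = ip f v"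
proof -
  define J where "J u = Q.sqn u - 2 * Re (ip f u)" for u
  have lower: "- L.sqn f \<le> J u" if u: "u \<in> D" for u
  proof -
    have "0 \<le> L.sqn (\<lambda>x. f x - u x)"
      by (intro L.sqn_nonneg L.diff_mem f D_L u)
    then show ?thesis
      using sqn_le[OF u] by (simp add: L.sqn_diff f D_L u J_def)
  qed
  obtain m X where m: "\<And>u. u \<in> D \<Longrightarrow> m \<le> J u" and X: "\<And>n::nat. X n \<in> D"
    and lim: "(\<lambda>n. J (X n)) \<longlonglongrightarrow> m"
    by (rule minimizing_sequence[of D "- L.sqn f" J]) (use Q.zero_mem lower in auto)
  have par: "Q.sqn (\<lambda>x. u x - v x) \<le> 2 * (J u - m) + 2 * (J v - m)" if u: "u \<in> D" and v: "v \<in> D" for u v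
  proof -
    \<comment> \<open>comparing with the value of J at the midpoint\<close>
    define w where "w = (\<lambda>x. (1/2) * (u x + v x))"
    have uv: "(\<lambda>x. u x + v x) \<in> D" by (rule Q.add_mem[OF u v])
    have w: "w \<in> D" unfolding w_def by (rule Q.scale_mem[OF uv])
    have "Q.sqn w = Q.sqn (\<lambda>x. u x + v x) / 4"
      unfolding w_def Q.sqn_scale[OF uv] by (simp add: power2_eq_square)
    moreover have "Re (ip f w) = (Re (ip f u) + Re (ip f v)) / 2"
      unfolding w_def L.ip_scale_right[OF D_L[OF uv] f] L.ip_add_right[OF D_L[OF u] D_L[OF v] f] by simp
    moreover have "m \<le> J w" by (rule m[OF w])
    ultimately show ?thesis
      using Q.parallelogram[OF u v] by (simp add: J_def)
  qed
  have "Q.ip_cauchy X"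
  proof (rule Q.ip_cauchy_sqnI[OF X])
    fix \<epsilon> :: real assume "\<epsilon> > 0"
    then have "\<forall>\<^sub>F n in sequentially. J (X n) < m + \<epsilon> / 4"
      by (intro order_tendstoD(2)[OF lim]) simp
    then obtain N where N: "J (X n) < m + \<epsilon> / 4" if "n \<ge> N" for n
      unfolding eventually_sequentially by blast
    have "Q.sqn (\<lambda>x. X m x - X n x) < \<epsilon>" if "m \<ge> N" "n \<ge> N" for m n
      using par[OF X[of m] X[of n]] N[OF that(1)] N[OF that(2)] by simp
    then show "\<exists>N. \<forall>m\<ge>N. \<forall>n\<ge>N. Q.sqn (\<lambda>x. X m x - X n x) < \<epsilon>" by blast
  qed
  then obtain u where u: "u \<in> D" and Xu: "Q.ip_lim X u" using form_complete[of X, OF X] by blast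
  have ipfu: "(\<lambda>n. ip f (X n)) \<longlonglongrightarrow> ip f u"
    using tendsto_cnj[OF L.ip_lim_ip[OF D_L[OF X] D_L[OF u] form_lim_imp_lim[OF X u Xu] f]]
    by (simp add: L.ip_herm[OF D_L f, symmetric] X u)
  have "(\<lambda>n. J (X n)) \<longlonglongrightarrow> J u"
    unfolding J_def by (intro tendsto_intros Q.ip_lim_sqn[OF X u Xu] ipfu)
  then have Ju: "J u = m" using lim LIMSEQ_unique by blast
  show ?thesis
  proof (intro bexI ballI)
    fix v assume v: "v \<in> D"
    define z where "z = q u v - ip f v"
    have *: "0 \<le> 2 * Re (cnj c * z) + (cmod c)\<^sup>2 * Q.sqn v" for c
    proof -
      have "m \<le> J (\<lambda>x. u x + c * v x)" by (intro m Q.comb_mem u v)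
      also have "J (\<lambda>x. u x + c * v x) = J u + 2 * Re (cnj c * z) + (cmod c)\<^sup>2 * Q.sqn v"
        by (simp add: J_def Q.sqn_comb[OF u v] L.ip_comb_right[OF D_L[OF u] D_L[OF v] f] z_def algebra_simps)
      finally show ?thesis using Ju by simp
    qed
    \<comment> \<open>a step so short that the quadratic term cannot compensate the linear one\<close>
    define t where "t = inverse (Q.sqn v + 1)"
    have t: "t > 0" "t * Q.sqn v < 1"
      using Q.sqn_nonneg[OF v] by (auto simp: t_def field_simps)
    have "Re (cnj (of_real (-t) * z) * z) = - t * (cmod z)\<^sup>2"
      by (simp add: cmod_power2) (simp add: power2_eq_square algebra_simps)
    from *[of "of_real (-t) * z", unfolded this]
    have "0 \<le> - 2 * t * (cmod z)\<^sup>2 + t\<^sup>2 * (cmod z)\<^sup>2 * Q.sqn v"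
      by (simp add: norm_mult power_mult_distrib mult.assoc)
    also have "\<dots> = - (t * (cmod z)\<^sup>2 * (2 - t * Q.sqn v))"
      by (simp add: power2_eq_square algebra_simps)
    finally have "t * (cmod z)\<^sup>2 * (2 - t * Q.sqn v) \<le> 0" by simp
    then have "z = 0" using t by (simp add: mult_le_0_iff)
    then show "q u v = ip f v" by (simp add: z_def)
  qed (rule u)
qed

text \<open>The orthogonal complement is taken in the inner product of \<open>L\<close>; for eigenvectors it is also the
complement with respect to \<open>q\<close>.\<close>

definition perp :: "('x \<Rightarrow> complex) set \<Rightarrow> ('x \<Rightarrow> complex) set" where
  "perp E = {u \<in> D. \<forall>e\<in>E. ip u e = 0}"

text \<open>The eigenvalue of a normalized eigenvector \<open>e\<close> is \<open>q(e,e)\<close>, so it needs no separate name.\<close>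

definition orthonormal_eigensystem :: "('x \<Rightarrow> complex) set \<Rightarrow> bool" where
  "orthonormal_eigensystem E \<longleftrightarrow> finite E \<and> E \<subseteq> D \<and> (\<forall>e\<in>E. L.sqn e = 1) \<and>
     (\<forall>e\<in>E. \<forall>e'\<in>E. e \<noteq> e' \<longrightarrow> ip e e' = 0) \<and>
     (\<forall>e\<in>E. \<forall>v\<in>D. q e v = of_real (Q.sqn e) * ip e v)"

lemma perp_D: "u \<in> perp E \<Longrightarrow> u \<in> D"
  by (simp add: perp_def)

lemma perp_comb: "E \<subseteq> D \<Longrightarrow> u \<in> perp E \<Longrightarrow> v \<in> perp E \<Longrightarrow> (\<lambda>x. u x + c * v x) \<in> perp E"
  by (auto simp: perp_def Q.comb_mem L.ip_comb_left D_L subset_iff)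

lemma perp_diff: "E \<subseteq> D \<Longrightarrow> u \<in> perp E \<Longrightarrow> v \<in> perp E \<Longrightarrow> (\<lambda>x. u x - v x) \<in> perp E"
  using perp_comb[of E u v "-1"] by simp

lemma perp_zero: "E \<subseteq> D \<Longrightarrow> (\<lambda>x. 0) \<in> perp E"
  by (auto simp: perp_def Q.zero_mem L.ip_zero_left D_L subset_iff)

lemma perp_closed:
  assumes E: "E \<subseteq> D" and X: "\<And>n. X n \<in> perp E" and u: "u \<in> D" and lim: "Q.ip_lim X u"
  shows "u \<in> perp E"
proof -
  have XD: "X n \<in> D" for n using X by (rule perp_D)
  have "ip u e = 0" if e: "e \<in> E" for e
  proof -
    have "(\<lambda>n. ip (X n) e) \<longlonglongrightarrow> ip u e"
      by (rule L.ip_lim_ip[OF D_L[OF XD] D_L[OF u] form_lim_imp_lim[OF XD u lim] D_L]) (use e E in auto)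
    moreover have "(\<lambda>n. ip (X n) e) = (\<lambda>n. 0)" using X e by (simp add: perp_def)
    ultimately show ?thesis by (simp add: LIMSEQ_const_iff)
  qed
  then show ?thesis by (simp add: perp_def u)
qed

lemma
  assumes "orthonormal_eigensystem E"
  shows ons_finite: "finite E" and ons_D: "E \<subseteq> D" and ons_sqn: "\<And>e. e \<in> E \<Longrightarrow> L.sqn e = 1"
    and ons_orth: "\<And>e e'. e \<in> E \<Longrightarrow> e' \<in> E \<Longrightarrow> e \<noteq> e' \<Longrightarrow> ip e e' = 0"
    and ons_eig: "\<And>e v. e \<in> E \<Longrightarrow> v \<in> D \<Longrightarrow> q e v = of_real (Q.sqn e) * ip e v"
  using assms by (auto simp: orthonormal_eigensystem_def)

lemma ons_eig_right:
  assumes E: "orthonormal_eigensystem E" and e: "e \<in> E" and v: "v \<in> D"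
  shows "q v e = of_real (Q.sqn e) * ip v e"
proof -
  have eD: "e \<in> D" using ons_D[OF E] e by blast
  show ?thesis
    using ons_eig[OF E e v] Q.ip_herm[OF eD v] L.ip_herm[OF D_L[OF eD] D_L[OF v]] by simp
qed

lemma projection_orthogonal:
  assumes E: "orthonormal_eigensystem E" and f: "f \<in> L" and e: "e \<in> E"
  shows "ip (\<lambda>x. f x - (\<Sum>e\<in>E. ip f e * e x)) e = 0"
proof -
  have EL: "E \<subseteq> L" using ons_D[OF E] D_subset by blast
  have "ip (\<lambda>x. \<Sum>e\<in>E. ip f e * e x) e = (\<Sum>e'\<in>E. ip f e' * ip e' e)"
    using EL e by (intro L.ip_sum_left ons_finite[OF E]) auto
  also have "\<dots> = (\<Sum>e'\<in>E. if e' = e then ip f e else 0)"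
    using ons_orth[OF E] ons_sqn[OF E] e L.ip_self EL by (intro sum.cong) auto
  also have "\<dots> = ip f e" using e ons_finite[OF E] by simp
  finally show ?thesis
    using EL e ons_finite[OF E] by (subst L.ip_diff_left) (auto intro!: L.sum_mem f)
qed

lemma projection_perp:
  assumes E: "orthonormal_eigensystem E" and u: "u \<in> D"
  shows "(\<lambda>x. u x - (\<Sum>e\<in>E. ip u e * e x)) \<in> perp E"
  using projection_orthogonal[OF E D_L[OF u]]
  by (auto simp: perp_def intro!: Q.diff_mem Q.sum_mem u ons_finite[OF E] ons_D[OF E])

text \<open>A minimizing sequence of \<open>q\<close> on the unit sphere of the complement has a subsequence that is Cauchy in
\<open>L\<close>. The parallelogram law then makes it Cauchy for \<open>q\<close>: the midpoints have norm close to 1, so their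
energy is not much below the minimum \<open>m\<close>. For the limit \<open>u\<close>, the form \<open>q - m\<langle>\<cdot>,\<cdot>\<rangle>\<close> is
nonnegative on the complement and vanishes at \<open>u\<close>, so by Cauchy-Schwarz \<open>u\<close> lies in its kernel.\<close>

lemma ground_state:
  assumes E: "orthonormal_eigensystem E" and w: "w \<in> perp E" "L.sqn w \<noteq> 0"
  shows "\<exists>u\<in>perp E. orthonormal_eigensystem (insert u E) \<and> L.sqn u = 1 \<and>
    (\<forall>v\<in>perp E. Q.sqn u * L.sqn v \<le> Q.sqn v)"
proof -
  note ED = ons_D[OF E]
  define A where "A = {u \<in> perp E. L.sqn u = 1}"
  have normalize: "(\<lambda>x. of_real (1 / L.nrm v) * v x) \<in> A" if v: "v \<in> perp E" "L.sqn v \<noteq> 0" for v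
  proof -
    have vL: "v \<in> L" using v perp_D D_L by blast
    have "(\<lambda>x. 0 + of_real (1 / L.nrm v) * v x) \<in> perp E" by (intro perp_comb ED perp_zero v)
    moreover have "L.sqn (\<lambda>x. of_real (1 / L.nrm v) * v x) = 1"
      unfolding L.sqn_scale[OF vL] using v(2) L.nrm_sq[OF vL]
      by (simp add: power_divide norm_divide)
    ultimately show ?thesis by (simp add: A_def)
  qed
  have "A \<noteq> {}" using normalize[OF w] by blast
  then obtain m X where m: "\<And>u. u \<in> A \<Longrightarrow> m \<le> Q.sqn u" and X: "\<And>n::nat. X n \<in> A"
    and lim: "(\<lambda>n. Q.sqn (X n)) \<longlonglongrightarrow> m"
  proof (rule minimizing_sequence[of A 0 Q.sqn])
    show "0 \<le> Q.sqn v" if "v \<in> A" for v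
      using that perp_D[of v E] Q.sqn_nonneg[of v] by (simp add: A_def)
  qed (use that in blast)+
  have XD: "X n \<in> D" and XE: "X n \<in> perp E" and X1: "L.sqn (X n) = 1" for n
    using X[of n] by (auto simp: A_def perp_def)
  have m0: "0 \<le> m" using LIMSEQ_le_const[OF lim] Q.sqn_nonneg[OF XD] by blast
  have low: "m * L.sqn v \<le> Q.sqn v" if v: "v \<in> perp E" for v
  proof (cases "L.sqn v = 0")
    case False
    have vD: "v \<in> D" using v by (rule perp_D)
    have "m \<le> Q.sqn (\<lambda>x. of_real (1 / L.nrm v) * v x)" by (rule m[OF normalize[OF v False]])
    also have "\<dots> = Q.sqn v / L.sqn v"
      unfolding Q.sqn_scale[OF vD] using L.nrm_sq[OF D_L[OF vD]] by (simp add: norm_divide power_divide)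
    finally show ?thesis
      using False L.sqn_nonneg[OF D_L[OF vD]] by (simp add: field_simps)
  qed (use Q.sqn_nonneg perp_D v in auto)
  obtain C where C: "\<And>n. Q.sqn (X n) \<le> C"
    using Bseq_eq_bounded convergent_imp_Bseq[OF convergentI[OF lim]] by (auto simp: Bseq_def abs_le_iff)
  obtain r where r: "strict_mono r" and rc: "L.ip_cauchy (X \<circ> r)"
    using form_compact[of X, OF XD C] by blast
  define Y where "Y = X \<circ> r"
  have YD: "Y n \<in> D" and YE: "Y n \<in> perp E" and Y1: "L.sqn (Y n) = 1" for n
    by (simp_all add: Y_def XD XE X1)
  have limY: "(\<lambda>n. Q.sqn (Y n)) \<longlonglongrightarrow> m"
    using LIMSEQ_subseq_LIMSEQ[OF lim r] by (simp add: Y_def o_def)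
  have par: "Q.sqn (\<lambda>x. Y i x - Y j x)
      \<le> 2 * (Q.sqn (Y i) - m) + 2 * (Q.sqn (Y j) - m) + m * L.sqn (\<lambda>x. Y i x - Y j x)" for i j
  proof -
    have "(\<lambda>x. Y i x + 1 * Y j x) \<in> perp E" by (intro perp_comb ED YE)
    then have "m * L.sqn (\<lambda>x. Y i x + Y j x) \<le> Q.sqn (\<lambda>x. Y i x + Y j x)"
      by (simp add: low)
    moreover have "L.sqn (\<lambda>x. Y i x + Y j x) = 4 - L.sqn (\<lambda>x. Y i x - Y j x)"
      using L.parallelogram[OF D_L[OF YD] D_L[OF YD], of i j] by (simp add: Y1)
    ultimately show ?thesis
      using Q.parallelogram[OF YD[of i] YD[of j]] by (simp add: algebra_simps)
  qed
  have "Q.ip_cauchy Y"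
  proof (rule Q.ip_cauchy_sqnI[OF YD])
    fix \<epsilon> :: real assume "\<epsilon> > 0"
    then have "\<forall>\<^sub>F n in sequentially. Q.sqn (Y n) < m + \<epsilon> / 8"
      by (intro order_tendstoD(2)[OF limY]) simp
    then obtain N where N: "Q.sqn (Y n) < m + \<epsilon> / 8" if "n \<ge> N" for n
      unfolding eventually_sequentially by blast
    obtain N' where N': "L.sqn (\<lambda>x. Y i x - Y j x) < \<epsilon> / (2 * (m + 1))" if "i \<ge> N'" "j \<ge> N'" for i j
      using L.ip_cauchy_sqnD[OF D_L[OF YD] rc[folded Y_def], of "\<epsilon> / (2 * (m + 1))"] \<open>\<epsilon> > 0\<close> m0 by auto
    have "Q.sqn (\<lambda>x. Y i x - Y j x) < \<epsilon>" if "i \<ge> max N N'" "j \<ge> max N N'" for i j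
    proof -
      have "m * L.sqn (\<lambda>x. Y i x - Y j x) \<le> m * (\<epsilon> / (2 * (m + 1)))"
        using N'[of i j] that m0 by (intro mult_left_mono) auto
      also have "\<dots> \<le> \<epsilon> / 2" using \<open>\<epsilon> > 0\<close> m0 by (simp add: field_simps)
      finally show ?thesis using par[of i j] N[of i] N[of j] that by simp
    qed
    then show "\<exists>N. \<forall>m\<ge>N. \<forall>n\<ge>N. Q.sqn (\<lambda>x. Y m x - Y n x) < \<epsilon>" by blast
  qed
  then obtain u where u: "u \<in> D" and Yu: "Q.ip_lim Y u" using form_complete[of Y, OF YD] by blast
  have uE: "u \<in> perp E" by (rule perp_closed[OF ED YE u Yu])
  have Qu: "Q.sqn u = m"
    using LIMSEQ_unique[OF Q.ip_lim_sqn[OF YD u Yu] limY] .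
  have "(\<lambda>n. L.sqn (Y n)) \<longlonglongrightarrow> L.sqn u"
    by (rule L.ip_lim_sqn[OF D_L[OF YD] D_L[OF u] form_lim_imp_lim[OF YD u Yu]])
  then have Lu: "L.sqn u = 1" by (simp add: Y1 LIMSEQ_const_iff)
  interpret B: semi_inner_product "perp E" "\<lambda>u v. q u v - of_real m * ip u v"
  proof
    show "(\<lambda>x. 0) \<in> perp E" by (rule perp_zero[OF ED])
  next
    fix u v c assume "u \<in> perp E" "v \<in> perp E"
    then show "(\<lambda>x. u x + c * v x) \<in> perp E" by (rule perp_comb[OF ED])
  next
    fix u v w c assume *: "u \<in> perp E" "v \<in> perp E" "w \<in> perp E"
    then have "u \<in> D" "v \<in> D" "w \<in> D" using perp_D by auto
    then show "q (\<lambda>x. u x + c * v x) w - of_real m * ip (\<lambda>x. u x + c * v x) w =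
        q u w - of_real m * ip u w + c * (q v w - of_real m * ip v w)"
      by (simp add: Q.ip_comb_left L.ip_comb_left D_L algebra_simps)
  next
    fix u v assume "u \<in> perp E" "v \<in> perp E"
    then have "u \<in> D" "v \<in> D" using perp_D by auto
    then show "q v u - of_real m * ip v u = cnj (q u v - of_real m * ip u v)"
      by (simp add: Q.ip_herm[of u v] L.ip_herm[of u v] D_L)
  next
    fix u assume "u \<in> perp E"
    then show "0 \<le> Re (q u u - of_real m * ip u u)"
      using low[of u] by (simp add: Q.sqn_def L.sqn_def)
  qed
  have eig_perp: "q u v = of_real m * ip u v" if v: "v \<in> perp E" for v
  proof -
    have "B.sqn u = 0" using Qu Lu by (simp add: B.sqn_def Q.sqn_def L.sqn_def)
    then show ?thesis using B.Cauchy_Schwarz_sqn[OF uE v] by simp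
  qed
  have uperp: "ip u e = 0" if "e \<in> E" for e using uE that by (simp add: perp_def)
  have eig: "q u v = of_real m * ip u v" if v: "v \<in> D" for v
  proof -
    \<comment> \<open>u is orthogonal to the old eigenvectors in both senses, so it suffices to test on the complement\<close>
    define s where "s = (\<lambda>x. \<Sum>e\<in>E. ip v e * e x)"
    have s: "s \<in> D" unfolding s_def by (intro Q.sum_mem ons_finite[OF E] ED)
    have "q s u = 0"
      unfolding s_def using ons_eig[OF E _ u] uperp L.ip_herm[OF D_L[OF u] D_L] ED
      by (subst Q.ip_sum_left[OF ons_finite[OF E] ED u]) (auto intro!: sum.neutral)
    moreover have "ip s u = 0"
      unfolding s_def using uperp L.ip_herm[OF D_L[OF u] D_L] ED D_subset
      by (subst L.ip_sum_left[OF ons_finite[OF E] _ D_L[OF u]]) (auto intro!: sum.neutral)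
    moreover have "(\<lambda>x. v x - s x) \<in> perp E" unfolding s_def by (rule projection_perp[OF E v])
    ultimately show ?thesis
      using eig_perp[of "\<lambda>x. v x - s x"] Q.ip_herm[OF s u] L.ip_herm[OF D_L[OF s] D_L[OF u]]
      by (simp add: Q.ip_diff_right L.ip_diff_right D_L u v s)
  qed
  have "orthonormal_eigensystem (insert u E)"
    unfolding orthonormal_eigensystem_def
  proof (intro conjI ballI impI)
    show "finite (insert u E)" "insert u E \<subseteq> D" using ons_finite[OF E] ED u by auto
  next
    fix e assume "e \<in> insert u E" then show "L.sqn e = 1" using Lu ons_sqn[OF E] by auto
  next
    fix e e' assume e: "e \<in> insert u E" "e' \<in> insert u E" "e \<noteq> e'"
    have "ip e u = 0" if "e \<in> E" for e
      using uperp[OF that] L.ip_herm[OF D_L[OF u] D_L, of e] ED that by auto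
    then show "ip e e' = 0" using e ons_orth[OF E] uperp by blast
  next
    fix e v assume "e \<in> insert u E" "v \<in> D"
    then show "q e v = of_real (Q.sqn e) * ip e v" using eig ons_eig[OF E] Qu by blast
  qed
  then show ?thesis using uE Lu low Qu by blast
qed

text \<open>Otherwise ground states could be added for ever, all with energy at most \<open>\<Lambda>\<close>. They form a
sequence bounded in \<open>D\<close> whose members have mutual distance \<open>\<surd>2\<close>, contrary to compactness.\<close>

lemma eigensystem_exhausts_low_energies:
  "\<exists>E. orthonormal_eigensystem E \<and> (\<forall>v\<in>perp E. \<Lambda> * L.sqn v \<le> Q.sqn v)"
proof (rule ccontr)
  assume contra: "\<not> ?thesis"
  have "\<exists>u. orthonormal_eigensystem E \<longrightarrow>
      u \<in> perp E \<and> orthonormal_eigensystem (insert u E) \<and> L.sqn u = 1 \<and> Q.sqn u \<le> \<Lambda>" for E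
  proof (cases "orthonormal_eigensystem E")
    case E: True
    obtain v where v: "v \<in> perp E" "Q.sqn v < \<Lambda> * L.sqn v" using contra E by force
    have v0: "0 \<le> L.sqn v" "0 \<le> Q.sqn v"
      using v perp_D D_L L.sqn_nonneg Q.sqn_nonneg by blast+
    then have ne: "L.sqn v \<noteq> 0" using v by auto
    obtain u where u: "u \<in> perp E" "orthonormal_eigensystem (insert u E)" "L.sqn u = 1"
      "\<forall>v\<in>perp E. Q.sqn u * L.sqn v \<le> Q.sqn v"
      using ground_state[OF E v(1) ne] by blast
    then have "Q.sqn u * L.sqn v < \<Lambda> * L.sqn v" using v by force
    then have "Q.sqn u < \<Lambda>" using v0 by (simp add: mult_less_cancel_right)
    then have "Q.sqn u \<le> \<Lambda>" by simp
    with u show ?thesis by blast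
  qed simp
  then have "\<forall>E. \<exists>u. orthonormal_eigensystem E \<longrightarrow>
      u \<in> perp E \<and> orthonormal_eigensystem (insert u E) \<and> L.sqn u = 1 \<and> Q.sqn u \<le> \<Lambda>" by blast
  from choice[OF this] obtain pick where pick: "\<And>E. orthonormal_eigensystem E \<Longrightarrow> pick E \<in> perp E"
      "\<And>E. orthonormal_eigensystem E \<Longrightarrow> orthonormal_eigensystem (insert (pick E) E)"
      "\<And>E. orthonormal_eigensystem E \<Longrightarrow> L.sqn (pick E) = 1"
      "\<And>E. orthonormal_eigensystem E \<Longrightarrow> Q.sqn (pick E) \<le> \<Lambda>" by blast
  define F where "F = rec_nat {} (\<lambda>_ E. insert (pick E) E)"
  have F0: "F 0 = {}" and FS: "F (Suc n) = insert (pick (F n)) (F n)" for n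
    by (simp_all add: F_def)
  have F: "orthonormal_eigensystem (F n)" for n
    by (induction n) (simp_all add: F0 FS pick, simp add: orthonormal_eigensystem_def)
  define X where "X n = pick (F n)" for n
  have XD: "X n \<in> D" and X1: "L.sqn (X n) = 1" and XQ: "Q.sqn (X n) \<le> \<Lambda>" for n
    unfolding X_def using pick[OF F[of n]] perp_D[of "pick (F n)" "F n"] by simp_all
  have mono: "F m \<subseteq> F n" if "m \<le> n" for m n
    using that by (induction rule: dec_induct) (auto simp: FS)
  have orth: "ip (X n) (X m) = 0" if "m < n" for m n
  proof -
    have "X m \<in> F (Suc m)" by (simp add: FS X_def)
    then have "X m \<in> F n" using mono[of "Suc m" n] that by auto
    then show ?thesis using pick(1)[OF F[of n]] by (simp add: perp_def X_def)
  qed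
  obtain r where r: "strict_mono r" and rc: "L.ip_cauchy (X \<circ> r)"
    using form_compact[of X, OF XD XQ] by blast
  have Xr: "(X \<circ> r) n \<in> L" for n by (simp add: D_L XD)
  obtain N where N: "\<forall>m\<ge>N. \<forall>n\<ge>N. L.sqn (\<lambda>x. (X \<circ> r) m x - (X \<circ> r) n x) < 2"
    using L.ip_cauchy_sqnD[OF Xr rc, of 2] by auto
  have "r N < r (Suc N)" using r by (simp add: strict_mono_less)
  then have "L.sqn (\<lambda>x. (X \<circ> r) (Suc N) x - (X \<circ> r) N x) = 2"
    using orth by (simp add: L.sqn_diff D_L XD X1)
  then show False using N[rule_format, of "Suc N" N] by simp
qed

lemma perp_form_nrm:
  assumes "u \<in> D" "\<Lambda> * L.sqn u \<le> Q.sqn u" "0 \<le> \<Lambda>"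
  shows "sqrt \<Lambda> * L.nrm u \<le> Q.nrm u"
  unfolding L.nrm_def Q.nrm_def real_sqrt_mult[symmetric] using assms by simp

text \<open>The equation \<open>q(u,v) = \<langle>f + \<mu>u, v\<rangle>\<close> is a fixed-point problem for \<open>u \<mapsto> R(f + \<mu>u)\<close>, where \<open>R\<close> inverts the
operator of \<open>q\<close>. On the complement of the eigensystem, \<open>\<surd>\<Lambda>\<close> times the norm of \<open>L\<close> is below the form
norm, which makes the map a contraction in the form norm with factor \<open>\<bar>\<mu>\<bar>/\<Lambda>\<close>. This also covers
nonreal \<open>\<mu>\<close>, for which the equation has no variational formulation.\<close>

lemma resolvent_on_perp:
  assumes E: "orthonormal_eigensystem E"
    and low: "\<And>v. v \<in> perp E \<Longrightarrow> \<Lambda> * L.sqn v \<le> Q.sqn v"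
    and \<mu>: "cmod \<mu> < \<Lambda>"
    and f: "f \<in> L" and fE: "\<And>e. e \<in> E \<Longrightarrow> ip f e = 0"
  shows "\<exists>u\<in>perp E. \<forall>v\<in>D. q u v = ip (\<lambda>x. f x + \<mu> * u x) v"
proof -
  note ED = ons_D[OF E]
  have \<Lambda>: "\<Lambda> > 0" using \<mu> norm_ge_zero[of \<mu>] by linarith
  have "\<forall>g. \<exists>u. g \<in> L \<longrightarrow> u \<in> D \<and> (\<forall>v\<in>D. q u v = ip g v)"
    using form_representation by blast
  from choice[OF this] obtain R where R: "\<And>g. g \<in> L \<Longrightarrow> R g \<in> D"
      "\<And>g v. g \<in> L \<Longrightarrow> v \<in> D \<Longrightarrow> q (R g) v = ip g v" by blast
  have R_perp: "R g \<in> perp E" if g: "g \<in> L" and gE: "\<And>e. e \<in> E \<Longrightarrow> ip g e = 0" for g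
  proof -
    have "ip (R g) e = 0" if e: "e \<in> E" for e
    proof -
      have eD: "e \<in> D" using e ED by blast
      have "of_real (Q.sqn e) * ip (R g) e = 0"
        using R(2)[OF g eD] gE[OF e] ons_eig_right[OF E e R(1)[OF g]] by simp
      moreover have "Q.sqn e \<ge> 1" using sqn_le[OF eD] ons_sqn[OF E e] by simp
      ultimately show ?thesis by auto
    qed
    then show ?thesis by (simp add: perp_def R(1) g)
  qed
  define X where "X = rec_nat (\<lambda>x. 0) (\<lambda>_ u. R (\<lambda>x. f x + \<mu> * u x))"
  have XS: "X (Suc n) = R (\<lambda>x. f x + \<mu> * X n x)" and X0: "X 0 = (\<lambda>x. 0)" for n
    by (simp_all add: X_def)
  have step_mem: "(\<lambda>x. f x + \<mu> * u x) \<in> L" if "u \<in> perp E" for u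
    by (intro L.comb_mem f D_L perp_D[OF that])
  have XE: "X n \<in> perp E" for n
  proof (induction n)
    case 0 show ?case unfolding X0 by (rule perp_zero[OF ED])
  next
    case (Suc n)
    have "ip (\<lambda>x. f x + \<mu> * X n x) e = 0" if "e \<in> E" for e
    proof -
      have "e \<in> D" using that ED by blast
      then show ?thesis
        using fE[OF that] Suc that
        by (subst L.ip_comb_left[OF f D_L[OF perp_D[OF Suc]] D_L]) (auto simp: perp_def)
    qed
    then show ?case unfolding XS by (intro R_perp step_mem Suc)
  qed
  have XD: "X n \<in> D" for n using XE by (rule perp_D)
  have XSq: "q (X (Suc n)) v = ip f v + \<mu> * ip (X n) v" if v: "v \<in> D" for n v
    unfolding XS using R(2)[OF step_mem[OF XE] v] by (simp add: L.ip_comb_left f D_L XD v)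
  define r where "r = cmod \<mu> / \<Lambda>"
  have r: "0 \<le> r" "r < 1" using \<mu> \<Lambda> by (auto simp: r_def)
  define d where "d n = (\<lambda>x. X (Suc n) x - X n x)" for n
  have dE: "d n \<in> perp E" for n unfolding d_def by (intro perp_diff ED XE)
  have dD: "d n \<in> D" for n using dE by (rule perp_D)
  have contract: "Q.nrm (d (Suc n)) \<le> r * Q.nrm (d n)" for n
  proof -
    have eq: "q (d (Suc n)) (d (Suc n)) = \<mu> * ip (d n) (d (Suc n))"
    proof -
      have "q (d (Suc n)) w = \<mu> * ip (d n) w" if w: "w \<in> D" for w
        unfolding d_def Q.ip_diff_left[OF XD XD w] L.ip_diff_left[OF D_L[OF XD] D_L[OF XD] D_L[OF w]]
          XSq[OF w] by (simp add: right_diff_distrib)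
      then show ?thesis using dD by blast
    qed
    have "(Q.nrm (d (Suc n)))\<^sup>2 = Re (\<mu> * ip (d n) (d (Suc n)))"
      unfolding Q.nrm_sq[OF dD] using eq by (simp add: Q.sqn_def)
    also have "\<dots> \<le> cmod (\<mu> * ip (d n) (d (Suc n)))" by (rule complex_Re_le_cmod)
    also have "\<dots> \<le> cmod \<mu> * (L.nrm (d n) * L.nrm (d (Suc n)))"
      unfolding norm_mult by (intro mult_left_mono L.Cauchy_Schwarz D_L dD norm_ge_zero)
    also have "\<dots> = r * ((sqrt \<Lambda> * L.nrm (d n)) * (sqrt \<Lambda> * L.nrm (d (Suc n))))"
    proof -
      have "r * ((sqrt \<Lambda> * L.nrm (d n)) * (sqrt \<Lambda> * L.nrm (d (Suc n))))
          = r * (sqrt \<Lambda> * sqrt \<Lambda>) * (L.nrm (d n) * L.nrm (d (Suc n)))"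
        by (simp only: mult_ac)
      also have "sqrt \<Lambda> * sqrt \<Lambda> = \<Lambda>" using \<Lambda> by simp
      finally show ?thesis using \<Lambda> by (simp add: r_def)
    qed
    also have "\<dots> \<le> r * (Q.nrm (d n) * Q.nrm (d (Suc n)))"
      using \<Lambda> by (intro mult_left_mono mult_mono perp_form_nrm dD low dE r(1) Q.nrm_nonneg
          mult_nonneg_nonneg L.nrm_nonneg D_L) auto
    finally have "Q.nrm (d (Suc n)) * Q.nrm (d (Suc n)) \<le> (r * Q.nrm (d n)) * Q.nrm (d (Suc n))"
      by (simp add: power2_eq_square mult.assoc)
    then show ?thesis
      using Q.nrm_nonneg[OF dD, of "Suc n"] Q.nrm_nonneg[OF dD, of n] r(1)
      by (cases "Q.nrm (d (Suc n)) = 0") (auto simp: mult_le_cancel_right)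
  qed
  have geo: "Q.nrm (d n) \<le> Q.nrm (d 0) * r ^ n" for n
  proof (induction n)
    case (Suc n)
    have "Q.nrm (d (Suc n)) \<le> r * (Q.nrm (d 0) * r ^ n)"
      using contract[of n] mult_left_mono[OF Suc r(1)] by linarith
    then show ?case by (simp add: algebra_simps)
  qed simp
  have "Q.ip_cauchy X"
    using geo by (intro Q.ip_cauchy_geometric[OF XD r Q.nrm_nonneg[OF dD[of 0]]]) (simp add: d_def)
  then obtain u where u: "u \<in> D" and Xu: "Q.ip_lim X u" using form_complete[of X, OF XD] by blast
  have uE: "u \<in> perp E" by (rule perp_closed[OF ED XE u Xu])
  show ?thesis
  proof (intro bexI[OF _ uE] ballI)
    fix v assume v: "v \<in> D"
    have "(\<lambda>n. q (X (Suc n)) v) \<longlonglongrightarrow> q u v"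
      by (rule LIMSEQ_Suc[OF Q.ip_lim_ip[OF XD u Xu v]])
    moreover have "(\<lambda>n. q (X (Suc n)) v) \<longlonglongrightarrow> ip f v + \<mu> * ip u v"
      unfolding XSq[OF v]
      by (intro tendsto_intros L.ip_lim_ip[OF D_L[OF XD] D_L[OF u] form_lim_imp_lim[OF XD u Xu] D_L[OF v]])
    ultimately have "q u v = ip f v + \<mu> * ip u v" by (rule LIMSEQ_unique)
    then show "q u v = ip (\<lambda>x. f x + \<mu> * u x) v" by (simp add: L.ip_comb_left f D_L u v)
  qed
qed

lemma eigen_on_perp_zero:
  assumes low: "\<And>v. v \<in> perp E \<Longrightarrow> \<Lambda> * L.sqn v \<le> Q.sqn v" and \<mu>: "cmod \<mu> < \<Lambda>"
    and w: "w \<in> perp E" and eig: "q w w = \<mu> * ip w w"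
  shows "L.sqn w = 0"
proof -
  have wD: "w \<in> D" using w by (rule perp_D)
  have "Q.sqn w = Re \<mu> * L.sqn w"
    unfolding Q.sqn_def eig by (simp add: L.ip_self[OF D_L[OF wD]])
  also have "\<dots> \<le> cmod \<mu> * L.sqn w"
    by (intro mult_right_mono complex_Re_le_cmod L.sqn_nonneg D_L wD)
  finally have "(\<Lambda> - cmod \<mu>) * L.sqn w \<le> 0" using low[OF w] by (simp add: algebra_simps)
  then show ?thesis using \<mu> L.sqn_nonneg[OF D_L[OF wD]] by (simp add: mult_le_0_iff)
qed

text \<open>Subtracting the projection onto the eigensystem from an eigenvector leaves an eigenvector in the
complement, where all energies exceed \<open>\<bar>\<mu>\<bar>\<close>.\<close>

lemma eigenvector_in_span:
  assumes E: "orthonormal_eigensystem E"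
    and low: "\<And>v. v \<in> perp E \<Longrightarrow> \<Lambda> * L.sqn v \<le> Q.sqn v" and \<mu>: "cmod \<mu> < \<Lambda>"
    and w: "w \<in> D" and eig: "\<And>v. v \<in> D \<Longrightarrow> q w v = \<mu> * ip w v"
  shows "L.sqn (\<lambda>x. w x - (\<Sum>e\<in>E. ip w e * e x)) = 0"
    and "e \<in> E \<Longrightarrow> ip w e \<noteq> 0 \<Longrightarrow> \<mu> = of_real (Q.sqn e)"
proof -
  note ED = ons_D[OF E] and fin = ons_finite[OF E]
  have coeff: "\<mu> = of_real (Q.sqn e)" if "e \<in> E" "ip w e \<noteq> 0" for e
    using ons_eig_right[OF E that(1) w] eig[of e] that ED by auto
  then show "e \<in> E \<Longrightarrow> ip w e \<noteq> 0 \<Longrightarrow> \<mu> = of_real (Q.sqn e)" .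
  define s where "s = (\<lambda>x. \<Sum>e\<in>E. ip w e * e x)"
  have s: "s \<in> D" unfolding s_def by (intro Q.sum_mem fin ED)
  have sq: "q s v = \<mu> * ip s v" if v: "v \<in> D" for v
  proof -
    have "q s v = (\<Sum>e\<in>E. ip w e * (of_real (Q.sqn e) * ip e v))"
      unfolding s_def using ons_eig[OF E _ v] by (simp add: Q.ip_sum_left[OF fin ED v])
    also have "\<dots> = (\<Sum>e\<in>E. \<mu> * (ip w e * ip e v))"
      using coeff by (intro sum.cong refl) auto
    also have "\<dots> = \<mu> * ip s v"
      unfolding s_def using ED D_subset by (simp add: L.ip_sum_left[OF fin _ D_L[OF v]] sum_distrib_left)
    finally show ?thesis .
  qed
  have "(\<lambda>x. w x - s x) \<in> perp E" unfolding s_def by (rule projection_perp[OF E w])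
  moreover have "q (\<lambda>x. w x - s x) (\<lambda>x. w x - s x) = \<mu> * ip (\<lambda>x. w x - s x) (\<lambda>x. w x - s x)"
  proof -
    have "q (\<lambda>x. w x - s x) v = \<mu> * ip (\<lambda>x. w x - s x) v" if v: "v \<in> D" for v
      unfolding Q.ip_diff_left[OF w s v] L.ip_diff_left[OF D_L[OF w] D_L[OF s] D_L[OF v]]
      using eig[OF v] sq[OF v] by (simp add: right_diff_distrib)
    then show ?thesis using Q.diff_mem[OF w s] by blast
  qed
  ultimately show "L.sqn (\<lambda>x. w x - (\<Sum>e\<in>E. ip w e * e x)) = 0"
    unfolding s_def by (rule eigen_on_perp_zero[OF _ \<mu>, rotated]) (rule low)
qed

text \<open>The right-hand side is split into its projection onto the eigensystem, where the operator is
diagonal and \<open>\<mu>\<close> is not among the eigenvalues, and a part in the complement.\<close>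

lemma resolvent_bound:
  assumes E: "orthonormal_eigensystem E"
    and low: "\<And>v. v \<in> perp E \<Longrightarrow> \<Lambda> * L.sqn v \<le> Q.sqn v" and \<mu>: "cmod \<mu> < \<Lambda>"
    and reg: "\<And>e. e \<in> E \<Longrightarrow> \<mu> \<noteq> of_real (Q.sqn e)"
  shows "\<exists>C. \<forall>f\<in>L. \<exists>u\<in>D. (\<forall>v\<in>D. q u v = ip (\<lambda>x. f x + \<mu> * u x) v) \<and> L.nrm u \<le> C * L.nrm f \<and>
     (\<forall>w\<in>D. (\<forall>v\<in>D. q w v = ip (\<lambda>x. f x + \<mu> * w x) v) \<longrightarrow> L.nrm (\<lambda>x. w x - u x) = 0)"
proof (intro exI ballI)
  note ED = ons_D[OF E] and fin = ons_finite[OF E]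
  have EL: "E \<subseteq> L" using ED D_subset by blast
  define S where "S = (\<Sum>e\<in>E. 1 / cmod (of_real (Q.sqn e) - \<mu>))"
  define n where "n = real (card E)"
  fix f assume f: "f \<in> L"
  define p where "p = (\<lambda>x. \<Sum>e\<in>E. ip f e * e x)"
  have p: "p \<in> L" unfolding p_def by (intro L.sum_mem fin EL)
  define f' where "f' = (\<lambda>x. f x - p x)"
  have f': "f' \<in> L" unfolding f'_def by (intro L.diff_mem f p)
  have f'E: "ip f' e = 0" if "e \<in> E" for e
    unfolding f'_def p_def by (rule projection_orthogonal[OF E f that])
  have ce: "cmod (ip f e) \<le> L.nrm f" if e: "e \<in> E" for e
    using L.Cauchy_Schwarz[OF f, of e] EL e ons_sqn[OF E e] by (auto simp: L.nrm_def)
  obtain u0 where u0: "u0 \<in> perp E" and u0q: "\<And>v. v \<in> D \<Longrightarrow> q u0 v = ip (\<lambda>x. f' x + \<mu> * u0 x) v"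
    using resolvent_on_perp[OF E low \<mu> f' f'E] by blast
  have u0D: "u0 \<in> D" using u0 by (rule perp_D)
  define c where "c e = ip f e / (of_real (Q.sqn e) - \<mu>)" for e
  define s where "s = (\<lambda>x. \<Sum>e\<in>E. c e * e x)"
  have s: "s \<in> D" unfolding s_def by (intro Q.sum_mem fin ED)
  have sq: "q s v - \<mu> * ip s v = ip p v" if v: "v \<in> D" for v
  proof -
    have "q s v - \<mu> * ip s v = (\<Sum>e\<in>E. c e * (of_real (Q.sqn e) * ip e v)) - \<mu> * (\<Sum>e\<in>E. c e * ip e v)"
      unfolding s_def using ons_eig[OF E _ v]
      by (simp add: Q.ip_sum_left[OF fin ED v] L.ip_sum_left[OF fin EL D_L[OF v]])
    also have "\<dots> = (\<Sum>e\<in>E. c e * (of_real (Q.sqn e) - \<mu>) * ip e v)"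
      by (simp add: sum_distrib_left sum_subtractf[symmetric] algebra_simps)
    also have "\<dots> = (\<Sum>e\<in>E. ip f e * ip e v)"
      using reg by (intro sum.cong refl) (auto simp: c_def)
    also have "\<dots> = ip p v" unfolding p_def by (simp add: L.ip_sum_left[OF fin EL D_L[OF v]])
    finally show ?thesis .
  qed
  define u where "u = (\<lambda>x. u0 x + s x)"
  have u: "u \<in> D" unfolding u_def by (intro Q.add_mem u0D s)
  have uq: "q u v = ip (\<lambda>x. f x + \<mu> * u x) v" if v: "v \<in> D" for v
  proof -
    have f'v: "ip f' v = ip f v - ip p v"
      unfolding f'_def by (rule L.ip_diff_left[OF f p D_L[OF v]])
    have "q u v = ip f' v + \<mu> * ip u0 v + (\<mu> * ip s v + ip p v)"
      unfolding u_def Q.ip_add_left[OF u0D s v] u0q[OF v] L.ip_comb_left[OF f' D_L[OF u0D] D_L[OF v]]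
      using sq[OF v] by (simp add: algebra_simps)
    also have "\<dots> = ip f v + \<mu> * ip u v"
      unfolding f'v unfolding u_def L.ip_add_left[OF D_L[OF u0D] D_L[OF s] D_L[OF v]]
      by (simp add: algebra_simps)
    finally show ?thesis unfolding L.ip_comb_left[OF f D_L[OF u] D_L[OF v]] .
  qed
  have nf': "L.nrm f' \<le> (1 + n) * L.nrm f"
  proof -
    have "L.nrm f' \<le> L.nrm f + L.nrm p"
      using L.nrm_triangle[OF f L.scale_mem[OF p, of "-1"]] L.nrm_scale[OF p, of "-1"] by (simp add: f'_def)
    also have "L.nrm p \<le> (\<Sum>e\<in>E. cmod (ip f e) * L.nrm e)"
      unfolding p_def by (rule L.nrm_sum_le[OF fin EL])
    also have "\<dots> \<le> (\<Sum>e\<in>E. L.nrm f)"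
      using ce ons_sqn[OF E] by (intro sum_mono) (simp add: L.nrm_def)
    finally show ?thesis by (simp add: n_def algebra_simps)
  qed
  have nu0: "L.nrm u0 \<le> L.nrm f' / (\<Lambda> - cmod \<mu>)"
  proof -
    have "Q.sqn u0 = Re (ip f' u0 + \<mu> * ip u0 u0)"
      unfolding Q.sqn_def u0q[OF u0D] by (simp add: L.ip_comb_left f' D_L u0D)
    also have "\<dots> \<le> L.nrm f' * L.nrm u0 + cmod \<mu> * L.sqn u0"
    proof -
      have "Re (ip f' u0) \<le> L.nrm f' * L.nrm u0"
        using complex_Re_le_cmod[of "ip f' u0"] L.Cauchy_Schwarz[OF f' D_L[OF u0D]] by linarith
      moreover have "Re (\<mu> * ip u0 u0) \<le> cmod \<mu> * L.sqn u0"
        using mult_right_mono[OF complex_Re_le_cmod[of \<mu>] L.sqn_nonneg[OF D_L[OF u0D]]]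
        by (simp add: L.ip_self[OF D_L[OF u0D]])
      ultimately show ?thesis by simp
    qed
    finally have "(\<Lambda> - cmod \<mu>) * L.nrm u0 * L.nrm u0 \<le> L.nrm f' * L.nrm u0"
      using low[OF u0] L.nrm_sq[OF D_L[OF u0D]] by (simp add: power2_eq_square algebra_simps)
    then have "(\<Lambda> - cmod \<mu>) * L.nrm u0 \<le> L.nrm f'"
      using L.nrm_nonneg[OF D_L[OF u0D]] L.nrm_nonneg[OF f']
      by (cases "L.nrm u0 = 0") (auto simp: mult_le_cancel_right)
    then show ?thesis using \<mu> by (simp add: field_simps)
  qed
  have ns: "L.nrm s \<le> S * L.nrm f"
  proof -
    have "L.nrm s \<le> (\<Sum>e\<in>E. cmod (c e) * L.nrm e)"
      unfolding s_def by (rule L.nrm_sum_le[OF fin EL])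
    also have "\<dots> \<le> (\<Sum>e\<in>E. (1 / cmod (of_real (Q.sqn e) - \<mu>)) * L.nrm f)"
      using ce ons_sqn[OF E]
      by (intro sum_mono) (simp add: L.nrm_def c_def norm_divide divide_right_mono)
    finally show ?thesis by (simp add: S_def sum_distrib_right)
  qed
  have nu: "L.nrm u \<le> ((1 + n) / (\<Lambda> - cmod \<mu>) + S) * L.nrm f"
  proof -
    have "L.nrm u \<le> L.nrm u0 + L.nrm s"
      unfolding u_def by (intro L.nrm_triangle D_L u0D s)
    also have "\<dots> \<le> (1 + n) * L.nrm f / (\<Lambda> - cmod \<mu>) + S * L.nrm f"
      using nu0 ns divide_right_mono[OF nf', of "\<Lambda> - cmod \<mu>"] \<mu> by linarith
    finally show ?thesis by (simp add: algebra_simps)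
  qed
  have uniq: "L.nrm (\<lambda>x. w x - u x) = 0"
    if w: "w \<in> D" and wq: "\<And>v. v \<in> D \<Longrightarrow> q w v = ip (\<lambda>x. f x + \<mu> * w x) v" for w
  proof -
    define z where "z = (\<lambda>x. w x - u x)"
    have z: "z \<in> D" unfolding z_def by (intro Q.diff_mem w u)
    have zq: "q z v = \<mu> * ip z v" if v: "v \<in> D" for v
      unfolding z_def Q.ip_diff_left[OF w u v] L.ip_diff_left[OF D_L[OF w] D_L[OF u] D_L[OF v]]
        wq[OF v] uq[OF v] L.ip_comb_left[OF f D_L[OF w] D_L[OF v]] L.ip_comb_left[OF f D_L[OF u] D_L[OF v]]
      by (simp add: right_diff_distrib)
    have "ip z e = 0" if "e \<in> E" for e
      using eigenvector_in_span(2)[OF E low \<mu> z zq that] reg[OF that] by blast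
    then have "z \<in> perp E" by (simp add: perp_def z)
    then show ?thesis
      using eigen_on_perp_zero[OF low \<mu> _ zq[OF z]] by (simp add: L.nrm_def z_def)
  qed
  show "\<exists>u\<in>D. (\<forall>v\<in>D. q u v = ip (\<lambda>x. f x + \<mu> * u x) v) \<and>
      L.nrm u \<le> ((1 + real (card E)) / (\<Lambda> - cmod \<mu>) + (\<Sum>e\<in>E. 1 / cmod (of_real (Q.sqn e) - \<mu>))) * L.nrm f \<and>
     (\<forall>w\<in>D. (\<forall>v\<in>D. q w v = ip (\<lambda>x. f x + \<mu> * w x) v) \<longrightarrow> L.nrm (\<lambda>x. w x - u x) = 0)"
    using u uq nu uniq unfolding n_def S_def by blast
qed

end

section \<open>Smooth bumps and the fundamental lemma\<close>

text \<open>For \<open>p = 1\<close> this is the classical function \<open>exp(-1/t)\<close>, flat at 0. The polynomial factor makes the family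
closed under differentiation.\<close>

definition flat_exp :: "real poly \<Rightarrow> real \<Rightarrow> real" where
  "flat_exp p t = (if t > 0 then poly p (1 / t) * exp (- (1 / t)) else 0)"

lemma poly_times_exp_tendsto_0:
  "((\<lambda>s::real. s ^ k * poly p s * exp (- s)) \<longlongrightarrow> 0) at_top"
proof (induction p arbitrary: k)
  case 0 show ?case by simp
next
  case (pCons a p)
  have "((\<lambda>s::real. a * (s ^ k / exp s) + s ^ Suc k * poly p s * exp (- s)) \<longlongrightarrow> a * 0 + 0) at_top"
    by (intro tendsto_intros tendsto_power_div_exp_0 pCons.IH)
  then show ?case by (simp add: exp_minus field_simps)
qed

lemma flat_exp_tendsto_0: "(flat_exp p \<longlongrightarrow> 0) (at 0)"
proof (rule filterlim_split_at)
  show "(flat_exp p \<longlongrightarrow> 0) (at_left 0)"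
    by (rule tendsto_eventually) (auto simp: eventually_at_filter flat_exp_def)
  have "((\<lambda>t. poly p (inverse t) * exp (- inverse t)) \<longlongrightarrow> 0) (at_right (0::real))"
    using filterlim_compose[OF poly_times_exp_tendsto_0[of 0 p] filterlim_inverse_at_top_right] by simp
  moreover have "\<forall>\<^sub>F t in at_right 0. poly p (inverse t) * exp (- inverse t) = flat_exp p t"
    by (auto simp: eventually_at_filter flat_exp_def inverse_eq_divide)
  ultimately show "(flat_exp p \<longlongrightarrow> 0) (at_right 0)"
    by (simp cong: tendsto_cong)
qed

lemma has_real_derivative_flat_exp:
  "(flat_exp p has_real_derivative flat_exp ([:0, 0, 1:] * (p - pderiv p)) t) (at t)"
proof -
  consider "t < 0" | "t = 0" | "t > 0" by linarith
  then show ?thesis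
  proof cases
    case 1
    have "((\<lambda>t. 0) has_real_derivative 0) (at t)" by simp
    then have "(flat_exp p has_real_derivative 0) (at t)"
      by (rule has_field_derivative_transform_within_open[where S = "{..<0}"]) (use 1 in \<open>auto simp: flat_exp_def\<close>)
    then show ?thesis using 1 by (simp add: flat_exp_def)
  next
    case 2
    \<comment> \<open>the difference quotient at 0 belongs to the family again\<close>
    have "\<forall>\<^sub>F h in at 0. flat_exp (pCons 0 p) h = (flat_exp p (0 + h) - flat_exp p 0) / h"
      by (auto simp: eventually_at_filter flat_exp_def)
    then have "(flat_exp p has_real_derivative 0) (at 0)"
      unfolding DERIV_def by (rule Lim_transform_eventually[OF flat_exp_tendsto_0])
    then show ?thesis using 2 by (simp add: flat_exp_def)
  next
    case 3
    have "((\<lambda>t. poly p (1 / t) * exp (- (1 / t))) has_real_derivative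
        flat_exp ([:0, 0, 1:] * (p - pderiv p)) t) (at t)"
      using 3 by (auto intro!: derivative_eq_intros DERIV_chain2[OF poly_DERIV]
          simp: flat_exp_def field_simps power2_eq_square)
    then show ?thesis
      by (rule has_field_derivative_transform_within_open[where S = "{0<..}"]) (use 3 in \<open>auto simp: flat_exp_def\<close>)
  qed
qed

text \<open>Any set of differentiable functions that contains their partial derivatives consists of smooth
functions. This one is generated by one-variable profiles, so that products over the coordinates
belong to it.\<close>

inductive_set flat_functions :: "(real^'n \<Rightarrow> real) set" where
  coord: "(\<lambda>x. flat_exp p (c * x $ i + d)) \<in> flat_functions"
| const: "(\<lambda>x. c) \<in> flat_functions"
| add: "f \<in> flat_functions \<Longrightarrow> g \<in> flat_functions \<Longrightarrow> (\<lambda>x. f x + g x) \<in> flat_functions"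
| mult: "f \<in> flat_functions \<Longrightarrow> g \<in> flat_functions \<Longrightarrow> (\<lambda>x. f x * g x) \<in> flat_functions"

lemma flat_functions_derivative:
  fixes f :: "real^'n \<Rightarrow> real"
  shows "f \<in> flat_functions \<Longrightarrow>
    \<exists>f'. (\<forall>x. (f has_derivative f' x) (at x)) \<and> (\<forall>i. (\<lambda>x. f' x (axis i 1)) \<in> flat_functions)"
proof (induction rule: flat_functions.induct)
  case (coord p c i d)
  let ?q = "[:0, 0, 1:] * (p - pderiv p)"
  have "((\<lambda>x. flat_exp p (c * x $ i + d)) has_derivative
      (\<lambda>h. (c * h $ i) * flat_exp ?q (c * x $ i + d))) (at x)" for x :: "real^'n"
  proof -
    have "((\<lambda>x::real^'n. c * x $ i + d) has_derivative (\<lambda>h. c * h $ i)) (at x)"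
      by (auto intro!: derivative_eq_intros bounded_linear_imp_has_derivative bounded_linear_vec_nth)
    from has_derivative_compose[OF this has_real_derivative_flat_exp[unfolded has_field_derivative_def]]
    show ?thesis by (simp add: mult.commute)
  qed
  moreover have "(\<lambda>x. (c * axis j 1 $ i) * flat_exp ?q (c * x $ i + d)) \<in> flat_functions" for j :: 'n
    by (intro flat_functions.intros)
  ultimately show ?case by (intro exI[of _ "\<lambda>x h. (c * h $ i) * flat_exp ?q (c * x $ i + d)"]) blast
next
  case (const c)
  then show ?case by (intro exI[of _ "\<lambda>x h. 0"]) (auto intro: flat_functions.intros)
next
  case (add f g)
  then obtain f' g' where "\<forall>x. (f has_derivative f' x) (at x)" "\<forall>i. (\<lambda>x. f' x (axis i 1)) \<in> flat_functions"
    "\<forall>x. (g has_derivative g' x) (at x)" "\<forall>i. (\<lambda>x. g' x (axis i 1)) \<in> flat_functions" by blast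
  then show ?case
    by (intro exI[of _ "\<lambda>x h. f' x h + g' x h"])
       (auto intro!: derivative_eq_intros flat_functions.intros)
next
  case (mult f g)
  then obtain f' g' where "\<forall>x. (f has_derivative f' x) (at x)" "\<forall>i. (\<lambda>x. f' x (axis i 1)) \<in> flat_functions"
    "\<forall>x. (g has_derivative g' x) (at x)" "\<forall>i. (\<lambda>x. g' x (axis i 1)) \<in> flat_functions" by blast
  with mult.hyps show ?case
    by (intro exI[of _ "\<lambda>x h. f x * g' x h + f' x h * g x"])
       (auto intro!: has_derivative_mult flat_functions.intros)
qed

lemma flat_functions_partial_deriv:
  assumes "f \<in> flat_functions"
  shows "f differentiable (at x)" and "partial_deriv i f \<in> flat_functions"
proof -
  obtain f' where f': "\<And>x. (f has_derivative f' x) (at x)" "\<And>i. (\<lambda>x. f' x (axis i 1)) \<in> flat_functions"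
    using flat_functions_derivative[OF assms] by blast
  show "f differentiable (at x)" using f'(1) by (rule differentiableI)
  have "partial_deriv i f = (\<lambda>x. f' x (axis i 1))"
    using frechet_derivative_at[OF f'(1)] by (simp add: partial_deriv_def fun_eq_iff)
  then show "partial_deriv i f \<in> flat_functions" using f'(2) by simp
qed

lemma flat_functions_continuous: "f \<in> flat_functions \<Longrightarrow> continuous_on S f"
  by (intro continuous_at_imp_continuous_on ballI differentiable_imp_continuous_within
      flat_functions_partial_deriv)

lemma flat_functions_smooth: "f \<in> flat_functions \<Longrightarrow> times_cont_diff k f"
  by (induction k arbitrary: f) (auto simp: flat_functions_partial_deriv flat_functions_continuous)

text \<open>The factor \<open>Suc n\<close> steepens the profiles, so that the bumps increase to the indicator of the open box.\<close>

definition box_bump :: "nat \<Rightarrow> real^'n \<Rightarrow> real^'n \<Rightarrow> real^'n \<Rightarrow> real" where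
  "box_bump n a b x = (\<Prod>i\<in>UNIV. flat_exp 1 (real (Suc n) * (x $ i - a $ i)) * flat_exp 1 (real (Suc n) * (b $ i - x $ i)))"

lemma box_bump_flat: "box_bump n a b \<in> flat_functions"
proof -
  have "(\<lambda>x. \<Prod>i\<in>I. flat_exp 1 (real (Suc n) * x $ i + - real (Suc n) * a $ i)
      * flat_exp 1 (- real (Suc n) * x $ i + real (Suc n) * b $ i)) \<in> flat_functions" if "finite I" for I
    using that
  proof (induction I)
    case empty
    show ?case using flat_functions.const[of 1] by simp
  next
    case (insert i I)
    show ?case
      unfolding prod.insert[OF insert.hyps(1,2)] by (intro flat_functions.intros insert.IH)
  qed
  from this[of UNIV] show ?thesis
    by (simp add: box_bump_def[abs_def] right_diff_distrib algebra_simps)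
qed

lemma box_bump_eq_0: "x \<notin> box a b \<Longrightarrow> box_bump n a b x = 0"
  by (force simp: mem_box_cart box_bump_def flat_exp_def zero_less_mult_iff)

lemma box_bump_bounds: "0 \<le> box_bump n a b x" "box_bump n a b x \<le> 1"
  unfolding box_bump_def
  by (auto intro!: prod_nonneg prod_le_1 mult_nonneg_nonneg mult_le_one simp: flat_exp_def)

lemma test_function_box_bump: "test_function (box_bump n a b)"
proof -
  have "{x. box_bump n a b x \<noteq> 0} \<subseteq> box a b" using box_bump_eq_0 by blast
  then have "bounded {x. box_bump n a b x \<noteq> 0}" using bounded_box bounded_subset by blast
  then show ?thesis
    by (simp add: test_function_def compact_closure flat_functions_smooth box_bump_flat)
qed

lemma box_bump_tendsto: "(\<lambda>n. box_bump n a b x) \<longlonglongrightarrow> indicator (box a b) x"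
proof (cases "x \<in> box a b")
  case True
  have *: "(\<lambda>n. flat_exp 1 (real (Suc n) * t)) \<longlonglongrightarrow> 1" if "t > 0" for t
  proof -
    have "(\<lambda>n. exp (- (inverse (real (Suc n)) * (1 / t)))) \<longlonglongrightarrow> exp (- (0 * (1 / t)))"
      by (intro tendsto_intros LIMSEQ_inverse_real_of_nat)
    moreover have "flat_exp 1 (real (Suc n) * t) = exp (- (inverse (real (Suc n)) * (1 / t)))" for n
      using mult_pos_pos[of "real (Suc n)" t] that by (simp add: flat_exp_def inverse_eq_divide del: of_nat_Suc)
    ultimately show ?thesis by simp
  qed
  have "(\<lambda>n. box_bump n a b x) \<longlonglongrightarrow> (\<Prod>i\<in>(UNIV::'a set). 1 * 1)"
    unfolding box_bump_def using True by (intro tendsto_intros *) (auto simp: mem_box_cart)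
  then show ?thesis using True by simp
qed (simp add: box_bump_eq_0)

lemma locally_integrable_mult_integrable:
  fixes u :: "real^'n \<Rightarrow> complex"
  assumes u: "locally_integrable u" and \<phi>: "\<phi> \<in> borel_measurable lebesgue"
    and bnd: "\<And>x. \<bar>\<phi> x\<bar> \<le> B" and K: "compact K" and supp: "\<And>x. x \<notin> K \<Longrightarrow> \<phi> x = 0"
  shows "integrable lebesgue (\<lambda>x. of_real (\<phi> x) * u x)"
proof -
  have int: "integrable lebesgue (\<lambda>x. indicator K x *\<^sub>R u x)"
    using u K by (simp add: locally_integrable_def set_integrable_def)
  have eq: "(\<lambda>x. of_real (\<phi> x) * u x) = (\<lambda>x. of_real (\<phi> x) * (indicator K x *\<^sub>R u x))"
    using supp by (auto simp: fun_eq_iff indicator_def)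
  show ?thesis
    unfolding eq
  proof (rule Bochner_Integration.integrable_bound)
    show "integrable lebesgue (\<lambda>x. B *\<^sub>R (indicator K x *\<^sub>R u x))" using int by (intro integrable_scaleR_right)
    show "(\<lambda>x. of_real (\<phi> x) * (indicator K x *\<^sub>R u x)) \<in> borel_measurable lebesgue"
      using \<phi> borel_measurable_integrable[OF int] by measurable
    have "0 \<le> B" using bnd[of undefined] by linarith
    then have "norm (of_real (\<phi> x) * (indicator K x *\<^sub>R u x)) \<le> norm (B *\<^sub>R (indicator K x *\<^sub>R u x))" for x
      unfolding norm_mult norm_of_real norm_scaleR[of B] using bnd[of x] by (intro mult_right_mono) auto
    then show "AE x in lebesgue. norm (of_real (\<phi> x) * (indicator K x *\<^sub>R u x)) \<le> norm (B *\<^sub>R (indicator K x *\<^sub>R u x))"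
      by simp
  qed
qed

lemma box_bump_measurable: "box_bump n a b \<in> borel_measurable lebesgue"
  using borel_measurable_continuous_onI[OF flat_functions_continuous[OF box_bump_flat[of n a b], of UNIV]]
  by (intro measurable_completion) simp

lemma box_bump_integrable:
  fixes u :: "real^'n \<Rightarrow> complex"
  assumes "locally_integrable u"
  shows "integrable lebesgue (\<lambda>x. of_real (box_bump n a b x) * u x)"
proof (rule locally_integrable_mult_integrable[OF assms box_bump_measurable, where B = 1 and K = "cbox a b"])
  show "\<bar>box_bump n a b x\<bar> \<le> 1" for x using box_bump_bounds[of n a b x] by simp
  show "box_bump n a b x = 0" if "x \<notin> cbox a b" for x
    using that box_subset_cbox[of a b] by (intro box_bump_eq_0) blast
qed simp

text \<open>By dominated convergence the integrals against the bumps give that all integrals of \<open>w\<close> over boxes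
vanish; Lebesgue differentiation then recovers \<open>w\<close> almost everywhere.\<close>

lemma fundamental_lemma:
  fixes w :: "real^'n \<Rightarrow> complex"
  assumes w: "locally_integrable w"
    and zero: "\<And>n a b. (LINT x|lebesgue. of_real (box_bump n a b x) * w x) = 0"
  shows "AE x in lebesgue. w x = 0"
proof -
  have wK: "w absolutely_integrable_on cbox a b" for a b
    using w by (simp add: locally_integrable_def)
  have box0: "integral (cbox a b) w = 0" for a b
  proof -
    have int: "integrable lebesgue (\<lambda>x. indicator (cbox a b) x *\<^sub>R w x)"
      using wK by (simp add: set_integrable_def)
    have "(\<lambda>n. LINT x|lebesgue. of_real (box_bump n a b x) * w x)
        \<longlonglongrightarrow> (LINT x|lebesgue. of_real (indicator (box a b) x) * w x)"
    proof (rule integral_dominated_convergence)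
      show "integrable lebesgue (\<lambda>x. norm (indicator (cbox a b) x *\<^sub>R w x))" by (rule integrable_norm[OF int])
      show "(\<lambda>x. of_real (box_bump n a b x) * w x) \<in> borel_measurable lebesgue" for n
        using box_bump_integrable[OF w] by auto
      have eq: "(\<lambda>x. of_real (indicator (box a b) x) * w x)
          = (\<lambda>x. indicator (box a b) x *\<^sub>R (indicator (cbox a b) x *\<^sub>R w x))"
        using box_subset_cbox[of a b] by (auto simp: fun_eq_iff indicator_def)
      show "(\<lambda>x. of_real (indicator (box a b) x) * w x) \<in> borel_measurable lebesgue"
        unfolding eq by (intro borel_measurable_scaleR borel_measurable_indicator borel_measurable_integrable[OF int]) simp
      show "AE x in lebesgue. (\<lambda>n. of_real (box_bump n a b x) * w x)
          \<longlonglongrightarrow> of_real (indicator (box a b) x) * w x"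
        by (intro AE_I2 tendsto_intros box_bump_tendsto)
      have "norm (of_real (box_bump n a b x) * w x) \<le> norm (indicator (cbox a b) x *\<^sub>R w x)" for n x
        using box_bump_bounds[of n a b x] box_bump_eq_0[of x a b n] box_subset_cbox[of a b]
        by (cases "x \<in> box a b") (auto simp: norm_mult mult_left_le_one_le)
      then show "AE x in lebesgue. norm (of_real (box_bump n a b x) * w x)
          \<le> norm (indicator (cbox a b) x *\<^sub>R w x)" for n by simp
    qed
    then have "(LINT x|lebesgue. of_real (indicator (box a b) x) * w x) = 0"
      by (simp add: zero LIMSEQ_const_iff)
    then have "(LINT x:box a b|lebesgue. w x) = 0"
      by (simp add: set_lebesgue_integral_def scaleR_conv_of_real)
    moreover have "w absolutely_integrable_on box a b"
      by (rule set_integrable_subset[OF wK[of a b]]) (auto intro: box_subset_cbox[THEN subsetD])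
    ultimately show ?thesis
      by (simp add: set_lebesgue_integral_eq_integral integral_open_interval)
  qed
  obtain N where N: "negligible N" "\<And>x e. x \<notin> N \<Longrightarrow> 0 < e \<Longrightarrow>
      \<exists>d>0. \<forall>h. 0 < h \<and> h < d \<longrightarrow> norm (integral (cbox x (x + h *\<^sub>R One)) w /\<^sub>R h ^ DIM(real^'n) - w x) < e"
    by (rule integrable_ccontinuous_explicit[OF set_lebesgue_integral_eq_integral(1)[OF wK]]) blast
  have "w x = 0" if "x \<notin> N" for x
  proof (rule ccontr)
    assume "w x \<noteq> 0"
    then obtain d where "d > 0" "\<forall>h. 0 < h \<and> h < d \<longrightarrow>
        norm (integral (cbox x (x + h *\<^sub>R One)) w /\<^sub>R h ^ DIM(real^'n) - w x) < norm (w x)"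
      using N(2)[OF \<open>x \<notin> N\<close>, of "norm (w x)"] by auto
    from this(2)[rule_format, of "d / 2"] this(1) show False by (simp add: box0)
  qed
  then show ?thesis
    using N(1) by (intro AE_I'[of N]) (auto simp: negligible_iff_null_sets)
qed

section \<open>Completeness of the square-integrable functions\<close>

lemma L2_measurable: "u \<in> L2 \<Longrightarrow> u \<in> borel_measurable lebesgue"
  by (simp add: L2_def)

lemma L2_integrable: "u \<in> L2 \<Longrightarrow> integrable lebesgue (\<lambda>x. (cmod (u x))\<^sup>2)"
  by (simp add: L2_def)

lemma two_prod_le_squares: "a * b \<le> a\<^sup>2 + b\<^sup>2" for a b :: real
  using sum_squares_bound[of a b] zero_le_power2[of a] zero_le_power2[of b] by linarith

lemma L2_prod_integrable:
  assumes u: "u \<in> L2" and v: "v \<in> L2"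
  shows "integrable lebesgue (\<lambda>x. u x * cnj (v x))"
proof (rule Bochner_Integration.integrable_bound)
  show "integrable lebesgue (\<lambda>x. (cmod (u x))\<^sup>2 + (cmod (v x))\<^sup>2)"
    using u v by (intro Bochner_Integration.integrable_add L2_integrable)
  show "(\<lambda>x. u x * cnj (v x)) \<in> borel_measurable lebesgue"
    by (intro borel_measurable_times L2_measurable u measurable_compose[OF L2_measurable[OF v]]
        borel_measurable_continuous_onI continuous_intros)
  show "AE x in lebesgue. norm (u x * cnj (v x)) \<le> norm ((cmod (u x))\<^sup>2 + (cmod (v x))\<^sup>2)"
    using two_prod_le_squares by (simp add: norm_mult)
qed

lemma L2I:
  fixes u :: "real^'n \<Rightarrow> complex"
  assumes "u \<in> borel_measurable lebesgue" "(\<integral>\<^sup>+x. ennreal ((cmod (u x))\<^sup>2) \<partial>lebesgue) < \<infinity>"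
  shows "u \<in> L2"
  using assms by (auto simp: L2_def integrable_iff_bounded intro!: borel_measurable_power borel_measurable_norm)

lemma L2_comb:
  assumes u: "u \<in> L2" and v: "v \<in> L2"
  shows "(\<lambda>x. u x + c * v x) \<in> L2"
proof -
  have m: "(\<lambda>x. u x + c * v x) \<in> borel_measurable lebesgue"
    by (intro borel_measurable_add borel_measurable_times borel_measurable_const L2_measurable u v)
  have "integrable lebesgue (\<lambda>x. (cmod (u x + c * v x))\<^sup>2)"
  proof (rule Bochner_Integration.integrable_bound)
    show "integrable lebesgue (\<lambda>x. 2 * (cmod (u x))\<^sup>2 + 2 * (cmod c)\<^sup>2 * (cmod (v x))\<^sup>2)"
      using u v by (intro Bochner_Integration.integrable_add integrable_mult_right L2_integrable)
    show "(\<lambda>x. (cmod (u x + c * v x))\<^sup>2) \<in> borel_measurable lebesgue"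
      using m by measurable
    have "(cmod (u x + c * v x))\<^sup>2 \<le> 2 * (cmod (u x))\<^sup>2 + 2 * (cmod c)\<^sup>2 * (cmod (v x))\<^sup>2" for x
    proof -
      have "(cmod (u x + c * v x))\<^sup>2 \<le> (cmod (u x) + cmod (c * v x))\<^sup>2"
        by (intro power_mono norm_triangle_ineq norm_ge_zero)
      also have "\<dots> \<le> 2 * (cmod (u x))\<^sup>2 + 2 * (cmod (c * v x))\<^sup>2"
        using sum_squares_bound[of "cmod (u x)" "cmod (c * v x)"] by (simp add: power2_sum)
      finally show ?thesis by (simp add: norm_mult power_mult_distrib mult.assoc)
    qed
    then show "AE x in lebesgue. norm ((cmod (u x + c * v x))\<^sup>2)
        \<le> norm (2 * (cmod (u x))\<^sup>2 + 2 * (cmod c)\<^sup>2 * (cmod (v x))\<^sup>2)" by simp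
  qed
  with m show ?thesis by (simp add: L2_def)
qed

interpretation L2sp: semi_inner_product "L2 :: (real^'n \<Rightarrow> complex) set" L2_inner
proof
  show "(\<lambda>x. 0) \<in> L2" by (simp add: L2_def)
next
  fix u v :: "real^'n \<Rightarrow> complex" and c assume "u \<in> L2" "v \<in> L2"
  then show "(\<lambda>x. u x + c * v x) \<in> L2" by (rule L2_comb)
next
  fix u v w :: "real^'n \<Rightarrow> complex" and c assume *: "u \<in> L2" "v \<in> L2" "w \<in> L2"
  have "(LINT x|lebesgue. (u x + c * v x) * cnj (w x))
      = (LINT x|lebesgue. u x * cnj (w x) + c * (v x * cnj (w x)))"
    by (simp add: algebra_simps)
  also have "\<dots> = (LINT x|lebesgue. u x * cnj (w x)) + c * (LINT x|lebesgue. v x * cnj (w x))"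
    using * by (subst Bochner_Integration.integral_add) (auto intro!: L2_prod_integrable)
  finally show "L2_inner (\<lambda>x. u x + c * v x) w = L2_inner u w + c * L2_inner v w"
    by (simp add: L2_inner_def)
next
  fix u v :: "real^'n \<Rightarrow> complex"
  show "L2_inner v u = cnj (L2_inner u v)"
    unfolding L2_inner_def Bochner_Integration.integral_cnj[symmetric] by (simp add: mult.commute)
next
  fix u :: "real^'n \<Rightarrow> complex"
  have "L2_inner u u = of_real (LINT x|lebesgue. (cmod (u x))\<^sup>2)"
    unfolding L2_inner_def complex_norm_square[symmetric] integral_complex_of_real[symmetric] by simp
  then show "0 \<le> Re (L2_inner u u)" by simp
qed

lemma L2_sqn: "L2sp.sqn u = (LINT x|lebesgue. (cmod (u x))\<^sup>2)"
proof -
  have "L2_inner u u = of_real (LINT x|lebesgue. (cmod (u x))\<^sup>2)"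
    unfolding L2_inner_def complex_norm_square[symmetric] integral_complex_of_real[symmetric] by simp
  then show ?thesis by (simp add: L2sp.sqn_def)
qed

lemma L2_norm_eq_nrm: "L2_norm u = L2sp.nrm u"
  by (simp add: L2_norm_def L2sp.nrm_def L2_sqn)

lemma nn_integral_L2: "u \<in> L2 \<Longrightarrow> (\<integral>\<^sup>+x. ennreal ((cmod (u x))\<^sup>2) \<partial>lebesgue) = ennreal (L2sp.sqn u)"
  by (simp add: L2_sqn nn_integral_eq_integral L2_integrable)

lemma L2_nrm_zero_iff: "u \<in> L2 \<Longrightarrow> L2sp.nrm u = 0 \<longleftrightarrow> (AE x in lebesgue. u x = 0)"
  using integral_nonneg_eq_0_iff_AE[OF L2_integrable, of u] by (simp add: L2sp.nrm_def L2_sqn)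

lemma L2_inner_cong_AE:
  assumes "u \<in> L2" "u' \<in> L2" "v \<in> L2" "v' \<in> L2"
    and "AE x in lebesgue. u x = u' x" "AE x in lebesgue. v x = v' x"
  shows "L2_inner u v = L2_inner u' v'"
  unfolding L2_inner_def
  using assms(5,6) by (intro integral_cong_AE borel_measurable_integrable L2_prod_integrable assms) auto

text \<open>The almost everywhere convergent subsequence is part of the conclusion because it identifies limits
of sequences such as \<open>\<surd>V X\<^sub>n\<close>.\<close>

theorem L2_complete:
  fixes X :: "nat \<Rightarrow> real^'n \<Rightarrow> complex"
  assumes X: "\<And>n. X n \<in> L2" and cauchy: "L2sp.ip_cauchy X"
  obtains u r where "u \<in> L2" "L2sp.ip_lim X u" "strict_mono r"
    "AE x in lebesgue. (\<lambda>n. X (r n) x) \<longlonglongrightarrow> u x"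
proof -
  have "\<exists>N. \<forall>m\<ge>N. \<forall>n\<ge>N. L2sp.sqn (\<lambda>x. X m x - X n x) < (1/4) ^ k" for k :: nat
    by (rule L2sp.ip_cauchy_sqnD[OF X cauchy]) simp
  then obtain N where N: "\<And>k m n. m \<ge> N k \<Longrightarrow> n \<ge> N k \<Longrightarrow> L2sp.sqn (\<lambda>x. X m x - X n x) < (1/4) ^ k"
    by metis
  \<comment> \<open>the summand k makes r strictly increasing, the sum makes it exceed each N k\<close>
  define r where "r k = k + (\<Sum>j\<le>k. N j)" for k
  have r: "strict_mono r" by (auto simp: strict_mono_Suc_iff r_def)
  have rN: "N k \<le> r k" for k
    unfolding r_def by (intro trans_le_add2 member_le_sum) auto
  define Y where "Y k = X (r k)" for k
  have Y: "Y k \<in> L2" for k by (simp add: Y_def X)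
  have [measurable]: "Y k \<in> borel_measurable lebesgue" for k by (rule L2_measurable[OF Y])
  define d where "d k x = cmod (Y (Suc k) x - Y k x)" for k x
  have [measurable]: "d k \<in> borel_measurable lebesgue" for k unfolding d_def by measurable
  have dint: "(\<integral>\<^sup>+x. ennreal ((d k x)\<^sup>2) \<partial>lebesgue) \<le> ennreal ((1/4) ^ k)" for k
  proof -
    have "r k \<le> r (Suc k)" using r by (simp add: strict_mono_less_eq)
    then have "L2sp.sqn (\<lambda>x. Y (Suc k) x - Y k x) \<le> (1/4) ^ k"
      unfolding Y_def using rN[of k] by (intro less_imp_le[OF N]) auto
    then show ?thesis
      unfolding d_def using nn_integral_L2[OF L2sp.diff_mem[OF Y[of "Suc k"] Y[of k]]] by (simp add: ennreal_leI)
  qed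
  \<comment> \<open>the weights 2^k keep the sum of the integrals finite, and d \<le> 2^-k
      + 2^k d^2 then makes the increments summable at almost every point\<close>
  have "(\<integral>\<^sup>+x. (\<Sum>k. ennreal (2 ^ k * (d k x)\<^sup>2)) \<partial>lebesgue) = (\<Sum>k. \<integral>\<^sup>+x. ennreal (2 ^ k * (d k x)\<^sup>2) \<partial>lebesgue)"
    by (rule nn_integral_suminf) measurable
  also have "\<dots> \<le> (\<Sum>k. ennreal ((1/2) ^ k))"
  proof (rule suminf_le)
    fix k
    have "(\<integral>\<^sup>+x. ennreal (2 ^ k * (d k x)\<^sup>2) \<partial>lebesgue) = ennreal (2 ^ k) * (\<integral>\<^sup>+x. ennreal ((d k x)\<^sup>2) \<partial>lebesgue)"
      by (subst nn_integral_cmult[symmetric]) (auto simp: ennreal_mult)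
    also have "\<dots> \<le> ennreal (2 ^ k) * ennreal ((1/4) ^ k)" by (intro mult_left_mono dint) auto
    also have "\<dots> = ennreal ((1/2) ^ k)"
      by (simp add: ennreal_mult[symmetric] power_mult_distrib[symmetric])
    finally show "(\<integral>\<^sup>+x. ennreal (2 ^ k * (d k x)\<^sup>2) \<partial>lebesgue) \<le> ennreal ((1/2) ^ k)" .
  qed auto
  also have "\<dots> = ennreal (\<Sum>k. (1/2) ^ k)" by (intro suminf_ennreal2) auto
  also have "\<dots> < \<infinity>" by simp
  finally have "AE x in lebesgue. (\<Sum>k. ennreal (2 ^ k * (d k x)\<^sup>2)) \<noteq> \<infinity>"
    by (intro nn_integral_PInf_AE) auto
  then have conv: "AE x in lebesgue. convergent (\<lambda>k. Y k x)"
  proof eventually_elim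
    case (elim x)
    have "summable (\<lambda>k. 2 ^ k * (d k x)\<^sup>2)"
      using elim by (intro summable_suminf_not_top) (auto simp: top_unique)
    then have "summable (\<lambda>k. (1/2) ^ k + 2 ^ k * (d k x)\<^sup>2)"
      by (intro summable_add summable_geometric) auto
    moreover have "norm (Y (Suc k) x - Y k x) \<le> (1/2) ^ k + 2 ^ k * (d k x)\<^sup>2" for k
    proof -
      have "2 ^ k * d k x \<le> 1 + (2 ^ k * d k x)\<^sup>2" using two_prod_le_squares[of 1 "2 ^ k * d k x"] by simp
      then have "(1/2) ^ k * (2 ^ k * d k x) \<le> (1/2) ^ k * (1 + (2 ^ k * d k x)\<^sup>2)" by (intro mult_left_mono) auto
      moreover have "(1/2) ^ k * (2 ^ k * d k x) = d k x"
        by (simp add: power_divide)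
      moreover have "(1/2) ^ k * (1 + (2 ^ k * d k x)\<^sup>2) = (1/2) ^ k + 2 ^ k * (d k x)\<^sup>2"
        by (simp add: power_divide field_simps power2_eq_square)
      ultimately show ?thesis unfolding d_def[symmetric] by linarith
    qed
    ultimately have "summable (\<lambda>k. Y (Suc k) x - Y k x)"
      by (rule summable_comparison_test'[where N = 0])
    then have "convergent (\<lambda>n. (\<Sum>k<n. Y (Suc k) x - Y k x) + Y 0 x)"
      by (intro convergent_add convergent_const) (simp add: summable_iff_convergent)
    moreover have "(\<Sum>k<n. Y (Suc k) x - Y k x) + Y 0 x = Y n x" for n
      using sum_lessThan_telescope[of "\<lambda>k. Y k x" n] by simp
    ultimately show ?case by (simp only:)
  qed
  define u where "u x = lim (\<lambda>k. Y k x)" for x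
  have [measurable]: "u \<in> borel_measurable lebesgue" unfolding u_def by measurable
  have Yu: "AE x in lebesgue. (\<lambda>k. Y k x) \<longlonglongrightarrow> u x"
    using conv by eventually_elim (simp add: u_def convergent_LIMSEQ_iff)
  have bound: "(\<integral>\<^sup>+x. ennreal ((cmod (X n x - u x))\<^sup>2) \<partial>lebesgue) \<le> ennreal ((1/4) ^ k)" if "n \<ge> N k" for n k
  proof -
    have [measurable]: "X n \<in> borel_measurable lebesgue" by (rule L2_measurable[OF X])
    have "(\<integral>\<^sup>+x. ennreal ((cmod (X n x - u x))\<^sup>2) \<partial>lebesgue)
        = (\<integral>\<^sup>+x. liminf (\<lambda>m. ennreal ((cmod (X n x - Y m x))\<^sup>2)) \<partial>lebesgue)"
    proof (rule nn_integral_cong_AE)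
      show "AE x in lebesgue. ennreal ((cmod (X n x - u x))\<^sup>2) = liminf (\<lambda>m. ennreal ((cmod (X n x - Y m x))\<^sup>2))"
        using Yu
      proof eventually_elim
        case (elim x)
        then have "(\<lambda>m. ennreal ((cmod (X n x - Y m x))\<^sup>2)) \<longlonglongrightarrow> ennreal ((cmod (X n x - u x))\<^sup>2)"
          by (intro tendsto_intros tendsto_ennrealI)
        then show ?case by (rule lim_imp_Liminf[OF sequentially_bot, symmetric])
      qed
    qed
    also have "\<dots> \<le> liminf (\<lambda>m. \<integral>\<^sup>+x. ennreal ((cmod (X n x - Y m x))\<^sup>2) \<partial>lebesgue)"
      by (rule nn_integral_liminf) measurable
    also have "\<dots> \<le> limsup (\<lambda>m. \<integral>\<^sup>+x. ennreal ((cmod (X n x - Y m x))\<^sup>2) \<partial>lebesgue)"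
      by (rule Liminf_le_Limsup) simp
    also have "\<dots> \<le> ennreal ((1/4) ^ k)"
    proof (rule Limsup_bounded, unfold eventually_sequentially, intro exI allI impI)
      fix m assume "k \<le> m"
      then have "r k \<le> r m" using r by (simp add: strict_mono_less_eq)
      then have "L2sp.sqn (\<lambda>x. X n x - Y m x) \<le> (1/4) ^ k"
        unfolding Y_def using rN[of k] that by (intro less_imp_le[OF N]) auto
      then show "(\<integral>\<^sup>+x. ennreal ((cmod (X n x - Y m x))\<^sup>2) \<partial>lebesgue) \<le> ennreal ((1/4) ^ k)"
        using nn_integral_L2[OF L2sp.diff_mem[OF X[of n] Y[of m]]] by (simp add: ennreal_leI)
    qed
    finally show ?thesis .
  qed
  have diff: "(\<lambda>x. X n x - u x) \<in> L2" if "n \<ge> N k" for n k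
    using L2_measurable[OF X] bound[OF that] by (intro L2I borel_measurable_diff) (auto simp: le_less_trans)
  have u: "u \<in> L2"
    using L2sp.diff_mem[OF X diff[of 0 "N 0"], of "N 0"] by simp
  have "L2sp.ip_lim X u"
    unfolding L2sp.ip_lim_def
  proof (rule LIMSEQ_I)
    fix e :: real assume "e > 0"
    then obtain k where k: "(1/4) ^ k < e\<^sup>2" using real_arch_pow_inv[of "e\<^sup>2" "1/4"] by auto
    have "norm (L2sp.nrm (\<lambda>x. X n x - u x) - 0) < e" if "n \<ge> N k" for n
    proof -
      have "L2sp.sqn (\<lambda>x. X n x - u x) \<le> (1/4) ^ k"
        using bound[OF that] nn_integral_L2[OF diff[OF that]] by simp
      then have "L2sp.nrm (\<lambda>x. X n x - u x) < e"
        unfolding L2sp.nrm_def using k \<open>e > 0\<close> by (intro real_less_lsqrt) auto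
      then show ?thesis using L2sp.nrm_nonneg[OF diff[OF that]] by simp
    qed
    then show "\<exists>no. \<forall>n\<ge>no. norm (L2sp.nrm (\<lambda>x. X n x - u x) - 0) < e" by blast
  qed
  then show thesis using that[OF u _ r] Yu by (simp add: Y_def)
qed

section \<open>Translations of square-integrable functions\<close>

lemma locally_integrable_measurable:
  fixes u :: "real^'n \<Rightarrow> 'b::{banach, second_countable_topology}"
  assumes u: "locally_integrable u"
  shows "u \<in> borel_measurable lebesgue"
proof (rule borel_measurable_LIMSEQ_metric)
  show "(\<lambda>x. indicator (cball 0 (real n)) x *\<^sub>R u x) \<in> borel_measurable lebesgue" for n
    using u by (intro borel_measurable_integrable) (simp add: locally_integrable_def set_integrable_def)
  fix x :: "real^'n"
  obtain N :: nat where N: "norm x \<le> real N" using real_arch_simple by blast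
  have "\<forall>\<^sub>F n in sequentially. indicator (cball 0 (real n)) x *\<^sub>R u x = u x"
    unfolding eventually_sequentially using N by (intro exI[of _ N]) (auto simp: indicator_def)
  then show "(\<lambda>n. indicator (cball 0 (real n)) x *\<^sub>R u x) \<longlonglongrightarrow> u x"
    by (rule tendsto_eventually)
qed

lemma L2_integrable_on_lmeasurable:
  fixes u :: "real^'n \<Rightarrow> complex"
  assumes u: "u \<in> L2" and K: "K \<in> lmeasurable"
  shows "integrable lebesgue (\<lambda>x. indicator K x *\<^sub>R u x)"
proof (rule Bochner_Integration.integrable_bound)
  have "integrable lebesgue (\<lambda>x. indicator K x :: real)"
    using K by (intro integrable_real_indicator) (auto simp: fmeasurable_def)
  then have "integrable lebesgue (\<lambda>x. indicator K x + (cmod (u x))\<^sup>2 :: real)"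
    using L2_integrable[OF u] by (rule Bochner_Integration.integrable_add)
  moreover have "(indicator K x)\<^sup>2 = (indicator K x :: real)" for x
    by (simp add: indicator_def)
  ultimately show "integrable lebesgue (\<lambda>x. (indicator K x)\<^sup>2 + (cmod (u x))\<^sup>2 :: real)"
    by (simp only:)
  show "(\<lambda>x. indicator K x *\<^sub>R u x) \<in> borel_measurable lebesgue"
    by (intro borel_measurable_scaleR borel_measurable_indicator L2_measurable u fmeasurableD K)
  show "AE x in lebesgue. norm (indicator K x *\<^sub>R u x) \<le> norm ((indicator K x)\<^sup>2 + (cmod (u x))\<^sup>2 :: real)"
    using two_prod_le_squares[of "indicator K x" "cmod (u x)" for x] by simp
qed

lemma L2_locally_integrable:
  fixes u :: "real^'n \<Rightarrow> complex"
  assumes "u \<in> L2"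
  shows "locally_integrable u"
  using L2_integrable_on_lmeasurable[OF assms lmeasurable_compact]
  by (simp add: locally_integrable_def set_integrable_def)

lemma L2_AE_cong:
  assumes u: "u \<in> L2" and v: "v \<in> borel_measurable lebesgue" and eq: "AE x in lebesgue. u x = v x"
  shows "v \<in> L2"
proof (rule L2I[OF v])
  have "(\<integral>\<^sup>+x. ennreal ((cmod (v x))\<^sup>2) \<partial>lebesgue) = (\<integral>\<^sup>+x. ennreal ((cmod (u x))\<^sup>2) \<partial>lebesgue)"
    using eq by (intro nn_integral_cong_AE) auto
  then show "(\<integral>\<^sup>+x. ennreal ((cmod (v x))\<^sup>2) \<partial>lebesgue) < \<infinity>" using nn_integral_L2[OF u] by simp
qed

text \<open>Fubini arguments on product spaces need Borel functions; Lebesgue measurability of \<open>u\<close> alone does not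
make \<open>(x,s) \<mapsto> u(x + s d)\<close> measurable for the product \<open>\<sigma>\<close>-algebra.\<close>

lemma L2_borel_representative:
  fixes u :: "real^'n \<Rightarrow> complex"
  assumes u: "u \<in> L2"
  obtains u' where "u' \<in> borel_measurable borel" "u' \<in> L2" "AE x in lebesgue. u x = u' x"
proof -
  have [measurable]: "u \<in> borel_measurable lebesgue" by (rule L2_measurable[OF u])
  have re: "(\<lambda>x. Re (u x)) \<in> borel_measurable lebesgue" and im: "(\<lambda>x. Im (u x)) \<in> borel_measurable lebesgue"
    by measurable
  obtain a b where ab: "a \<in> borel_measurable lborel" "b \<in> borel_measurable lborel"
    "AE x in lborel. Re (u x) = a x" "AE x in lborel. Im (u x) = b x"
    using completion_ex_borel_measurable_real[OF re] completion_ex_borel_measurable_real[OF im] by blast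
  define u' where "u' x = of_real (a x) + \<i> * of_real (b x)" for x
  have m: "u' \<in> borel_measurable borel" using ab(1,2) unfolding u'_def by measurable
  have "AE x in lborel. u x = u' x"
    using ab(3,4) by eventually_elim (simp add: u'_def complex_eq_iff)
  then have eq: "AE x in lebesgue. u x = u' x" by (rule AE_completion)
  have "u' \<in> borel_measurable lebesgue" using m by (intro measurable_completion) simp
  then show thesis using that m eq L2_AE_cong[OF u] by blast
qed

lemma nn_integral_lborel_shift:
  fixes c :: "'a::euclidean_space"
  assumes "f \<in> borel_measurable borel"
  shows "(\<integral>\<^sup>+x. f (x + c) \<partial>lborel) = (\<integral>\<^sup>+x. f x \<partial>lborel)"
proof -
  have "(\<integral>\<^sup>+x. f x \<partial>lborel) = (\<integral>\<^sup>+x. f x \<partial>distr lborel borel ((+) c))"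
    by (simp add: lborel_distr_plus)
  also have "\<dots> = (\<integral>\<^sup>+x. f (c + x) \<partial>lborel)"
    using assms by (subst nn_integral_distr) auto
  finally show ?thesis by (simp add: add.commute)
qed

lemma integral_lborel_shift:
  fixes f :: "'a::euclidean_space \<Rightarrow> 'b::{banach, second_countable_topology}"
  assumes "f \<in> borel_measurable borel"
  shows "(LINT x|lborel. f (x + c)) = (LINT x|lborel. f x)"
proof -
  have "(LINT x|lborel. f x) = (LINT x|distr lborel borel ((+) c). f x)"
    by (simp add: lborel_distr_plus)
  also have "\<dots> = (LINT x|lborel. f (c + x))"
    using assms by (subst integral_distr) auto
  finally show ?thesis by (simp add: add.commute)
qed

lemma L2_borel_finite:
  assumes "u \<in> L2"
  shows "(\<integral>\<^sup>+x. ennreal ((cmod (u x))\<^sup>2) \<partial>lborel) = ennreal (L2sp.sqn u)"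
  using nn_integral_L2[OF assms] by (simp add: nn_integral_completion)

lemma
  fixes u :: "real^'n \<Rightarrow> complex"
  assumes b: "u \<in> borel_measurable borel" and u: "u \<in> L2"
  shows L2_shift: "(\<lambda>x. u (x + c)) \<in> L2"
    and L2_shift_nrm: "L2sp.nrm (\<lambda>x. u (x + c)) = L2sp.nrm u"
proof -
  have eq: "(\<integral>\<^sup>+x. ennreal ((cmod (u (x + c)))\<^sup>2) \<partial>lborel) = ennreal (L2sp.sqn u)"
    using b nn_integral_lborel_shift[of "\<lambda>x. ennreal ((cmod (u x))\<^sup>2)" c] L2_borel_finite[OF u] by simp
  have "(\<lambda>x. u (x + c)) \<in> borel_measurable lborel" using b by simp
  then show *: "(\<lambda>x. u (x + c)) \<in> L2"
    using eq by (intro L2I measurable_completion) (auto simp: nn_integral_completion)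
  show "L2sp.nrm (\<lambda>x. u (x + c)) = L2sp.nrm u"
    using eq L2_borel_finite[OF *] L2sp.sqn_nonneg[OF u] L2sp.sqn_nonneg[OF *]
    by (simp add: L2sp.nrm_def)
qed

text \<open>By \<open>ab \<le> a\<^sup>2 + b\<^sup>2\<close> and translation invariance, the integral in \<open>x\<close> is bounded uniformly in \<open>s\<close>.\<close>

lemma shift_product_integrable:
  fixes f h :: "real^'n \<Rightarrow> complex"
  assumes [measurable]: "f \<in> borel_measurable borel" "h \<in> borel_measurable borel"
    and f: "f \<in> L2" and h: "h \<in> L2"
  shows "integrable (lborel \<Otimes>\<^sub>M lborel) (\<lambda>(x, s). f x * (indicator {0..t} s *\<^sub>R h (x + s *\<^sub>R d)))"
proof (rule integrableI_bounded)
  let ?F = "\<lambda>x s. f x * (indicator {0..t} s *\<^sub>R h (x + s *\<^sub>R d))"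
  show m: "(\<lambda>(x, s). ?F x s) \<in> borel_measurable (lborel \<Otimes>\<^sub>M lborel)"
    by measurable
  define C where "C = ennreal (L2sp.sqn f) + ennreal (L2sp.sqn h)"
  have "(\<integral>\<^sup>+z. ennreal (norm (case z of (x, s) \<Rightarrow> ?F x s)) \<partial>(lborel \<Otimes>\<^sub>M lborel))
      = (\<integral>\<^sup>+s. (\<integral>\<^sup>+x. ennreal (norm (?F x s)) \<partial>lborel) \<partial>lborel)"
    by (subst lborel_pair.nn_integral_snd[symmetric]) (auto simp: case_prod_beta)
  also have "\<dots> \<le> (\<integral>\<^sup>+s. indicator {0..t} s * C \<partial>lborel)"
  proof (rule nn_integral_mono)
    fix s :: real
    have "(\<integral>\<^sup>+x. ennreal (norm (?F x s)) \<partial>lborel)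
        \<le> (\<integral>\<^sup>+x. indicator {0..t} s * (ennreal ((cmod (f x))\<^sup>2) + ennreal ((cmod (h (x + s *\<^sub>R d)))\<^sup>2)) \<partial>lborel)"
      using two_prod_le_squares
      by (intro nn_integral_mono) (auto simp: norm_mult indicator_def ennreal_plus[symmetric] simp del: ennreal_plus intro!: ennreal_leI)
    also have "\<dots> = indicator {0..t} s * ((\<integral>\<^sup>+x. ennreal ((cmod (f x))\<^sup>2) \<partial>lborel)
        + (\<integral>\<^sup>+x. ennreal ((cmod (h (x + s *\<^sub>R d)))\<^sup>2) \<partial>lborel))"
      by (simp add: nn_integral_cmult nn_integral_add)
    also have "\<dots> = indicator {0..t} s * C"
      using nn_integral_lborel_shift[of "\<lambda>x. ennreal ((cmod (h x))\<^sup>2)" "s *\<^sub>R d"]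
      by (simp add: C_def L2_borel_finite f h)
    finally show "(\<integral>\<^sup>+x. ennreal (norm (?F x s)) \<partial>lborel) \<le> indicator {0..t} s * C" .
  qed
  also have "\<dots> = C * emeasure lborel {0..t}"
    by (subst mult.commute) (simp add: nn_integral_cmult_indicator)
  also have "\<dots> < \<infinity>"
    by (auto simp: C_def ennreal_mult_less_top emeasure_lborel_Icc_eq)
  finally show "(\<integral>\<^sup>+z. ennreal (norm (case z of (x, s) \<Rightarrow> ?F x s)) \<partial>(lborel \<Otimes>\<^sub>M lborel)) < \<infinity>" .
qed

lemma shift_product_Fubini:
  fixes f h :: "real^'n \<Rightarrow> complex"
  assumes "f \<in> borel_measurable borel" "h \<in> borel_measurable borel" "f \<in> L2" "h \<in> L2"
  shows "(LINT x|lborel. f x * (LINT s|lborel. indicator {0..t} s *\<^sub>R h (x + s *\<^sub>R d)))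
       = (LINT s|lborel. indicator {0..t} s *\<^sub>R (LINT x|lborel. f x * h (x + s *\<^sub>R d)))"
    and "integrable lborel (\<lambda>x. f x * (LINT s|lborel. indicator {0..t} s *\<^sub>R h (x + s *\<^sub>R d)))"
proof -
  note int = shift_product_integrable[OF assms, of t d]
  show "integrable lborel (\<lambda>x. f x * (LINT s|lborel. indicator {0..t} s *\<^sub>R h (x + s *\<^sub>R d)))"
    using lborel_pair.integrable_fst'[OF int] unfolding prod.case integral_mult_right_zero .
  have "(LINT s|lborel. (LINT x|lborel. f x * (indicator {0..t} s *\<^sub>R h (x + s *\<^sub>R d))))
      = (LINT x|lborel. (LINT s|lborel. f x * (indicator {0..t} s *\<^sub>R h (x + s *\<^sub>R d))))"
    by (rule lborel_pair.Fubini_integral[OF int])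
  moreover have "f x * (indicator {0..t} s *\<^sub>R h (x + s *\<^sub>R d)) = indicator {0..t} s *\<^sub>R (f x * h (x
      + s *\<^sub>R d))" for x s
    by (rule mult_scaleR_right)
  ultimately show "(LINT x|lborel. f x * (LINT s|lborel. indicator {0..t} s *\<^sub>R h (x + s *\<^sub>R d)))
       = (LINT s|lborel. indicator {0..t} s *\<^sub>R (LINT x|lborel. f x * h (x + s *\<^sub>R d)))"
    unfolding integral_mult_right_zero by (simp only: integral_scaleR_right)
qed

lemma continuous_compact_support_L2:
  fixes f :: "real^'n \<Rightarrow> real"
  assumes f: "continuous_on UNIV f" and K: "compact K" "\<And>x. x \<notin> K \<Longrightarrow> f x = 0"
  shows "(\<lambda>x. complex_of_real (f x)) \<in> borel_measurable borel" "(\<lambda>x. complex_of_real (f x)) \<in> L2"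
proof -
  show m: "(\<lambda>x. complex_of_real (f x)) \<in> borel_measurable borel"
    using f by (intro borel_measurable_continuous_onI continuous_intros)
  have "integrable lborel (\<lambda>x. indicator K x *\<^sub>R (f x)\<^sup>2)"
    using f K(1) by (intro borel_integrable_compact continuous_intros continuous_on_subset[of UNIV f K]) auto
  moreover have "(\<lambda>x. indicator K x *\<^sub>R (f x)\<^sup>2) = (\<lambda>x. (f x)\<^sup>2)"
    using K(2) by (auto simp: fun_eq_iff indicator_def)
  moreover have "(\<lambda>x. (f x)\<^sup>2) \<in> borel_measurable borel"
    using f by (intro borel_measurable_continuous_onI continuous_intros)
  ultimately have "integrable lebesgue (\<lambda>x. (f x)\<^sup>2)"
    by (simp add: integrable_completion)
  moreover have "(\<lambda>x. complex_of_real (f x)) \<in> borel_measurable lebesgue"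
    using m by (intro measurable_completion) simp
  ultimately show "(\<lambda>x. complex_of_real (f x)) \<in> L2"
    by (simp add: L2_def)
qed

lemma partial_deriv_shift:
  assumes "\<And>x. f differentiable (at x)"
  shows "partial_deriv i (\<lambda>x. f (x - c)) x = partial_deriv i f (x - c)"
proof -
  have f: "(f has_derivative frechet_derivative f (at (x - c))) (at (x - c))"
    using assms frechet_derivative_works by blast
  have "((\<lambda>x. x - c) has_derivative (\<lambda>h. h)) (at x)" by (auto intro!: derivative_eq_intros)
  from has_derivative_compose[OF this f]
  have "((\<lambda>x. f (x - c)) has_derivative frechet_derivative f (at (x - c))) (at x)" .
  from frechet_derivative_at[OF this] show ?thesis by (simp add: partial_deriv_def)
qed

lemma partial_deriv_box_bump_eq_0:
  assumes "x \<notin> cbox a b"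
  shows "partial_deriv i (box_bump n a b) x = 0"
proof -
  have zero: "box_bump n a b y = 0" if "y \<in> - cbox a b" for y
    using that box_subset_cbox[of a b] by (intro box_bump_eq_0) blast
  have "((\<lambda>x. 0::real) has_derivative (\<lambda>h. 0)) (at x)" by simp
  then have "(box_bump n a b has_derivative (\<lambda>h. 0)) (at x)"
    by (rule has_derivative_transform_within_open[where s = "- cbox a b"])
       (use assms zero in \<open>auto simp: open_Compl\<close>)
  from frechet_derivative_at[OF this] show ?thesis by (simp add: partial_deriv_def fun_eq_iff)
qed

lemma box_bump_shift: "box_bump n (a + c) (b + c) x = box_bump n a b (x - c)"
  by (simp add: box_bump_def algebra_simps)

lemma box_bump_difference:
  "box_bump n a b (x - t *\<^sub>R axis i 1) - box_bump n a b x
     = - (LINT s|lborel. indicator {0..t} s *\<^sub>R partial_deriv i (box_bump n a b) (x - s *\<^sub>R axis i 1))"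
  if "0 \<le> t"
proof -
  let ?\<phi> = "box_bump n a b" and ?e = "axis i 1"
  have diff: "?\<phi> differentiable (at y)" for y
    by (rule flat_functions_partial_deriv[OF box_bump_flat])
  have cont: "continuous_on UNIV (partial_deriv i ?\<phi>)"
    by (intro flat_functions_continuous flat_functions_partial_deriv box_bump_flat)
  have D: "((\<lambda>s. ?\<phi> (x - s *\<^sub>R ?e)) has_real_derivative - partial_deriv i ?\<phi> (x - s *\<^sub>R ?e)) (at s)" for s
  proof -
    let ?F = "frechet_derivative ?\<phi> (at (x - s *\<^sub>R ?e))"
    have F: "(?\<phi> has_derivative ?F) (at (x - s *\<^sub>R ?e))"
      using diff frechet_derivative_works by blast
    have "((\<lambda>s. x - s *\<^sub>R ?e) has_derivative (\<lambda>h. - (h *\<^sub>R ?e))) (at s)"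
      by (auto intro!: derivative_eq_intros)
    from has_derivative_compose[OF this F]
    have "((\<lambda>s. ?\<phi> (x - s *\<^sub>R ?e)) has_derivative (\<lambda>h. ?F (- (h *\<^sub>R ?e)))) (at s)" .
    moreover have "(\<lambda>h. ?F (- (h *\<^sub>R ?e))) = (*) (- partial_deriv i ?\<phi> (x - s *\<^sub>R ?e))"
      using has_derivative_linear[OF F] by (simp add: fun_eq_iff partial_deriv_def linear_neg linear_cmul)
    ultimately show ?thesis by (simp add: has_field_derivative_def)
  qed
  have "continuous_on UNIV (\<lambda>s::real. - partial_deriv i ?\<phi> (x - s *\<^sub>R ?e))"
    by (intro continuous_on_minus continuous_on_compose2[OF cont] continuous_intros) auto
  then have isCont: "isCont (\<lambda>s::real. - partial_deriv i ?\<phi> (x - s *\<^sub>R ?e)) s" for s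
    by (simp add: continuous_on_eq_continuous_at)
  have "(LINT s|lborel. - partial_deriv i ?\<phi> (x - s *\<^sub>R ?e) * indicator {0..t} s)
      = ?\<phi> (x - t *\<^sub>R ?e) - ?\<phi> (x - 0 *\<^sub>R ?e)"
    by (rule integral_FTC_Icc_real[OF that D]) (rule isCont)
  then show ?thesis by (simp add: mult.commute)
qed

section \<open>Weak derivatives and their line integrals\<close>

lemma test_function_bounded_support:
  fixes \<phi> :: "real^'n \<Rightarrow> real"
  assumes \<phi>: "test_function \<phi>"
  shows "continuous_on UNIV \<phi>" "continuous_on UNIV (partial_deriv i \<phi>)"
    and "\<exists>K. compact K \<and> (\<forall>x. x \<notin> K \<longrightarrow> \<phi> x = 0 \<and> partial_deriv i \<phi> x = 0)"
proof -
  have k: "times_cont_diff k \<phi>" for k using \<phi> by (simp add: test_function_def)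
  show "continuous_on UNIV \<phi>" using k[of 0] by simp
  show "continuous_on UNIV (partial_deriv i \<phi>)" using k[of "Suc 0"] by simp
  obtain K where K: "compact K" and zero: "\<And>x. x \<notin> K \<Longrightarrow> \<phi> x = 0"
    using \<phi> closure_subset[of "{x. \<phi> x \<noteq> 0}"] unfolding test_function_def by blast
  have "partial_deriv i \<phi> x = 0" if x: "x \<notin> K" for x
  proof -
    have "((\<lambda>x. 0::real) has_derivative (\<lambda>h. 0)) (at x)" by simp
    then have "(\<phi> has_derivative (\<lambda>h. 0)) (at x)"
      by (rule has_derivative_transform_within_open[where s = "- K"]) (use x zero K in
          \<open>auto simp: open_Compl compact_imp_closed\<close>)
    from frechet_derivative_at[OF this] show ?thesis by (simp add: partial_deriv_def fun_eq_iff)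
  qed
  with zero K show "\<exists>K. compact K \<and> (\<forall>x. x \<notin> K \<longrightarrow> \<phi> x = 0 \<and> partial_deriv i \<phi> x = 0)"
    by blast
qed

lemma test_integrable:
  fixes u :: "real^'n \<Rightarrow> complex"
  assumes u: "locally_integrable u" and \<phi>: "test_function \<phi>"
  shows "integrable lebesgue (\<lambda>x. of_real (\<phi> x) * u x)"
    and "integrable lebesgue (\<lambda>x. of_real (partial_deriv i \<phi> x) * u x)"
proof -
  obtain K where K: "compact K" "\<And>x. x \<notin> K \<Longrightarrow> \<phi> x = 0" "\<And>x. x \<notin> K \<Longrightarrow> partial_deriv i \<phi> x = 0"
    using test_function_bounded_support(3)[OF \<phi>, of i] by blast
  have *: "integrable lebesgue (\<lambda>x. of_real (f x) * u x)"
    if f: "continuous_on UNIV f" and f0: "\<And>x. x \<notin> K \<Longrightarrow> f x = 0" for f :: "real^'n \<Rightarrow> real"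
  proof -
    have "bounded (f ` K)"
      by (intro compact_imp_bounded compact_continuous_image continuous_on_subset[OF f] K(1)) simp
    then obtain B where B: "\<And>x. x \<in> K \<Longrightarrow> \<bar>f x\<bar> \<le> B" by (auto simp: bounded_iff)
    have "\<bar>f x\<bar> \<le> max B 0" for x using B[of x] f0[of x] by (cases "x \<in> K") auto
    moreover have "f \<in> borel_measurable lebesgue"
      using borel_measurable_continuous_onI[OF f] by (intro measurable_completion) simp
    ultimately show ?thesis by (intro locally_integrable_mult_integrable[OF u _ _ K(1) f0])
  qed
  show "integrable lebesgue (\<lambda>x. of_real (\<phi> x) * u x)"
    using test_function_bounded_support(1)[OF \<phi>] K(2) by (rule *)
  show "integrable lebesgue (\<lambda>x. of_real (partial_deriv i \<phi> x) * u x)"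
    using test_function_bounded_support(2)[OF \<phi>] K(3) by (rule *)
qed

lemma locally_integrable_comb:
  fixes u v :: "real^'n \<Rightarrow> complex"
  assumes "locally_integrable u" "locally_integrable v"
  shows "locally_integrable (\<lambda>x. u x + c * v x)"
  using assms unfolding locally_integrable_def
  by (auto intro!: set_integral_add set_integrable_mult_right)

lemma weak_partial_deriv_unique:
  fixes u :: "real^'n \<Rightarrow> complex"
  assumes g: "has_weak_partial_deriv i u g" and h: "has_weak_partial_deriv i u h"
  shows "AE x in lebesgue. g x = h x"
proof -
  have l: "locally_integrable g" "locally_integrable h" using g h by (auto simp: has_weak_partial_deriv_def)
  have "AE x in lebesgue. g x + (-1) * h x = 0"
  proof (rule fundamental_lemma)
    show "locally_integrable (\<lambda>x. g x + (-1) * h x)" by (intro locally_integrable_comb l)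
    fix n and a b :: "real^'n"
    have "(LINT x|lebesgue. of_real (box_bump n a b x) * (g x + (-1) * h x))
        = (LINT x|lebesgue. of_real (box_bump n a b x) * g x - of_real (box_bump n a b x) * h x)"
      by (simp add: algebra_simps)
    also have "\<dots> = (LINT x|lebesgue. of_real (box_bump n a b x) * g x) - (LINT x|lebesgue. of_real (box_bump n a b x) * h x)"
      by (intro Bochner_Integration.integral_diff box_bump_integrable l)
    also have "\<dots> = 0"
    proof -
      have "(LINT x|lebesgue. of_real (partial_deriv i (box_bump n a b) x) * u x)
          = - (LINT x|lebesgue. of_real (box_bump n a b x) * f x)"
        if "has_weak_partial_deriv i u f" for f
        using that test_function_box_bump[of n a b] by (simp add: has_weak_partial_deriv_def)
      from this[OF g] this[OF h] show ?thesis by simp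
    qed
    finally show "(LINT x|lebesgue. of_real (box_bump n a b x) * (g x + (-1) * h x)) = 0" .
  qed
  then show ?thesis by eventually_elim simp
qed

lemma has_weak_partial_deriv_cong_AE:
  fixes u :: "real^'n \<Rightarrow> complex"
  assumes w: "has_weak_partial_deriv i u g"
    and u': "locally_integrable u'" "AE x in lebesgue. u x = u' x"
    and g': "locally_integrable g'" "AE x in lebesgue. g x = g' x"
  shows "has_weak_partial_deriv i u' g'"
  unfolding has_weak_partial_deriv_def
proof (intro conjI allI impI u' g')
  fix \<phi> :: "real^'n \<Rightarrow> real" assume \<phi>: "test_function \<phi>"
  have u: "locally_integrable u" and g: "locally_integrable g"
    using w by (auto simp: has_weak_partial_deriv_def)
  have "(LINT x|lebesgue. of_real (partial_deriv i \<phi> x) * u' x)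
      = (LINT x|lebesgue. of_real (partial_deriv i \<phi> x) * u x)"
    using u'(2) by (intro integral_cong_AE borel_measurable_integrable test_integrable u u' \<phi>) auto
  moreover have "(LINT x|lebesgue. of_real (\<phi> x) * g' x) = (LINT x|lebesgue. of_real (\<phi> x) * g x)"
    using g'(2) by (intro integral_cong_AE borel_measurable_integrable test_integrable g g' \<phi>) auto
  ultimately show "(LINT x|lebesgue. of_real (partial_deriv i \<phi> x) * u' x) = - (LINT x|lebesgue. of_real (\<phi> x) * g' x)"
    using w \<phi> by (simp add: has_weak_partial_deriv_def)
qed

lemma has_weak_partial_deriv_comb:
  fixes u v :: "real^'n \<Rightarrow> complex"
  assumes u: "has_weak_partial_deriv i u g" and v: "has_weak_partial_deriv i v h"
  shows "has_weak_partial_deriv i (\<lambda>x. u x + c * v x) (\<lambda>x. g x + c * h x)"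
  unfolding has_weak_partial_deriv_def
proof (intro conjI allI impI)
  have l: "locally_integrable u" "locally_integrable v" "locally_integrable g" "locally_integrable h"
    using u v by (auto simp: has_weak_partial_deriv_def)
  show "locally_integrable (\<lambda>x. u x + c * v x)" "locally_integrable (\<lambda>x. g x + c * h x)"
    by (intro locally_integrable_comb l)+
  fix \<phi> :: "real^'n \<Rightarrow> real" assume \<phi>: "test_function \<phi>"
  have split: "(LINT x|lebesgue. f x * (p x + c * q x)) = (LINT x|lebesgue. f x * p x)
      + c * (LINT x|lebesgue. f x * q x)"
    if "integrable lebesgue (\<lambda>x. f x * p x)" "integrable lebesgue (\<lambda>x. f x * q x)" for f p q :: "real^'n \<Rightarrow> complex"
  proof -
    have "(LINT x|lebesgue. f x * (p x + c * q x)) = (LINT x|lebesgue. f x * p x + c * (f x * q x))"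
      by (simp add: algebra_simps)
    also have "\<dots> = (LINT x|lebesgue. f x * p x) + c * (LINT x|lebesgue. f x * q x)"
      using that by (subst Bochner_Integration.integral_add) auto
    finally show ?thesis .
  qed
  show "(LINT x|lebesgue. of_real (partial_deriv i \<phi> x) * (u x + c * v x))
      = - (LINT x|lebesgue. of_real (\<phi> x) * (g x + c * h x))"
    using u v \<phi> by (simp add: split test_integrable l has_weak_partial_deriv_def)
qed

text \<open>A weak derivative satisfies the fundamental theorem of calculus along almost every line parallel to
the axis. Tested against a bump \<open>\<phi>\<close>, the difference quotient moves to \<open>\<phi>\<close>, is written there as a line
integral of \<open>\<partial>\<^sub>i \<phi>\<close>, and returns to \<open>u\<close> through the weak derivative; both exchanges of integrals are
Fubini's theorem. The fundamental lemma removes the bump.\<close>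

lemma weak_partial_deriv_integrated:
  fixes u g :: "real^'n \<Rightarrow> complex"
  assumes um: "u \<in> borel_measurable borel" and gm: "g \<in> borel_measurable borel"
    and u: "u \<in> L2" and g: "g \<in> L2" and w: "has_weak_partial_deriv i u g" and t: "0 \<le> t"
  shows "AE x in lborel. u (x + t *\<^sub>R axis i 1) - u x = (LINT s|lborel. indicator {0..t} s *\<^sub>R g (x + s *\<^sub>R axis i 1))"
proof -
  define e :: "real^'n" where "e = axis i 1"
  define G where "G x = (LINT s|lborel. indicator {0..t} s *\<^sub>R g (x + s *\<^sub>R e))" for x
  have ut: "(\<lambda>x. u (x + t *\<^sub>R e)) \<in> L2" by (rule L2_shift[OF um u])
  have G: "locally_integrable G"
    unfolding locally_integrable_def set_integrable_def
  proof (intro allI impI)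
    fix K :: "(real^'n) set" assume K: "compact K"
    have "integrable lborel (\<lambda>x. complex_of_real (indicator K x) * G x)"
      unfolding G_def
    proof (rule shift_product_Fubini(2)[OF _ gm _ g])
      have Km: "K \<in> sets borel" using K by (simp add: borel_compact)
      show m: "(\<lambda>x. complex_of_real (indicator K x)) \<in> borel_measurable borel"
        using Km by measurable
      have "integrable lebesgue (\<lambda>x. (indicator K x) :: real)"
        using lmeasurable_compact[OF K] by (intro integrable_real_indicator) (auto simp: fmeasurable_def)
      moreover have "(indicator K x :: real) = (cmod (complex_of_real (indicator K x)))\<^sup>2" for x
        by (simp add: indicator_def)
      ultimately have "integrable lebesgue (\<lambda>x. (cmod (complex_of_real (indicator K x)))\<^sup>2)" by (simp only:)
      moreover have "(\<lambda>x. complex_of_real (indicator K x)) \<in> borel_measurable lebesgue"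
        using m by (intro measurable_completion) simp
      ultimately show "(\<lambda>x. complex_of_real (indicator K x)) \<in> L2" by (simp add: L2_def)
    qed
    then show "integrable lebesgue (\<lambda>x. indicator K x *\<^sub>R G x)"
      by (subst integrable_completion) (simp_all add: scaleR_conv_of_real borel_measurable_integrable)
  qed
  \<comment> \<open>differences in the form a + (-1) * b, matching the lemma on linear combinations\<close>
  define w' where "w' x = (u (x + t *\<^sub>R e) + (-1) * u x) + (-1) * G x" for x
  have lu: "locally_integrable u" by (rule L2_locally_integrable[OF u])
  have lut: "locally_integrable (\<lambda>x. u (x + t *\<^sub>R e))" by (rule L2_locally_integrable[OF ut])
  have "AE x in lebesgue. w' x = 0"
  proof (rule fundamental_lemma)
    show "locally_integrable w'"
      unfolding w'_def by (intro locally_integrable_comb lu lut G)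
    fix n and a b :: "real^'n"
    define \<phi> where "\<phi> = box_bump n a b"
    define \<psi> where "\<psi> = partial_deriv i \<phi>"
    have diff: "\<phi> differentiable (at y)" for y
      unfolding \<phi>_def by (rule flat_functions_partial_deriv[OF box_bump_flat])
    have supp: "\<phi> x = 0" "\<psi> x = 0" if "x \<notin> cbox a b" for x
      using that box_subset_cbox[of a b] box_bump_eq_0[of x a b n] partial_deriv_box_bump_eq_0[of x a b i n]
      by (auto simp: \<phi>_def \<psi>_def)
    have \<phi>c: "continuous_on UNIV \<phi>" and \<psi>c: "continuous_on UNIV \<psi>"
      unfolding \<phi>_def \<psi>_def by (intro flat_functions_continuous flat_functions_partial_deriv box_bump_flat)+
    note \<phi>L = continuous_compact_support_L2[OF \<phi>c compact_cbox supp(1)]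
    note \<psi>L = continuous_compact_support_L2[OF \<psi>c compact_cbox supp(2)]
    have int: "integrable lebesgue (\<lambda>x. of_real (\<phi> x) * f x)" if "locally_integrable f" for f :: "real^'n \<Rightarrow> complex"
      unfolding \<phi>_def by (rule box_bump_integrable[OF that])
    \<comment> \<open>the weak derivative is tested against the bump moved by s; the shift is then passed on to g\<close>
    have weak: "(LINT x|lborel. u x * of_real (\<psi> (x - s *\<^sub>R e))) = - (LINT x|lborel. of_real (\<phi> x) * g (x
        + s *\<^sub>R e))" for s
    proof -
      define \<phi>s where "\<phi>s = box_bump n (a + s *\<^sub>R e) (b + s *\<^sub>R e)"
      have \<phi>s: "\<phi>s = (\<lambda>x. \<phi> (x - s *\<^sub>R e))" by (simp add: \<phi>s_def \<phi>_def box_bump_shift fun_eq_iff)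
      have p: "partial_deriv i \<phi>s x = \<psi> (x - s *\<^sub>R e)" for x
        unfolding \<phi>s \<psi>_def by (rule partial_deriv_shift[OF diff])
      have tf: "test_function \<phi>s" unfolding \<phi>s_def by (rule test_function_box_bump)
      have "(LINT x|lebesgue. of_real (partial_deriv i \<phi>s x) * u x) = - (LINT x|lebesgue. of_real (\<phi>s x) * g x)"
        using w tf by (simp add: has_weak_partial_deriv_def)
      then have eq: "(LINT x|lebesgue. of_real (\<psi> (x - s *\<^sub>R e)) * u x)
          = - (LINT x|lebesgue. of_real (\<phi> (x - s *\<^sub>R e)) * g x)"
        unfolding p unfolding \<phi>s .
      have m1: "(\<lambda>x. of_real (\<psi> (x - s *\<^sub>R e)) * u x) \<in> borel_measurable lborel"
        using measurable_compose[of "\<lambda>x. x - s *\<^sub>R e" borel borel, OF _ \<psi>L(1)] um by simp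
      have m2: "(\<lambda>x. of_real (\<phi> (x - s *\<^sub>R e)) * g x) \<in> borel_measurable borel"
        using measurable_compose[of "\<lambda>x. x - s *\<^sub>R e" borel borel, OF _ \<phi>L(1)] gm by simp
      then have m3: "(\<lambda>x. of_real (\<phi> (x - s *\<^sub>R e)) * g x) \<in> borel_measurable lborel" by simp
      have "(LINT x|lborel. of_real (\<phi> (x - s *\<^sub>R e)) * g x) = (LINT x|lborel. of_real (\<phi> x) * g (x + s *\<^sub>R e))"
        using integral_lborel_shift[OF m2, of "s *\<^sub>R e"] by simp
      then show ?thesis
        using eq integral_completion[OF m1] integral_completion[OF m3]
        by (simp add: mult.commute)
    qed
    have "(LINT x|lebesgue. of_real (\<phi> x) * u (x + t *\<^sub>R e)) - (LINT x|lebesgue. of_real (\<phi> x) * u x)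
        = (LINT x|lebesgue. of_real (\<phi> x) * G x)"
    proof -
      have mu: "(\<lambda>x. of_real (\<phi> x) * u x) \<in> borel_measurable lborel" using um \<phi>L(1) by simp
      have mt: "(\<lambda>x. of_real (\<phi> (x - t *\<^sub>R e)) * u x) \<in> borel_measurable lborel"
        using measurable_compose[of "\<lambda>x. x - t *\<^sub>R e" borel borel, OF _ \<phi>L(1)] um by simp
      have mut: "(\<lambda>x. of_real (\<phi> x) * u (x + t *\<^sub>R e)) \<in> borel_measurable lborel"
        using um \<phi>L(1) by simp
      have iu: "integrable lborel (\<lambda>x. of_real (\<phi> x) * u x)"
        using int[OF lu] integrable_completion[OF mu] by simp
      have it: "integrable lborel (\<lambda>x. of_real (\<phi> (x - t *\<^sub>R e)) * u x)"
        using box_bump_integrable[OF lu, of n "a + t *\<^sub>R e" "b + t *\<^sub>R e"] integrable_completion[OF mt]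
        by (simp add: \<phi>_def box_bump_shift)
      have "(LINT x|lborel. of_real (\<phi> x) * u (x + t *\<^sub>R e)) = (LINT x|lborel. of_real (\<phi> (x - t *\<^sub>R e)) * u x)"
        using integral_lborel_shift[of "\<lambda>x. of_real (\<phi> (x - t *\<^sub>R e)) * u x" "t *\<^sub>R e"] mt by simp
      then have "(LINT x|lborel. of_real (\<phi> x) * u (x + t *\<^sub>R e)) - (LINT x|lborel. of_real (\<phi> x) * u x)
          = (LINT x|lborel. of_real (\<phi> (x - t *\<^sub>R e)) * u x - of_real (\<phi> x) * u x)"
        using it iu by simp
      also have "\<dots> = (LINT x|lborel. - (u x * (LINT s|lborel. indicator {0..t} s *\<^sub>R complex_of_real (\<psi> (x
          + s *\<^sub>R (- e))))))"
      proof (rule Bochner_Integration.integral_cong[OF refl])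
        fix x
        have "of_real (\<phi> (x - t *\<^sub>R e)) * u x - of_real (\<phi> x) * u x
            = u x * complex_of_real (\<phi> (x - t *\<^sub>R e) - \<phi> x)" by (simp add: algebra_simps)
        also have "\<phi> (x - t *\<^sub>R e) - \<phi> x = - (LINT s|lborel. indicator {0..t} s *\<^sub>R \<psi> (x - s *\<^sub>R e))"
          unfolding \<phi>_def \<psi>_def e_def by (rule box_bump_difference[OF t])
        also have "complex_of_real \<dots> = - (LINT s|lborel. complex_of_real (indicator {0..t} s *\<^sub>R \<psi> (x - s *\<^sub>R e)))"
          by (simp only: of_real_minus integral_complex_of_real)
        finally show "of_real (\<phi> (x - t *\<^sub>R e)) * u x - of_real (\<phi> x) * u x
            = - (u x * (LINT s|lborel. indicator {0..t} s *\<^sub>R complex_of_real (\<psi> (x + s *\<^sub>R (- e)))))"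
          by (simp add: scaleR_conv_of_real)
      qed
      also have "\<dots> = - (LINT s|lborel. indicator {0..t} s *\<^sub>R (LINT x|lborel. u x * complex_of_real (\<psi> (x
          + s *\<^sub>R (- e)))))"
        by (simp only: Bochner_Integration.integral_minus shift_product_Fubini(1)[OF um \<psi>L(1) u \<psi>L(2)])
      also have "\<dots> = (LINT s|lborel. indicator {0..t} s *\<^sub>R (LINT x|lborel. of_real (\<phi> x) * g (x + s *\<^sub>R e)))"
        using weak by simp
      also have "\<dots> = (LINT x|lborel. of_real (\<phi> x) * G x)"
        unfolding G_def by (rule shift_product_Fubini(1)[OF \<phi>L(1) gm \<phi>L(2) g, symmetric])
      moreover have "(LINT x|lebesgue. of_real (\<phi> x) * G x) = (LINT x|lborel. of_real (\<phi> x) * G x)"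
        unfolding G_def
        by (rule integral_completion[OF borel_measurable_integrable[OF shift_product_Fubini(2)[OF \<phi>L(1) gm \<phi>L(2) g]]])
      ultimately show ?thesis
        using integral_completion[OF mu] integral_completion[OF mut] by simp
    qed
    moreover have "(LINT x|lebesgue. of_real (\<phi> x) * w' x)
        = (LINT x|lebesgue. of_real (\<phi> x) * u (x + t *\<^sub>R e) - of_real (\<phi> x) * u x - of_real (\<phi> x) * G x)"
      by (simp add: w'_def algebra_simps)
    moreover have "\<dots> = (LINT x|lebesgue. of_real (\<phi> x) * u (x + t *\<^sub>R e)) - (LINT x|lebesgue. of_real (\<phi> x) * u x)
        - (LINT x|lebesgue. of_real (\<phi> x) * G x)"
      using Bochner_Integration.integral_diff[OF Bochner_Integration.integrable_diff[OF int[OF lut] int[OF lu]] int[OF G]]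
        Bochner_Integration.integral_diff[OF int[OF lut] int[OF lu]] by simp
    ultimately show "(LINT x|lebesgue. of_real (box_bump n a b x) * w' x) = 0"
      by (simp add: \<phi>_def)
  qed
  then have "AE x in lborel. w' x = 0" by (simp add: AE_completion_iff)
  then show ?thesis by eventually_elim (simp add: w'_def G_def e_def)
qed

section \<open>The translation estimate\<close>

lemma norm_integral_le_nn_integral:
  fixes f :: "'a \<Rightarrow> 'b::{banach, second_countable_topology}"
  shows "ennreal (norm (integral\<^sup>L M f)) \<le> (\<integral>\<^sup>+x. ennreal (norm (f x)) \<partial>M)"
  by (cases "integrable M f") (auto simp: integral_norm_bound_ennreal not_integrable_integral_eq)

text \<open>The Cauchy-Schwarz inequality, with a nonnegative integral on the right so that it can be integrated
in further variables by Tonelli's theorem.\<close>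

lemma norm_set_integral_squared_le:
  fixes f :: "'a \<Rightarrow> 'b::{banach, second_countable_topology}"
  assumes [measurable]: "f \<in> borel_measurable M" "A \<in> sets M"
  shows "ennreal ((norm (LINT x|M. indicator A x *\<^sub>R f x))\<^sup>2)
    \<le> emeasure M A * (\<integral>\<^sup>+x. indicator A x * ennreal ((norm (f x))\<^sup>2) \<partial>M)"
proof -
  have "ennreal ((norm (LINT x|M. indicator A x *\<^sub>R f x))\<^sup>2) = (ennreal (norm (LINT x|M. indicator A x *\<^sub>R f x)))\<^sup>2"
    by (simp add: ennreal_power)
  also have "\<dots> \<le> (\<integral>\<^sup>+x. ennreal (norm (indicator A x *\<^sub>R f x)) \<partial>M)\<^sup>2"
    by (intro power_mono norm_integral_le_nn_integral) simp
  also have "(\<integral>\<^sup>+x. ennreal (norm (indicator A x *\<^sub>R f x)) \<partial>M)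
      = (\<integral>\<^sup>+x. indicator A x * (indicator A x * ennreal (norm (f x))) \<partial>M)"
    by (intro nn_integral_cong) (auto simp: indicator_def)
  also have "\<dots>\<^sup>2 \<le> (\<integral>\<^sup>+x. (indicator A x)\<^sup>2 \<partial>M) * (\<integral>\<^sup>+x. (indicator A x * ennreal (norm (f x)))\<^sup>2 \<partial>M)"
    by (intro Cauchy_Schwarz_nn_integral) measurable
  also have "(\<integral>\<^sup>+x. (indicator A x)\<^sup>2 \<partial>M) = (\<integral>\<^sup>+x. indicator A x \<partial>M)"
    by (intro nn_integral_cong) (auto simp: indicator_def)
  also have "\<dots> = emeasure M A" by simp
  also have "(\<integral>\<^sup>+x. (indicator A x * ennreal (norm (f x)))\<^sup>2 \<partial>M) = (\<integral>\<^sup>+x. indicator A x * ennreal ((norm (f x))\<^sup>2) \<partial>M)"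
    by (intro nn_integral_cong) (auto simp: indicator_def ennreal_power)
  finally show ?thesis .
qed

lemma nrm_le_of_nn_integral:
  fixes u :: "real^'n \<Rightarrow> complex"
  assumes u: "u \<in> L2" and "(\<integral>\<^sup>+x. ennreal ((cmod (u x))\<^sup>2) \<partial>lborel) \<le> ennreal (c\<^sup>2)" "0 \<le> c"
  shows "L2sp.nrm u \<le> c"
proof -
  have "L2sp.sqn u \<le> c\<^sup>2" using assms L2_borel_finite[OF u] by simp
  then show ?thesis unfolding L2sp.nrm_def using \<open>0 \<le> c\<close> by (intro real_le_lsqrt L2sp.sqn_nonneg u) auto
qed

text \<open>Cauchy-Schwarz on the line integral of length \<open>t\<close> gives one factor \<open>t\<close>, integration of the translates over the
segment gives the other.\<close>

lemma translation_axis_nonneg: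
  fixes u g :: "real^'n \<Rightarrow> complex"
  assumes um: "u \<in> borel_measurable borel" and gm: "g \<in> borel_measurable borel"
    and u: "u \<in> L2" and g: "g \<in> L2" and w: "has_weak_partial_deriv i u g" and t: "0 \<le> t"
  shows "L2sp.nrm (\<lambda>x. u (x + t *\<^sub>R axis i 1) - u x) \<le> t * L2sp.nrm g"
proof (rule nrm_le_of_nn_integral)
  let ?e = "axis i 1 :: real^'n"
  let ?G = "\<lambda>x s. ennreal ((cmod (g (x + s *\<^sub>R ?e)))\<^sup>2)"
  note [measurable] = um gm
  show "(\<lambda>x. u (x + t *\<^sub>R ?e) - u x) \<in> L2" by (intro L2sp.diff_mem L2_shift um u)
  show "0 \<le> t * L2sp.nrm g" using t L2sp.nrm_nonneg[OF g] by simp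
  have "AE x in lborel. ennreal ((cmod (u (x + t *\<^sub>R ?e) - u x))\<^sup>2)
      \<le> ennreal t * (\<integral>\<^sup>+s. indicator {0..t} s * ?G x s \<partial>lborel)"
    using weak_partial_deriv_integrated[OF um gm u g w t]
  proof eventually_elim
    case (elim x)
    have "ennreal ((norm (LINT s|lborel. indicator {0..t} s *\<^sub>R g (x + s *\<^sub>R ?e)))\<^sup>2)
        \<le> emeasure lborel {0..t} * (\<integral>\<^sup>+s. indicator {0..t} s * ennreal ((norm (g (x + s *\<^sub>R ?e)))\<^sup>2) \<partial>lborel)"
      by (rule norm_set_integral_squared_le) measurable
    then show ?case using t by (simp add: elim emeasure_lborel_Icc_eq)
  qed
  then have "(\<integral>\<^sup>+x. ennreal ((cmod (u (x + t *\<^sub>R ?e) - u x))\<^sup>2) \<partial>lborel)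
      \<le> (\<integral>\<^sup>+x. ennreal t * (\<integral>\<^sup>+s. indicator {0..t} s * ?G x s \<partial>lborel) \<partial>lborel)"
    by (rule nn_integral_mono_AE)
  also have "\<dots> = ennreal t * (\<integral>\<^sup>+x. (\<integral>\<^sup>+s. indicator {0..t} s * ?G x s \<partial>lborel) \<partial>lborel)"
    by (rule nn_integral_cmult) measurable
  also have "(\<integral>\<^sup>+x. (\<integral>\<^sup>+s. indicator {0..t} s * ?G x s \<partial>lborel) \<partial>lborel)
      = (\<integral>\<^sup>+s. (\<integral>\<^sup>+x. indicator {0..t} s * ?G x s \<partial>lborel) \<partial>lborel)"
    by (rule lborel_pair.Fubini'[symmetric]) measurable
  also have "\<dots> = (\<integral>\<^sup>+s. ennreal (L2sp.sqn g) * indicator {0..t} s \<partial>lborel)"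
  proof (intro nn_integral_cong)
    fix s :: real
    have "(\<integral>\<^sup>+x. ?G x s \<partial>lborel) = ennreal (L2sp.sqn g)"
      using nn_integral_lborel_shift[of "\<lambda>x. ennreal ((cmod (g x))\<^sup>2)" "s *\<^sub>R ?e"] by (simp add: L2_borel_finite g)
    then show "(\<integral>\<^sup>+x. indicator {0..t} s * ?G x s \<partial>lborel)
        = ennreal (L2sp.sqn g) * indicator {0..t} s"
      by (simp add: nn_integral_cmult mult.commute)
  qed
  also have "\<dots> = ennreal (L2sp.sqn g) * ennreal t"
    using t by (simp add: nn_integral_cmult_indicator emeasure_lborel_Icc_eq)
  also have "ennreal t * (ennreal (L2sp.sqn g) * ennreal t) = ennreal ((t * L2sp.nrm g)\<^sup>2)"
    using t L2sp.sqn_nonneg[OF g]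
    by (simp add: ennreal_mult[symmetric] power_mult_distrib L2sp.nrm_sq[OF g], simp add: power2_eq_square mult_ac)
  finally show "(\<integral>\<^sup>+x. ennreal ((cmod (u (x + t *\<^sub>R ?e) - u x))\<^sup>2) \<partial>lborel) \<le> ennreal ((t * L2sp.nrm g)\<^sup>2)" .
qed

text \<open>A negative translation is undone by a positive one, which preserves norms.\<close>

lemma translation_axis:
  fixes u g :: "real^'n \<Rightarrow> complex"
  assumes um: "u \<in> borel_measurable borel"
    and u: "u \<in> L2" and g: "g \<in> L2" and w: "has_weak_partial_deriv i u g"
  shows "L2sp.nrm (\<lambda>x. u (x + t *\<^sub>R axis i 1) - u x) \<le> \<bar>t\<bar> * L2sp.nrm g"
proof -
  let ?e = "axis i 1 :: real^'n"
  obtain g' where g': "g' \<in> borel_measurable borel" "g' \<in> L2" "AE x in lebesgue. g x = g' x"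
    using L2_borel_representative[OF g] by blast
  have w': "has_weak_partial_deriv i u g'"
    by (rule has_weak_partial_deriv_cong_AE[OF w L2_locally_integrable[OF u] _ L2_locally_integrable[OF g'(2)] g'(3)]) simp
  have eq: "L2sp.nrm g' = L2sp.nrm g"
    using g'(3) L2_inner_cong_AE[OF g g'(2) g g'(2)] by (simp add: L2sp.nrm_def L2sp.sqn_def)
  have nonneg: "L2sp.nrm (\<lambda>x. u (x + s *\<^sub>R ?e) - u x) \<le> s * L2sp.nrm g" if "0 \<le> s" for s
    using translation_axis_nonneg[OF um g'(1) u g'(2) w' that] eq by simp
  show ?thesis
  proof (cases "0 \<le> t")
    case False
    have ut: "(\<lambda>x. u (x + t *\<^sub>R ?e)) \<in> L2" by (rule L2_shift[OF um u])
    have "L2sp.nrm (\<lambda>x. u (x + t *\<^sub>R ?e) - u x)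
        = L2sp.nrm (\<lambda>x. u (x + (- t) *\<^sub>R ?e + t *\<^sub>R ?e) - u (x + (- t) *\<^sub>R ?e))"
    proof (rule L2_shift_nrm[symmetric])
      show "(\<lambda>x. u (x + t *\<^sub>R ?e) - u x) \<in> borel_measurable borel" using um by simp
      show "(\<lambda>x. u (x + t *\<^sub>R ?e) - u x) \<in> L2" by (intro L2sp.diff_mem ut u)
    qed
    also have "\<dots> = L2sp.nrm (\<lambda>x. u (x + (- t) *\<^sub>R ?e) - u x)"
      using L2sp.nrm_diff_commute[OF u L2_shift[OF um u, of "(- t) *\<^sub>R ?e"]] by simp
    also have "\<dots> \<le> (- t) * L2sp.nrm g" by (rule nonneg) (use False in simp)
    finally show ?thesis using False by simp
  qed (use nonneg in simp)
qed

text \<open>The translation is carried out one coordinate at a time.\<close>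

lemma translation_estimate:
  fixes u :: "real^'n \<Rightarrow> complex"
  assumes um: "u \<in> borel_measurable borel" and u: "u \<in> L2"
    and g: "\<And>i. g i \<in> L2" and w: "\<And>i. has_weak_partial_deriv i u (g i)"
  shows "L2sp.nrm (\<lambda>x. u (x + h) - u x) \<le> (\<Sum>i\<in>UNIV. \<bar>h $ i\<bar> * L2sp.nrm (g i))"
proof -
  have shift: "(\<lambda>x. u (x + c)) \<in> L2" for c by (rule L2_shift[OF um u])
  have "L2sp.nrm (\<lambda>x. u (x + (\<Sum>i\<in>I. h $ i *\<^sub>R axis i 1)) - u x) \<le> (\<Sum>i\<in>I. \<bar>h $ i\<bar> * L2sp.nrm (g i))"
    if "finite I" for I
    using that
  proof (induction I)
    case empty
    have "L2sp.nrm (\<lambda>x::real^'n. 0) = 0" by (simp add: L2_nrm_zero_iff[OF L2sp.zero_mem])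
    then show ?case by simp
  next
    case (insert i I)
    define c where "c = (\<Sum>i\<in>I. h $ i *\<^sub>R axis i 1 :: real^'n)"
    define d where "d = h $ i *\<^sub>R (axis i 1 :: real^'n)"
    have "L2sp.nrm (\<lambda>x. u (x + (d + c)) - u x) \<le> L2sp.nrm (\<lambda>x. u (x + (d + c)) - u (x + c)) + L2sp.nrm (\<lambda>x. u (x
        + c) - u x)"
      by (rule L2sp.nrm_triangle_diff[OF shift shift u])
    also have "L2sp.nrm (\<lambda>x. u (x + (d + c)) - u (x + c)) = L2sp.nrm (\<lambda>x. u (x + d) - u x)"
    proof -
      have "L2sp.nrm (\<lambda>x. u (x + c + d) - u (x + c)) = L2sp.nrm (\<lambda>x. u (x + d) - u x)"
        using um by (intro L2_shift_nrm[of "\<lambda>x. u (x + d) - u x"] L2sp.diff_mem shift u) simp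
      then show ?thesis by (simp add: add_ac)
    qed
    also have "\<dots> \<le> \<bar>h $ i\<bar> * L2sp.nrm (g i)"
      unfolding d_def by (rule translation_axis[OF um u g w])
    also have "L2sp.nrm (\<lambda>x. u (x + c) - u x) \<le> (\<Sum>i\<in>I. \<bar>h $ i\<bar> * L2sp.nrm (g i))"
      unfolding c_def by (rule insert.IH)
    finally show ?case using insert.hyps by (simp add: c_def d_def)
  qed
  from this[of UNIV] show ?thesis
    using basis_expansion[of h] by (simp add: scalar_mult_eq_scaleR)
qed

section \<open>Cubes and averages over them\<close>

text \<open>The grid of mesh \<open>1/(k+1)\<close>; its half-open cubes are indexed by integer vectors, written as functions so that
the index type is countable.\<close>

definition cell :: "nat \<Rightarrow> real^'n \<Rightarrow> 'n \<Rightarrow> int" where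
  "cell k x i = \<lfloor>real (Suc k) * x $ i\<rfloor>"

definition cube :: "nat \<Rightarrow> ('n \<Rightarrow> int) \<Rightarrow> (real^'n) set" where
  "cube k z = {x. cell k x = z}"

lemma cube_measurable[measurable]: "cube k z \<in> sets borel"
proof -
  have "cube k z = {x \<in> space borel. \<forall>i. \<lfloor>real (Suc k) * x $ i\<rfloor> = z i}"
    by (auto simp: cube_def cell_def fun_eq_iff)
  also have "\<dots> \<in> sets borel" by measurable
  finally show ?thesis .
qed

lemma emeasure_cube:
  "emeasure lborel (cube k z :: (real^'n) set) = ennreal ((1 / real (Suc k)) ^ CARD('n))"
proof -
  let ?c = "real (Suc k)"
  define l where "l = (\<chi> i. of_int (z i) / ?c)"
  define r where "r = (\<chi> i. of_int (z i + 1) / ?c)"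
  have "(r - l) \<bullet> b = 1 / ?c" if "b \<in> Basis" for b
    using that by (auto simp: Basis_vec_def inner_axis r_def l_def diff_divide_distrib[symmetric])
  then have prod: "(\<Prod>b\<in>Basis. (r - l) \<bullet> b) = (1 / ?c) ^ CARD('n)" by simp
  have lr: "l \<bullet> b \<le> r \<bullet> b" if "b \<in> Basis" for b
    using that by (auto simp: Basis_vec_def inner_axis r_def l_def divide_right_mono)
  have *: "x \<in> cube k z \<longleftrightarrow> (\<forall>i. of_int (z i) \<le> ?c * x $ i \<and> ?c * x $ i < of_int (z i) + 1)" for x :: "real^'n"
    by (auto simp: cube_def cell_def fun_eq_iff floor_eq_iff)
  have "box l r \<subseteq> cube k z"
  proof
    fix x assume "x \<in> box l r"
    then have "l $ i < x $ i \<and> x $ i < r $ i" for i by (simp add: mem_box_cart)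
    then have "of_int (z i) < ?c * x $ i \<and> ?c * x $ i < of_int (z i) + 1" for i
      by (simp add: l_def r_def field_simps)
    then show "x \<in> cube k z" unfolding * by (blast intro: less_imp_le)
  qed
  then have "ennreal ((1 / ?c) ^ CARD('n)) \<le> emeasure lborel (cube k z :: (real^'n) set)"
    using emeasure_mono[of "box l r" "cube k z" lborel] by (simp add: emeasure_lborel_box lr prod)
  moreover have "cube k z \<subseteq> cbox l r"
  proof
    fix x :: "real^'n" assume "x \<in> cube k z"
    then have "of_int (z i) \<le> ?c * x $ i \<and> ?c * x $ i \<le> of_int (z i) + 1" for i
      unfolding * by (blast intro: less_imp_le)
    then have "l $ i \<le> x $ i \<and> x $ i \<le> r $ i" for i
      by (simp add: l_def r_def field_simps)
    then show "x \<in> cbox l r" by (simp add: mem_box_cart)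
  qed
  then have "emeasure lborel (cube k z :: (real^'n) set) \<le> ennreal ((1 / ?c) ^ CARD('n))"
    using emeasure_mono[of "cube k z" "cbox l r" lborel] by (simp add: emeasure_lborel_cbox lr prod)
  ultimately show ?thesis by (rule antisym[rotated])
qed

definition cube_average :: "nat \<Rightarrow> (real^'n \<Rightarrow> complex) \<Rightarrow> real^'n \<Rightarrow> complex" where
  "cube_average k u x = real (Suc k) ^ CARD('n) *\<^sub>R (LINT y|lborel. indicator (cube k (cell k x)) y *\<^sub>R u y)"

text \<open>Joint measurability is what makes averages over the cube that contains a point measurable in the
point.\<close>

lemma same_cube_measurable[measurable]:
  "(\<lambda>(x, y). indicator (cube k (cell k x)) y) \<in> borel_measurable (borel \<Otimes>\<^sub>M (borel :: (real^'n) measure))"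
proof -
  have [measurable]: "(\<lambda>z. fst z $ i) \<in> borel_measurable (borel \<Otimes>\<^sub>M (borel :: (real^'n) measure))"
      "(\<lambda>z. snd z $ i) \<in> borel_measurable ((borel :: (real^'n) measure) \<Otimes>\<^sub>M borel)" for i :: 'n
    by (intro measurable_compose[OF measurable_fst] measurable_compose[OF measurable_snd]
        borel_measurable_continuous_onI continuous_intros)+
  have "{z \<in> space (borel \<Otimes>\<^sub>M (borel :: (real^'n) measure)). \<forall>i. \<lfloor>real (Suc k) * snd z $ i\<rfloor>
      = \<lfloor>real (Suc k) * fst z $ i\<rfloor>}
     \<in> sets (borel \<Otimes>\<^sub>M (borel :: (real^'n) measure))" by measurable
  then have "indicator {z \<in> space (borel \<Otimes>\<^sub>M (borel :: (real^'n) measure)). \<forall>i. \<lfloor>real (Suc k) * snd z $ i\<rfloor>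
      = \<lfloor>real (Suc k) * fst z $ i\<rfloor>}
     \<in> borel_measurable (borel \<Otimes>\<^sub>M (borel :: (real^'n) measure))" by (rule borel_measurable_indicator)
  then show ?thesis
    by (rule measurable_cong[THEN iffD1, rotated])
       (auto simp: indicator_def cube_def cell_def fun_eq_iff space_pair_measure)
qed

lemma cube_lmeasurable: "cube k z \<in> lmeasurable"
  using emeasure_cube[of k z] cube_measurable[of k z] by (auto simp: fmeasurable_def)

lemma cube_average_measurable:
  fixes u :: "real^'n \<Rightarrow> complex"
  assumes [measurable]: "u \<in> borel_measurable borel"
  shows "cube_average k u \<in> borel_measurable borel"
proof -
  have "(\<lambda>(x, y). indicator (cube k (cell k x)) y *\<^sub>R u y) \<in> borel_measurable (borel \<Otimes>\<^sub>M (lborel :: (real^'n) measure))"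
    using borel_measurable_scaleR[OF same_cube_measurable[of k], of "\<lambda>z. u (snd z)"]
    by (simp add: case_prod_beta)
  then show ?thesis
    unfolding cube_average_def[abs_def]
    by (intro borel_measurable_scaleR borel_measurable_const lborel.borel_measurable_lebesgue_integral)
qed

text \<open>The scaling factor is the reciprocal of the volume of the cube, so this is Jensen's inequality for
the mean.\<close>

lemma norm_cube_scaled_integral_le:
  fixes f :: "real^'n \<Rightarrow> complex"
  assumes [measurable]: "f \<in> borel_measurable borel"
  shows "ennreal ((cmod (real (Suc k) ^ CARD('n) *\<^sub>R (LINT y|lborel. indicator (cube k z) y *\<^sub>R f y)))\<^sup>2)
    \<le> ennreal (real (Suc k) ^ CARD('n)) * (\<integral>\<^sup>+y. indicator (cube k z) y * ennreal ((cmod (f y))\<^sup>2) \<partial>lborel)"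
proof -
  define D where "D = real (Suc k) ^ CARD('n)"
  have D: "D > 0" by (simp add: D_def)
  let ?I = "LINT y|lborel. indicator (cube k z) y *\<^sub>R f y"
  let ?J = "\<integral>\<^sup>+y. indicator (cube k z) y * ennreal ((cmod (f y))\<^sup>2) \<partial>lborel"
  have "ennreal ((cmod (D *\<^sub>R ?I))\<^sup>2) = ennreal (D\<^sup>2) * ennreal ((cmod ?I)\<^sup>2)"
    by (simp add: power_mult_distrib ennreal_mult)
  also have "\<dots> \<le> ennreal (D\<^sup>2) * (emeasure lborel (cube k z) * ?J)"
    by (intro mult_left_mono norm_set_integral_squared_le) simp_all
  also have "emeasure lborel (cube k z) = ennreal (1 / D)"
    by (simp add: emeasure_cube D_def power_one_over inverse_eq_divide)
  also have "ennreal (D\<^sup>2) * (ennreal (1 / D) * ?J)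
      = ennreal D * ?J"
    using D by (simp add: mult.assoc[symmetric] ennreal_mult[symmetric] power2_eq_square)
  finally show ?thesis by (simp only: D_def)
qed

lemma cube_average_bound:
  fixes u :: "real^'n \<Rightarrow> complex"
  assumes um: "u \<in> borel_measurable borel" and u: "u \<in> L2"
  shows "(cmod (cube_average k u x))\<^sup>2 \<le> real (Suc k) ^ CARD('n) * L2sp.sqn u"
proof -
  have "ennreal ((cmod (cube_average k u x))\<^sup>2)
      \<le> ennreal (real (Suc k) ^ CARD('n)) * (\<integral>\<^sup>+y. indicator (cube k (cell k x)) y * ennreal ((cmod (u y))\<^sup>2) \<partial>lborel)"
    unfolding cube_average_def by (rule norm_cube_scaled_integral_le[OF um])
  also have "\<dots> \<le> ennreal (real (Suc k) ^ CARD('n)) * (\<integral>\<^sup>+y. ennreal ((cmod (u y))\<^sup>2) \<partial>lborel)"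
    by (intro mult_left_mono nn_integral_mono) (auto simp: indicator_def)
  also have "\<dots> = ennreal (real (Suc k) ^ CARD('n) * L2sp.sqn u)"
    using L2sp.sqn_nonneg[OF u] by (simp add: L2_borel_finite[OF u] ennreal_mult del: of_nat_Suc)
  finally show ?thesis using L2sp.sqn_nonneg[OF u] by simp
qed

lemma cube_integrable:
  fixes u :: "real^'n \<Rightarrow> complex"
  assumes [measurable]: "u \<in> borel_measurable borel" and u: "u \<in> L2"
  shows "integrable lborel (\<lambda>y. indicator (cube k z) y *\<^sub>R u y)"
  using L2_integrable_on_lmeasurable[OF u cube_lmeasurable, of k z]
  by (subst (asm) integrable_completion) auto

text \<open>The difference of \<open>u(x)\<close> and the mean over its cube is the mean of \<open>u(x) - u(y)\<close>, and \<open>y = x + h\<close> with \<open>h\<close> in a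
fixed box \<open>B\<close>. Enlarging the cube to \<open>x + B\<close> makes the domain of \<open>h\<close> independent of \<open>x\<close>, at the cost
of the volume ratio \<open>2\<^sup>n\<close>; for fixed \<open>h\<close> the translation estimate applies.\<close>

lemma cube_average_error:
  fixes u :: "real^'n \<Rightarrow> complex"
  assumes um: "u \<in> borel_measurable borel" and u: "u \<in> L2"
    and g: "\<And>i. g i \<in> L2" and w: "\<And>i. has_weak_partial_deriv i u (g i)"
    and S: "(\<Sum>i\<in>UNIV. L2sp.nrm (g i)) \<le> S"
  shows "(\<integral>\<^sup>+x. ennreal ((cmod (u x - cube_average k u x))\<^sup>2) \<partial>lborel) \<le> ennreal (2 ^ CARD('n) * (S / real (Suc k))\<^sup>2)"
proof -
  note [measurable] = um
  let ?T = "\<lambda>x h. ennreal ((cmod (u x - u (x + h)))\<^sup>2)"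
  define c where "c = real (Suc k)"
  define D where "D = c ^ CARD('n)"
  have c: "c > 0" and D: "D > 0" by (simp_all add: c_def D_def)
  have S0: "0 \<le> S" by (rule order_trans[OF sum_nonneg S]) (simp add: L2sp.nrm_nonneg g)
  let ?Q = "\<lambda>x. cube k (cell k x) :: (real^'n) set"
  define B :: "(real^'n) set" where "B = cbox (- (\<chi> i. 1 / c)) (\<chi> i. 1 / c)"
  have [measurable]: "B \<in> sets borel" by (simp add: B_def)
  have eB: "emeasure lborel B = ennreal ((2 / c) ^ CARD('n))"
  proof -
    have "((\<chi> i. 1 / c) - - (\<chi> i. 1 / c)) \<bullet> b = 2 / c" if "b \<in> Basis" for b :: "real^'n"
      using that by (auto simp: Basis_vec_def inner_axis)
    then have "(\<Prod>b\<in>Basis. ((\<chi> i. 1 / c) - - (\<chi> i. 1 / c)) \<bullet> (b :: real^'n)) = (2 / c) ^ CARD('n)" by simp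
    moreover have "- (\<chi> i. 1 / c) \<bullet> b \<le> (\<chi> i. 1 / c) \<bullet> b" if "b \<in> Basis" for b :: "real^'n"
      using that c by (auto simp: Basis_vec_def inner_axis)
    ultimately show ?thesis unfolding B_def by (subst emeasure_lborel_cbox) (simp_all only:)
  qed
  have Qm[measurable]: "(\<lambda>(x, y). indicator (?Q x) y) \<in> borel_measurable (borel \<Otimes>\<^sub>M (borel :: (real^'n) measure))"
    by (rule same_cube_measurable)
  have QB: "h \<in> B" if "x + h \<in> ?Q x" for x h
  proof -
    have "- (1 / c) \<le> h $ i \<and> h $ i \<le> 1 / c" for i
    proof -
      have "\<lfloor>c * (x $ i + h $ i)\<rfloor> = \<lfloor>c * x $ i\<rfloor>" using that by (auto simp: cube_def cell_def fun_eq_iff c_def)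
      then have "\<bar>c * (x $ i + h $ i) - c * x $ i\<bar> < 1" by linarith
      then have "\<bar>c * h $ i\<bar> < 1" by (simp add: algebra_simps)
      then show ?thesis using c by (auto simp: abs_less_iff field_simps)
    qed
    then show ?thesis by (simp add: B_def mem_box_cart)
  qed
  have trans: "(\<integral>\<^sup>+x. ?T x h \<partial>lborel) \<le> ennreal ((S / c)\<^sup>2)" if h: "h \<in> B" for h
  proof -
    have d: "(\<lambda>x. u (x + h) - u x) \<in> L2" by (intro L2sp.diff_mem L2_shift um u)
    have "L2sp.nrm (\<lambda>x. u (x + h) - u x) \<le> (\<Sum>i\<in>UNIV. \<bar>h $ i\<bar> * L2sp.nrm (g i))"
      by (rule translation_estimate[OF um u g w])
    also have "\<dots> \<le> (\<Sum>i\<in>UNIV. 1 / c * L2sp.nrm (g i))"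
    proof (intro sum_mono mult_right_mono L2sp.nrm_nonneg g)
      fix i
      have "- (1 / c) \<le> h $ i \<and> h $ i \<le> 1 / c" using h by (simp add: B_def mem_box_cart)
      then show "\<bar>h $ i\<bar> \<le> 1 / c" by linarith
    qed
    also have "\<dots> = 1 / c * (\<Sum>i\<in>UNIV. L2sp.nrm (g i))" by (rule sum_distrib_left[symmetric])
    also have "\<dots> \<le> 1 / c * S" using c S by (intro mult_left_mono) auto
    finally have "(L2sp.nrm (\<lambda>x. u (x + h) - u x))\<^sup>2 \<le> (S / c)\<^sup>2"
      by (intro power_mono L2sp.nrm_nonneg d) simp
    then show ?thesis
      using L2_borel_finite[OF d] L2sp.nrm_sq[OF d] by (simp add: norm_minus_commute ennreal_leI)
  qed
  have pointwise: "ennreal ((cmod (u x - cube_average k u x))\<^sup>2)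
      \<le> ennreal D * (\<integral>\<^sup>+h. indicator B h * ?T x h \<partial>lborel)" for x
  proof -
    have int1: "integrable lborel (\<lambda>y. indicator (?Q x) y *\<^sub>R u x)"
      using emeasure_cube[of k "cell k x"] by (intro integrable_scaleR_left integrable_real_indicator) auto
    have "(LINT y|lborel. indicator (?Q x) y *\<^sub>R u x) = measure lborel (?Q x) *\<^sub>R u x"
      using emeasure_cube[of k "cell k x"] by (simp add: less_top[symmetric])
    also have "measure lborel (?Q x) = 1 / D"
      using emeasure_cube[of k "cell k x"] by (simp add: measure_def D_def c_def power_one_over inverse_eq_divide)
    finally have "u x = D *\<^sub>R (LINT y|lborel. indicator (?Q x) y *\<^sub>R u x)" using D by simp
    then have "u x - cube_average k u x = D *\<^sub>R (LINT y|lborel. indicator (?Q x) y *\<^sub>R u x)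
        - D *\<^sub>R (LINT y|lborel. indicator (?Q x) y *\<^sub>R u y)"
      by (simp add: cube_average_def D_def c_def)
    also have "\<dots> = D *\<^sub>R (LINT y|lborel. indicator (?Q x) y *\<^sub>R u x - indicator (?Q x) y *\<^sub>R u y)"
      using int1 cube_integrable[OF um u, of k "cell k x"] by (simp add: scaleR_diff_right)
    finally have eq: "u x - cube_average k u x
        = real (Suc k) ^ CARD('n) *\<^sub>R (LINT y|lborel. indicator (?Q x) y *\<^sub>R (u x - u y))"
      by (simp add: D_def c_def scaleR_diff_right)
    have "ennreal ((cmod (u x - cube_average k u x))\<^sup>2)
        \<le> ennreal D * (\<integral>\<^sup>+y. indicator (?Q x) y * ennreal ((cmod (u x - u y))\<^sup>2) \<partial>lborel)"
      unfolding eq D_def c_def by (rule norm_cube_scaled_integral_le) measurable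
    also have "(\<integral>\<^sup>+y. indicator (?Q x) y * ennreal ((cmod (u x - u y))\<^sup>2) \<partial>lborel)
        = (\<integral>\<^sup>+h. indicator (?Q x) (h + x) * ennreal ((cmod (u x - u (h + x)))\<^sup>2) \<partial>lborel)"
      by (rule nn_integral_lborel_shift[symmetric]) measurable
    also have "\<dots> \<le> (\<integral>\<^sup>+h. indicator B h * ?T x h \<partial>lborel)"
      using QB[of x] by (intro nn_integral_mono) (auto simp: indicator_def add.commute)
    finally show ?thesis by (simp add: mult_left_mono)
  qed
  have "(\<integral>\<^sup>+x. ennreal ((cmod (u x - cube_average k u x))\<^sup>2) \<partial>lborel)
      \<le> (\<integral>\<^sup>+x. ennreal D * (\<integral>\<^sup>+h. indicator B h * ?T x h \<partial>lborel) \<partial>lborel)"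
    by (intro nn_integral_mono pointwise)
  also have "\<dots> = ennreal D * (\<integral>\<^sup>+x. (\<integral>\<^sup>+h. indicator B h * ?T x h \<partial>lborel) \<partial>lborel)"
    by (rule nn_integral_cmult) measurable
  also have "(\<integral>\<^sup>+x. (\<integral>\<^sup>+h. indicator B h * ?T x h \<partial>lborel) \<partial>lborel)
      = (\<integral>\<^sup>+h. (\<integral>\<^sup>+x. indicator B h * ?T x h \<partial>lborel) \<partial>lborel)"
    by (rule lborel_pair.Fubini'[symmetric]) measurable
  also have "\<dots> = (\<integral>\<^sup>+h. indicator B h * (\<integral>\<^sup>+x. ?T x h \<partial>lborel) \<partial>lborel)"
    by (intro nn_integral_cong nn_integral_cmult) measurable
  also have "\<dots> \<le> (\<integral>\<^sup>+h. ennreal ((S / c)\<^sup>2) * indicator B h \<partial>lborel)"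
    using trans by (intro nn_integral_mono) (auto simp: indicator_def)
  also have "\<dots> = ennreal ((S / c)\<^sup>2) * ennreal ((2 / c) ^ CARD('n))"
    by (simp add: nn_integral_cmult_indicator eB)
  also have "ennreal D * (ennreal ((S / c)\<^sup>2) * ennreal ((2 / c) ^ CARD('n))) = ennreal (2 ^ CARD('n) * (S / c)\<^sup>2)"
    using c D by (simp add: ennreal_mult[symmetric] D_def power_divide)
  finally show ?thesis by (simp add: c_def mult_left_mono)
qed

section \<open>Compactness under a confining potential\<close>

lemma emeasure_cube_lebesgue:
  "emeasure lebesgue (cube k z :: (real^'n) set) = ennreal ((1 / real (Suc k)) ^ CARD('n))"
proof -
  have "emeasure lebesgue (cube k z :: (real^'n) set) = (\<integral>\<^sup>+x. indicator (cube k z) x \<partial>lebesgue)"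
    by (rule nn_integral_indicator[symmetric]) (use cube_lmeasurable[of k z] in auto)
  also have "\<dots> = emeasure lborel (cube k z :: (real^'n) set)"
    by (simp add: nn_integral_completion)
  finally show ?thesis by (simp add: emeasure_cube)
qed

lemma cube_integral_bound:
  fixes u :: "real^'n \<Rightarrow> complex"
  assumes u: "u \<in> L2"
  shows "cmod (LINT x|lebesgue. indicator (cube k z) x *\<^sub>R u x) \<le> L2sp.nrm u"
proof -
  have "ennreal ((cmod (LINT x|lebesgue. indicator (cube k z) x *\<^sub>R u x))\<^sup>2)
      \<le> emeasure lebesgue (cube k z :: (real^'n) set) * (\<integral>\<^sup>+x. indicator (cube k z) x * ennreal ((cmod (u x))\<^sup>2) \<partial>lebesgue)"
    by (rule norm_set_integral_squared_le[OF L2_measurable[OF u]]) (use cube_lmeasurable[of k z] in auto)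
  also have "\<dots> \<le> 1 * (\<integral>\<^sup>+x. ennreal ((cmod (u x))\<^sup>2) \<partial>lebesgue)"
  proof (intro mult_mono nn_integral_mono)
    have "(1 / real (Suc k)) ^ CARD('n) \<le> 1" by (rule power_le_one) auto
    then show "emeasure lebesgue (cube k z :: (real^'n) set) \<le> 1"
      unfolding emeasure_cube_lebesgue by (metis ennreal_1 ennreal_leI)
  qed (auto simp: indicator_def)
  also have "\<dots> = ennreal (L2sp.sqn u)" by (simp add: nn_integral_L2 u)
  finally have "(cmod (LINT x|lebesgue. indicator (cube k z) x *\<^sub>R u x))\<^sup>2 \<le> L2sp.sqn u"
    using L2sp.sqn_nonneg[OF u] by simp
  then show ?thesis unfolding L2sp.nrm_def by (rule real_le_rsqrt)
qed

text \<open>The assumptions under which the form is closed and its domain is compactly embedded.\<close>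

locale confining_potential =
  fixes V :: "real^'n \<Rightarrow> real"
  assumes V_measurable: "V \<in> borel_measurable lebesgue"
    and V_nonneg: "AE x in lebesgue. 0 \<le> V x"
    and sublevel_finite: "M > 0 \<Longrightarrow> emeasure lebesgue (Omega M V) < \<infinity>"
begin

text \<open>Multiplication by the root of \<open>V\<close> turns the potential energy into an inner product in \<open>L\<^sup>2\<close>.\<close>

definition sqrtV :: "(real^'n \<Rightarrow> complex) \<Rightarrow> real^'n \<Rightarrow> complex" where
  "sqrtV u x = of_real (sqrt (V x)) * u x"

lemma Omega_measurable: "Omega M V \<in> sets lebesgue"
proof -
  note [measurable] = V_measurable
  have "Omega M V = {x \<in> space lebesgue. 0 \<le> V x \<and> V x < M}" by (simp add: Omega_def)
  also have "\<dots> \<in> sets lebesgue" by measurable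
  finally show ?thesis .
qed

text \<open>Where \<open>V \<ge> M\<close> the first term dominates; elsewhere \<open>u\<close> is split into its cube average and the
error.\<close>

lemma mass_splitting:
  fixes u :: "real^'n \<Rightarrow> complex"
  assumes um: "u \<in> borel_measurable borel" and u: "u \<in> L2"
    and g: "\<And>i. g i \<in> L2" and w: "\<And>i. has_weak_partial_deriv i u (g i)"
    and S: "(\<Sum>i\<in>UNIV. L2sp.nrm (g i)) \<le> S" and sV: "sqrtV u \<in> L2" "L2sp.nrm (sqrtV u) \<le> S" and M: "M > 0"
  shows "ennreal (L2sp.sqn u) \<le> ennreal (S\<^sup>2 / M) + ennreal (2 * 2 ^ CARD('n) * (S / real (Suc k))\<^sup>2)
    + 2 * (\<integral>\<^sup>+x. indicator (Omega M V) x * ennreal ((cmod (cube_average k u x))\<^sup>2) \<partial>lebesgue)"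
proof -
  let ?a = "cube_average k u"
  have [measurable]: "u \<in> borel_measurable lebesgue" "sqrtV u \<in> borel_measurable lebesgue"
    using u sV by (auto intro: L2_measurable)
  have am: "?a \<in> borel_measurable borel" by (rule cube_average_measurable[OF um])
  have [measurable]: "?a \<in> borel_measurable lebesgue"
    using am by (intro measurable_completion) simp
  have [measurable]: "Omega M V \<in> sets lebesgue" by (rule Omega_measurable)
  have "AE x in lebesgue. ennreal ((cmod (u x))\<^sup>2) \<le> (ennreal (1 / M) * ennreal ((cmod (sqrtV u x))\<^sup>2)
      + 2 * ennreal ((cmod (u x - ?a x))\<^sup>2)) + 2 * (indicator (Omega M V) x * ennreal ((cmod (?a x))\<^sup>2))"
    using V_nonneg
  proof eventually_elim
    case (elim x)
    show ?case
    proof (cases "V x < M")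
      case True
      have "(cmod (u x))\<^sup>2 \<le> (cmod (u x - ?a x) + cmod (?a x))\<^sup>2"
        using norm_triangle_sub[of "u x" "?a x"] by (intro power_mono) auto
      also have "\<dots> \<le> 2 * (cmod (u x - ?a x))\<^sup>2 + 2 * (cmod (?a x))\<^sup>2"
        using sum_squares_bound[of "cmod (u x - ?a x)" "cmod (?a x)"] by (simp add: power2_sum)
      finally have "ennreal ((cmod (u x))\<^sup>2) \<le> ennreal (2 * (cmod (u x - ?a x))\<^sup>2 + 2 * (cmod (?a x))\<^sup>2)"
        by (rule ennreal_leI)
      also have "\<dots> = 2 * ennreal ((cmod (u x - ?a x))\<^sup>2) + 2 * ennreal ((cmod (?a x))\<^sup>2)"
        by (simp add: ennreal_mult)
      finally show ?thesis
        using True elim by (auto simp: Omega_def add.assoc intro: add_increasing)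
    next
      case False
      have "(cmod (u x))\<^sup>2 \<le> 1 / M * (V x * (cmod (u x))\<^sup>2)"
        using False M mult_right_mono[of M "V x" "(cmod (u x))\<^sup>2"] by (simp add: field_simps)
      also have "V x * (cmod (u x))\<^sup>2 = (cmod (sqrtV u x))\<^sup>2"
        using elim by (simp add: sqrtV_def norm_mult power_mult_distrib)
      finally have "ennreal ((cmod (u x))\<^sup>2) \<le> ennreal (1 / M) * ennreal ((cmod (sqrtV u x))\<^sup>2)"
        using M by (subst ennreal_mult[symmetric]) (auto intro: ennreal_leI)
      then show ?thesis by (auto simp: add.assoc intro: add_increasing2)
    qed
  qed
  then have "(\<integral>\<^sup>+x. ennreal ((cmod (u x))\<^sup>2) \<partial>lebesgue)
      \<le> (\<integral>\<^sup>+x. (ennreal (1 / M) * ennreal ((cmod (sqrtV u x))\<^sup>2)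
      + 2 * ennreal ((cmod (u x - ?a x))\<^sup>2)) + 2 * (indicator (Omega M V) x * ennreal ((cmod (?a x))\<^sup>2)) \<partial>lebesgue)"
    by (rule nn_integral_mono_AE)
  also have "\<dots> = (ennreal (1 / M) * (\<integral>\<^sup>+x. ennreal ((cmod (sqrtV u x))\<^sup>2) \<partial>lebesgue)
      + 2 * (\<integral>\<^sup>+x. ennreal ((cmod (u x - ?a x))\<^sup>2) \<partial>lebesgue))
      + 2 * (\<integral>\<^sup>+x. indicator (Omega M V) x * ennreal ((cmod (?a x))\<^sup>2) \<partial>lebesgue)"
    by (simp add: nn_integral_add nn_integral_cmult)
  also have "\<dots> \<le> (ennreal (S\<^sup>2 / M) + ennreal (2 * 2 ^ CARD('n) * (S / real (Suc k))\<^sup>2))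
      + 2 * (\<integral>\<^sup>+x. indicator (Omega M V) x * ennreal ((cmod (?a x))\<^sup>2) \<partial>lebesgue)"
  proof (intro add_mono order_refl)
    have "L2sp.sqn (sqrtV u) \<le> S\<^sup>2"
      using power_mono[OF sV(2) L2sp.nrm_nonneg[OF sV(1)], of 2] by (simp add: L2sp.nrm_sq[OF sV(1)])
    then have "1 / M * L2sp.sqn (sqrtV u) \<le> S\<^sup>2 / M" using M by (simp add: divide_right_mono)
    then show "ennreal (1 / M) * (\<integral>\<^sup>+x. ennreal ((cmod (sqrtV u x))\<^sup>2) \<partial>lebesgue) \<le> ennreal (S\<^sup>2 / M)"
      unfolding nn_integral_L2[OF sV(1)] using M L2sp.sqn_nonneg[OF sV(1)]
      by (subst ennreal_mult[symmetric]) (auto intro: ennreal_leI)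
    have "2 * (\<integral>\<^sup>+x. ennreal ((cmod (u x - ?a x))\<^sup>2) \<partial>lebesgue) \<le> 2 * ennreal (2 ^ CARD('n) * (S / real (Suc k))\<^sup>2)"
      unfolding nn_integral_completion by (intro mult_left_mono cube_average_error[OF um u g w S]) simp
    then show "2 * (\<integral>\<^sup>+x. ennreal ((cmod (u x - ?a x))\<^sup>2) \<partial>lebesgue)
        \<le> ennreal (2 * 2 ^ CARD('n) * (S / real (Suc k))\<^sup>2)"
      by (simp add: ennreal_mult mult.assoc)
  qed
  finally show ?thesis by (simp add: nn_integral_L2 u)
qed

text \<open>At each point the averages tend to 0 because only one cube is involved, and they are bounded
uniformly, so dominated convergence applies on a set of finite measure.\<close>

lemma averages_vanish:
  fixes w :: "nat \<Rightarrow> real^'n \<Rightarrow> complex"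
  assumes wm: "\<And>n. w n \<in> borel_measurable borel" and w: "\<And>n. w n \<in> L2" and bnd: "\<And>n. L2sp.nrm (w n) \<le> S"
    and cubes: "\<And>z. (\<lambda>n. LINT x|lebesgue. indicator (cube k z) x *\<^sub>R w n x) \<longlonglongrightarrow> 0" and M: "M > 0"
  shows "(\<lambda>n. \<integral>\<^sup>+x. indicator (Omega M V) x * ennreal ((cmod (cube_average k (w n) x))\<^sup>2) \<partial>lebesgue) \<longlonglongrightarrow> 0"
proof -
  let ?D = "real (Suc k) ^ CARD('n)"
  let ?f = "\<lambda>n x. indicator (Omega M V) x * (cmod (cube_average k (w n) x))\<^sup>2 :: real"
  have [measurable]: "Omega M V \<in> sets lebesgue" by (rule Omega_measurable)
  have [measurable]: "cube_average k (w n) \<in> borel_measurable lebesgue" for n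
    using cube_average_measurable[OF wm] by (intro measurable_completion) simp
  have dom: "integrable lebesgue (\<lambda>x. indicator (Omega M V) x * (?D * S\<^sup>2) :: real)"
    using sublevel_finite[OF M] by (intro integrable_mult_left integrable_real_indicator) auto
  have le: "(cmod (cube_average k (w n) x))\<^sup>2 \<le> ?D * S\<^sup>2" for n x
  proof -
    have "L2sp.sqn (w n) \<le> S\<^sup>2"
      using power_mono[OF bnd L2sp.nrm_nonneg[OF w], of n 2] by (simp add: L2sp.nrm_sq[OF w])
    then have "?D * L2sp.sqn (w n) \<le> ?D * S\<^sup>2" by (intro mult_left_mono) auto
    then show ?thesis using cube_average_bound[OF wm w, of k n x] by linarith
  qed
  have fint: "integrable lebesgue (?f n)" for n
    by (rule Bochner_Integration.integrable_bound[OF dom])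
       (measurable, use le in \<open>auto simp: indicator_def\<close>)
  have "(\<lambda>n. LINT x|lebesgue. ?f n x) \<longlonglongrightarrow> (LINT x|(lebesgue :: (real^'n) measure). 0)"
  proof (rule integral_dominated_convergence[OF _ _ dom])
    show "AE x in lebesgue. (\<lambda>n. ?f n x) \<longlonglongrightarrow> 0"
    proof (rule AE_I2)
      fix x :: "real^'n"
      have "cube_average k (w n) x = ?D *\<^sub>R (LINT y|lebesgue. indicator (cube k (cell k x)) y *\<^sub>R w n y)" for n
        using wm[of n] unfolding cube_average_def by (subst integral_completion) auto
      then have "(\<lambda>n. cube_average k (w n) x) \<longlonglongrightarrow> ?D *\<^sub>R 0"
        by (simp only:) (intro tendsto_intros cubes)
      then have "(\<lambda>n. ?f n x) \<longlonglongrightarrow> indicator (Omega M V) x * (cmod (?D *\<^sub>R 0 :: complex))\<^sup>2"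
        by (intro tendsto_intros)
      then show "(\<lambda>n. ?f n x) \<longlonglongrightarrow> 0" by simp
    qed
    show "AE x in lebesgue. norm (?f n x) \<le> indicator (Omega M V) x * (?D * S\<^sup>2)" for n
      using le by (auto simp: indicator_def)
  qed measurable
  then have "(\<lambda>n. ennreal (LINT x|lebesgue. ?f n x)) \<longlonglongrightarrow> ennreal 0"
    by (intro tendsto_ennrealI) simp
  moreover have "ennreal (LINT x|lebesgue. ?f n x)
      = (\<integral>\<^sup>+x. indicator (Omega M V) x * ennreal ((cmod (cube_average k (w n) x))\<^sup>2) \<partial>lebesgue)" for n
    by (subst nn_integral_eq_integral[OF fint, symmetric]) (auto intro!: nn_integral_cong simp: indicator_def)
  ultimately show ?thesis by simp
qed

text \<open>In the splitting of the mass, first \<open>M\<close> and then the mesh are chosen to make two terms small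
uniformly in \<open>n\<close>; the third then vanishes in the limit.\<close>

lemma energy_bounded_vanishing:
  fixes w :: "nat \<Rightarrow> real^'n \<Rightarrow> complex"
  assumes w: "\<And>n. w n \<in> L2" and bnd: "\<And>n. L2sp.nrm (w n) \<le> S"
    and g: "\<And>n i. g n i \<in> L2" and wg: "\<And>n i. has_weak_partial_deriv i (w n) (g n i)"
    and S: "\<And>n. (\<Sum>i\<in>UNIV. L2sp.nrm (g n i)) \<le> S"
    and sV: "\<And>n. sqrtV (w n) \<in> L2" "\<And>n. L2sp.nrm (sqrtV (w n)) \<le> S"
    and cubes: "\<And>k z. (\<lambda>n. LINT x|lebesgue. indicator (cube k z) x *\<^sub>R w n x) \<longlonglongrightarrow> 0"
  shows "(\<lambda>n. L2sp.sqn (w n)) \<longlonglongrightarrow> 0"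
proof -
  have "\<exists>u'. u' \<in> borel_measurable borel \<and> u' \<in> L2 \<and> (AE x in lebesgue. w n x = u' x)" for n
    using L2_borel_representative[OF w] by metis
  then obtain v where vm: "\<And>n. v n \<in> borel_measurable borel" and v: "\<And>n. v n \<in> L2"
    and vw: "\<And>n. AE x in lebesgue. w n x = v n x" by metis
  have sqn_eq: "L2sp.sqn (v n) = L2sp.sqn (w n)" for n
    using L2_inner_cong_AE[OF w v w v vw vw] by (simp add: L2sp.sqn_def)
  have vg: "has_weak_partial_deriv i (v n) (g n i)" for n i
    by (rule has_weak_partial_deriv_cong_AE[OF wg L2_locally_integrable[OF v] vw L2_locally_integrable[OF g]]) simp
  have sVeq: "AE x in lebesgue. sqrtV (w n) x = sqrtV (v n) x" for n
    using vw[of n] by eventually_elim (simp add: sqrtV_def)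
  have vlm: "v n \<in> borel_measurable lebesgue" for n by (rule L2_measurable[OF v])
  have "sqrtV (v n) \<in> borel_measurable lebesgue" for n
    using V_measurable vlm[of n] unfolding sqrtV_def[abs_def] by measurable
  then have sVv: "sqrtV (v n) \<in> L2" for n by (rule L2_AE_cong[OF sV(1) _ sVeq])
  have sVb: "L2sp.nrm (sqrtV (v n)) \<le> S" for n
    using sV(2)[of n] L2_inner_cong_AE[OF sV(1) sVv sV(1) sVv sVeq sVeq, of n n]
        by (simp add: L2sp.nrm_def L2sp.sqn_def)
  have vb: "L2sp.nrm (v n) \<le> S" for n using bnd[of n] by (simp add: L2sp.nrm_def sqn_eq)
  have vcubes: "(\<lambda>n. LINT x|lebesgue. indicator (cube k z) x *\<^sub>R v n x) \<longlonglongrightarrow> 0" for k z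
  proof -
    have "(LINT x|lebesgue. indicator (cube k z) x *\<^sub>R w n x)
        = (LINT x|lebesgue. indicator (cube k z) x *\<^sub>R v n x)" for n
      using vw[of n]
      by (intro integral_cong_AE borel_measurable_integrable L2_integrable_on_lmeasurable w v cube_lmeasurable) auto
    then show ?thesis using cubes[of k z] by simp
  qed
  show ?thesis
  proof (rule LIMSEQ_I)
    fix \<epsilon> :: real assume e: "\<epsilon> > 0"
    \<comment> \<open>the summand 1 keeps M positive when S = 0\<close>
    define M where "M = 3 * (S\<^sup>2 + 1) / \<epsilon>"
    have M: "M > 0" using e by (simp add: M_def add_nonneg_pos)
    have "S\<^sup>2 / M \<le> \<epsilon> / 3"
      using e by (simp add: M_def divide_simps add_nonneg_pos)
    obtain k where k: "6 * 2 ^ CARD('n) * S\<^sup>2 / \<epsilon> < real k" using reals_Archimedean2 by blast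
    let ?A = "\<lambda>n. \<integral>\<^sup>+x. indicator (Omega M V) x * ennreal ((cmod (cube_average k (v n) x))\<^sup>2) \<partial>lebesgue"
    have kk: "2 * 2 ^ CARD('n) * (S / real (Suc k))\<^sup>2 \<le> \<epsilon> / 3"
    proof -
      have "6 * 2 ^ CARD('n) * S\<^sup>2 \<le> \<epsilon> * real (Suc k)" using k e by (simp add: field_simps)
      also have "\<dots> \<le> \<epsilon> * (real (Suc k))\<^sup>2"
        using e by (intro mult_left_mono) (auto simp: power2_eq_square)
      finally show ?thesis by (simp add: power_divide divide_simps algebra_simps)
    qed
    have "?A \<longlonglongrightarrow> 0"
      by (rule averages_vanish[OF vm v vb vcubes M])
    \<comment> \<open>7 instead of 6, so that the three terms add up to strictly less than \<epsilon>\<close>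
    then have "\<forall>\<^sub>F n in sequentially. ?A n < ennreal (\<epsilon> / 7)"
      using e by (intro order_tendstoD(2)) auto
    then obtain N where N: "\<And>n. n \<ge> N \<Longrightarrow> ?A n < ennreal (\<epsilon> / 7)"
      unfolding eventually_sequentially by blast
    have "L2sp.sqn (w n) < \<epsilon>" if "n \<ge> N" for n
    proof -
      have "ennreal (L2sp.sqn (v n)) \<le> ennreal (S\<^sup>2 / M) + ennreal (2 * 2 ^ CARD('n) * (S / real (Suc k))\<^sup>2)
          + 2 * ?A n"
        by (rule mass_splitting[OF vm v g vg S sVv sVb M])
      also have "\<dots> \<le> ennreal (\<epsilon> / 3) + ennreal (\<epsilon> / 3) + 2 * ennreal (\<epsilon> / 7)"
        using N[OF that] kk \<open>S\<^sup>2 / M \<le> \<epsilon> / 3\<close> by (intro add_mono mult_left_mono ennreal_leI) auto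
      also have "\<dots> = ennreal (\<epsilon> / 3) + ennreal (\<epsilon> / 3) + ennreal (2 * (\<epsilon> / 7))"
        using e by (subst ennreal_mult) auto
      also have "\<dots> = ennreal (\<epsilon> / 3 + \<epsilon> / 3 + 2 * (\<epsilon> / 7))"
        using e by (simp add: ennreal_plus[symmetric] del: ennreal_plus)
      finally have "L2sp.sqn (v n) \<le> \<epsilon> / 3 + \<epsilon> / 3 + 2 * (\<epsilon> / 7)" using e by (simp del: ennreal_plus)
      then show ?thesis using e sqn_eq by simp
    qed
    then show "\<exists>no. \<forall>n\<ge>no. norm (L2sp.sqn (w n) - 0) < \<epsilon>"
      using L2sp.sqn_nonneg[OF w] by auto
  qed
qed

end

section \<open>The Schroedinger form and its spectrum\<close>

lemma H1_weak_partial_deriv: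
  fixes u :: "real^'n \<Rightarrow> complex"
  assumes u: "u \<in> H1"
  shows "has_weak_partial_deriv i u (weak_partial_deriv i u)" and "weak_partial_deriv i u \<in> L2"
proof -
  obtain g where g: "g \<in> L2" "has_weak_partial_deriv i u g" using u by (auto simp: H1_def)
  show w: "has_weak_partial_deriv i u (weak_partial_deriv i u)"
    unfolding weak_partial_deriv_def by (rule someI[where P = "has_weak_partial_deriv i u", OF g(2)])
  then have "weak_partial_deriv i u \<in> borel_measurable lebesgue"
    by (intro locally_integrable_measurable) (simp add: has_weak_partial_deriv_def)
  then show "weak_partial_deriv i u \<in> L2"
    by (rule L2_AE_cong[OF g(1) _ weak_partial_deriv_unique[OF g(2) w]])
qed

lemma H1_comb:
  fixes u v :: "real^'n \<Rightarrow> complex"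
  assumes u: "u \<in> H1" and v: "v \<in> H1"
  shows "(\<lambda>x. u x + c * v x) \<in> H1"
    and "AE x in lebesgue. weak_partial_deriv i (\<lambda>x. u x + c * v x) x = weak_partial_deriv i u x
        + c * weak_partial_deriv i v x"
proof -
  have w: "has_weak_partial_deriv i (\<lambda>x. u x + c * v x) (\<lambda>x. weak_partial_deriv i u x
      + c * weak_partial_deriv i v x)" for i
    by (intro has_weak_partial_deriv_comb H1_weak_partial_deriv u v)
  have "u \<in> L2" "v \<in> L2" using u v by (auto simp: H1_def)
  then show H: "(\<lambda>x. u x + c * v x) \<in> H1"
    unfolding H1_def
  proof (intro CollectI conjI allI)
    show "(\<lambda>x. u x + c * v x) \<in> L2" by (rule L2_comb) fact+
    show "\<exists>g\<in>L2. has_weak_partial_deriv i (\<lambda>x. u x + c * v x) g" for i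
      by (rule bexI[where x = "\<lambda>x. weak_partial_deriv i u x + c * weak_partial_deriv i v x"])
        (intro w L2_comb H1_weak_partial_deriv u v)+
  qed
  show "AE x in lebesgue. weak_partial_deriv i (\<lambda>x. u x + c * v x) x = weak_partial_deriv i u x
      + c * weak_partial_deriv i v x"
    by (rule weak_partial_deriv_unique[OF H1_weak_partial_deriv(1)[OF H] w])
qed

text \<open>Both sides of the defining identity are inner products with fixed elements of \<open>L\<^sup>2\<close>, hence continuous.\<close>

lemma has_weak_partial_deriv_L2_limit:
  fixes X :: "nat \<Rightarrow> real^'n \<Rightarrow> complex"
  assumes X: "\<And>n. X n \<in> L2" and Y: "\<And>n. Y n \<in> L2" and w: "\<And>n. has_weak_partial_deriv i (X n) (Y n)"
    and u: "u \<in> L2" and g: "g \<in> L2" and Xu: "L2sp.ip_lim X u" and Yg: "L2sp.ip_lim Y g"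
  shows "has_weak_partial_deriv i u g"
  unfolding has_weak_partial_deriv_def
proof (intro conjI allI impI L2_locally_integrable u g)
  fix \<phi> :: "real^'n \<Rightarrow> real" assume \<phi>: "test_function \<phi>"
  note c = test_function_bounded_support(1)[OF \<phi>] and c' = test_function_bounded_support(2)[OF \<phi>, of i]
  obtain K where K: "compact K" "\<And>x. x \<notin> K \<Longrightarrow> \<phi> x = 0" "\<And>x. x \<notin> K \<Longrightarrow> partial_deriv i \<phi> x = 0"
    using test_function_bounded_support(3)[OF \<phi>, of i] by blast
  have inner: "(LINT x|lebesgue. of_real (f x) * v x) = L2_inner v (\<lambda>x. of_real (f x))" for f and v ::
      "real^'n \<Rightarrow> complex"
    by (simp add: L2_inner_def mult.commute)
  have "(\<lambda>n. L2_inner (X n) (\<lambda>x. of_real (partial_deriv i \<phi> x))) \<longlonglongrightarrow> L2_inner u (\<lambda>x. of_real (partial_deriv i \<phi> x))"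
    by (rule L2sp.ip_lim_ip[OF X u Xu continuous_compact_support_L2(2)[OF c' K(1) K(3)]])
  moreover have "(\<lambda>n. - L2_inner (Y n) (\<lambda>x. of_real (\<phi> x))) \<longlonglongrightarrow> - L2_inner g (\<lambda>x. of_real (\<phi> x))"
    by (intro tendsto_minus L2sp.ip_lim_ip[OF Y g Yg continuous_compact_support_L2(2)[OF c K(1) K(2)]])
  moreover have "L2_inner (X n) (\<lambda>x. of_real (partial_deriv i \<phi> x)) = - L2_inner (Y n) (\<lambda>x. of_real (\<phi> x))" for n
    using w[of n] \<phi> unfolding has_weak_partial_deriv_def inner[symmetric] by simp
  ultimately have "L2_inner u (\<lambda>x. of_real (partial_deriv i \<phi> x)) = - L2_inner g (\<lambda>x. of_real (\<phi> x))"
    by (simp add: LIMSEQ_unique)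
  then show "(LINT x|lebesgue. of_real (partial_deriv i \<phi> x) * u x) = - (LINT x|lebesgue. of_real (\<phi> x) * g x)"
    by (simp add: inner)
qed

context confining_potential
begin

lemma sqrtV_comb: "sqrtV (\<lambda>x. u x + c * v x) = (\<lambda>x. sqrtV u x + c * sqrtV v x)"
  by (simp add: sqrtV_def fun_eq_iff algebra_simps)

lemma sqrtV_measurable: "u \<in> borel_measurable lebesgue \<Longrightarrow> sqrtV u \<in> borel_measurable lebesgue"
  using V_measurable unfolding sqrtV_def[abs_def] by measurable

lemma form_domain_iff: "u \<in> form_domain V \<longleftrightarrow> u \<in> H1 \<and> sqrtV u \<in> L2"
proof (cases "u \<in> H1")
  case True
  then have um: "u \<in> borel_measurable lebesgue" by (auto simp: H1_def L2_def)
  note [measurable] = um V_measurable sqrtV_measurable[OF um]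
  have "integrable lebesgue (\<lambda>x. V x * (cmod (u x))\<^sup>2) \<longleftrightarrow> integrable lebesgue (\<lambda>x. (cmod (sqrtV u x))\<^sup>2)"
  proof (rule integrable_cong_AE)
    show "AE x in lebesgue. V x * (cmod (u x))\<^sup>2 = (cmod (sqrtV u x))\<^sup>2"
      using V_nonneg by eventually_elim (simp add: sqrtV_def norm_mult power_mult_distrib)
  qed measurable
  then show ?thesis using True sqrtV_measurable[OF um] by (simp add: form_domain_def L2_def)
qed (simp add: form_domain_def)

lemma form_domainD:
  assumes "u \<in> form_domain V"
  shows "u \<in> H1" "u \<in> L2" "sqrtV u \<in> L2" "weak_partial_deriv i u \<in> L2"
    "has_weak_partial_deriv i u (weak_partial_deriv i u)"
  using assms H1_weak_partial_deriv[of u i] by (auto simp: form_domain_iff H1_def)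

lemma form_domain_comb:
  assumes "u \<in> form_domain V" "v \<in> form_domain V"
  shows "(\<lambda>x. u x + c * v x) \<in> form_domain V"
  using assms H1_comb(1)[of u v c] L2_comb[of "sqrtV u" "sqrtV v" c] by (simp add: form_domain_iff sqrtV_comb)

text \<open>The form of \<open>H + 1\<close>: with the shift it dominates the inner product of \<open>L\<^sup>2\<close> and its norm is that of the
form domain.\<close>

definition q :: "(real^'n \<Rightarrow> complex) \<Rightarrow> (real^'n \<Rightarrow> complex) \<Rightarrow> complex" where
  "q u v = schrodinger_form V u v + L2_inner u v"

text \<open>All three terms are inner products in \<open>L\<^sup>2\<close>, so the form inherits its algebraic properties.\<close>

lemma q_eq:
  assumes u: "u \<in> form_domain V" and v: "v \<in> form_domain V"
  shows "q u v = (\<Sum>i\<in>UNIV. L2_inner (weak_partial_deriv i u) (weak_partial_deriv i v))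
    + L2_inner (sqrtV u) (sqrtV v) + L2_inner u v"
proof -
  note [measurable] = V_measurable L2_measurable[OF form_domainD(2)[OF u]] L2_measurable[OF form_domainD(2)[OF v]]
    sqrtV_measurable[OF L2_measurable[OF form_domainD(2)[OF u]]] sqrtV_measurable[OF L2_measurable[OF
        form_domainD(2)[OF v]]]
  have cnj[measurable]: "(\<lambda>x. cnj (f x)) \<in> borel_measurable lebesgue" if "f \<in> borel_measurable lebesgue"
      for f :: "real^'n \<Rightarrow> complex"
    by (intro measurable_compose[OF that] borel_measurable_continuous_onI continuous_intros)
  have "(LINT x|lebesgue. of_real (V x) * (u x * cnj (v x))) = L2_inner (sqrtV u) (sqrtV v)"
    unfolding L2_inner_def
  proof (rule integral_cong_AE)
    show "AE x in lebesgue. of_real (V x) * (u x * cnj (v x)) = sqrtV u x * cnj (sqrtV v x)"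
      using V_nonneg
    proof eventually_elim
      case (elim x)
      have "complex_of_real (V x) = of_real (sqrt (V x)) * of_real (sqrt (V x))"
        using elim by (simp flip: of_real_mult)
      then show ?case by (simp add: sqrtV_def)
    qed
  qed measurable
  then show ?thesis by (simp add: q_def schrodinger_form_def)
qed

sublocale Q: semi_inner_product "form_domain V" q
proof
  show "(\<lambda>x. 0) \<in> form_domain V"
  proof -
    have L: "(\<lambda>x. 0) \<in> (L2 :: (real^'n \<Rightarrow> complex) set)" by (rule L2sp.zero_mem)
    have "has_weak_partial_deriv i (\<lambda>x. 0) (\<lambda>x. 0)" for i :: 'n
      using L2_locally_integrable[OF L] by (simp add: has_weak_partial_deriv_def)
    then show ?thesis using L by (auto simp: form_domain_iff H1_def sqrtV_def[abs_def])
  qed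
next
  fix u v c assume "u \<in> form_domain V" "v \<in> form_domain V"
  then show "(\<lambda>x. u x + c * v x) \<in> form_domain V" by (rule form_domain_comb)
next
  fix u v w c assume u: "u \<in> form_domain V" and v: "v \<in> form_domain V" and w: "w \<in> form_domain V"
  have "L2_inner (weak_partial_deriv i (\<lambda>x. u x + c * v x)) (weak_partial_deriv i w)
      = L2_inner (weak_partial_deriv i u) (weak_partial_deriv i w)
          + c * L2_inner (weak_partial_deriv i v) (weak_partial_deriv i w)" for i
  proof -
    note uD = form_domainD(4)[OF u, of i] and vD = form_domainD(4)[OF v, of i] and wD = form_domainD(4)[OF w, of i]
    have "L2_inner (weak_partial_deriv i (\<lambda>x. u x + c * v x)) (weak_partial_deriv i w)
        = L2_inner (\<lambda>x. weak_partial_deriv i u x + c * weak_partial_deriv i v x) (weak_partial_deriv i w)"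
      using H1_comb(2)[OF form_domainD(1)[OF u] form_domainD(1)[OF v]]
      by (intro L2_inner_cong_AE form_domainD(4) form_domain_comb u v w L2_comb) auto
    then show ?thesis by (simp add: L2sp.ip_comb_left uD vD wD)
  qed
  then show "q (\<lambda>x. u x + c * v x) w = q u w + c * q v w"
    using u v w
    by (simp add: q_eq form_domain_comb sqrtV_comb L2sp.ip_comb_left
        form_domainD sum.distrib sum_distrib_left algebra_simps)
next
  fix u v assume u: "u \<in> form_domain V" and v: "v \<in> form_domain V"
  show "q v u = cnj (q u v)"
    using L2sp.ip_herm[OF form_domainD(2)[OF u] form_domainD(2)[OF v]] L2sp.ip_herm[OF form_domainD(3)[OF u]
        form_domainD(3)[OF v]]
      L2sp.ip_herm[OF form_domainD(4)[OF u] form_domainD(4)[OF v]]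
    by (simp add: q_eq u v)
next
  fix u assume u: "u \<in> form_domain V"
  show "0 \<le> Re (q u u)"
    using L2sp.ip_nonneg[OF form_domainD(2)[OF u]] L2sp.ip_nonneg[OF form_domainD(3)[OF u]]
      L2sp.ip_nonneg[OF form_domainD(4)[OF u]]
    by (simp add: q_eq u sum_nonneg)
qed

lemma Q_sqn_eq:
  assumes u: "u \<in> form_domain V"
  shows "Q.sqn u = (\<Sum>i\<in>UNIV. L2sp.sqn (weak_partial_deriv i u)) + L2sp.sqn (sqrtV u) + L2sp.sqn u"
  by (simp add: Q.sqn_def L2sp.sqn_def q_eq u)

lemma components_le:
  assumes u: "u \<in> form_domain V"
  shows "L2sp.sqn u \<le> Q.sqn u" "L2sp.nrm u \<le> Q.nrm u" "L2sp.nrm (sqrtV u) \<le> Q.nrm u"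
    "L2sp.nrm (weak_partial_deriv i u) \<le> Q.nrm u"
proof -
  have nn: "0 \<le> L2sp.sqn u" "0 \<le> L2sp.sqn (sqrtV u)" "\<And>i. 0 \<le> L2sp.sqn (weak_partial_deriv i u)"
    using form_domainD[OF u] by (auto intro: L2sp.sqn_nonneg)
  have s: "0 \<le> (\<Sum>i\<in>UNIV. L2sp.sqn (weak_partial_deriv i u))" using nn(3) by (simp add: sum_nonneg)
  have "L2sp.sqn (weak_partial_deriv i u) \<le> (\<Sum>i\<in>UNIV. L2sp.sqn (weak_partial_deriv i u))"
    using nn(3) by (intro member_le_sum) auto
  then show "L2sp.sqn u \<le> Q.sqn u" "L2sp.nrm u \<le> Q.nrm u" "L2sp.nrm (sqrtV u) \<le> Q.nrm u"
    "L2sp.nrm (weak_partial_deriv i u) \<le> Q.nrm u"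
    using nn(1,2) s unfolding L2sp.nrm_def Q.nrm_def by (auto simp: Q_sqn_eq u)
qed

lemma weak_partial_deriv_diff:
  assumes "u \<in> form_domain V" "v \<in> form_domain V"
  shows "AE x in lebesgue. weak_partial_deriv i (\<lambda>x. u x - v x) x = weak_partial_deriv i u x - weak_partial_deriv i v x"
  using H1_comb(2)[OF form_domainD(1)[OF assms(1)] form_domainD(1)[OF assms(2)], of i "-1"] by simp

lemma sqrtV_diff: "sqrtV (\<lambda>x. u x - v x) = (\<lambda>x. sqrtV u x - sqrtV v x)"
  using sqrtV_comb[of u "-1" v] by simp

lemma nrm_weak_partial_deriv_diff:
  assumes u: "u \<in> form_domain V" and v: "v \<in> form_domain V"
  shows "L2sp.nrm (\<lambda>x. weak_partial_deriv i u x - weak_partial_deriv i v x)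
      = L2sp.nrm (weak_partial_deriv i (\<lambda>x. u x - v x))"
proof -
  have d: "weak_partial_deriv i (\<lambda>x. u x - v x) \<in> L2" by (intro form_domainD Q.diff_mem u v)
  have d': "(\<lambda>x. weak_partial_deriv i u x - weak_partial_deriv i v x) \<in> L2" by (intro L2sp.diff_mem form_domainD u v)
  show ?thesis
    using L2_inner_cong_AE[OF d d' d d' weak_partial_deriv_diff[OF u v] weak_partial_deriv_diff[OF u v]]
    by (simp add: L2sp.nrm_def L2sp.sqn_def)
qed

text \<open>The functions, their weak derivatives and their products with the root of \<open>V\<close> converge in \<open>L\<^sup>2\<close> separately.
Convergence almost everywhere along a subsequence shows that the limit of the products is the
product with the limit.\<close>

lemma form_norm_complete:
  fixes X :: "nat \<Rightarrow> real^'n \<Rightarrow> complex"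
  assumes X: "\<And>n. X n \<in> form_domain V" and c: "Q.ip_cauchy X"
  shows "\<exists>u\<in>form_domain V. Q.ip_lim X u"
proof -
  have transfer: "L2sp.ip_cauchy Y"
    if le: "\<And>m n. L2sp.nrm (\<lambda>x. Y m x - Y n x) \<le> Q.nrm (\<lambda>x. Z m x - Z n x)" and cZ: "Q.ip_cauchy Z"
    for Y Z :: "nat \<Rightarrow> real^'n \<Rightarrow> complex"
    unfolding L2sp.ip_cauchy_def
  proof (intro allI impI)
    fix \<epsilon> :: real assume "\<epsilon> > 0"
    then obtain N where "\<forall>m\<ge>N. \<forall>n\<ge>N. Q.nrm (\<lambda>x. Z m x - Z n x) < \<epsilon>"
      using cZ unfolding Q.ip_cauchy_def by blast
    then show "\<exists>N. \<forall>m\<ge>N. \<forall>n\<ge>N. L2sp.nrm (\<lambda>x. Y m x - Y n x) < \<epsilon>"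
      using le_less_trans[OF le] by blast
  qed
  have cX: "L2sp.ip_cauchy X" by (rule transfer[OF components_le(2)[OF Q.diff_mem[OF X X]] c])
  obtain u r where u: "u \<in> L2" and "L2sp.ip_lim X u" and r: "strict_mono r"
    and AEu: "AE x in lebesgue. (\<lambda>n. X (r n) x) \<longlonglongrightarrow> u x"
    by (rule L2_complete[OF form_domainD(2)[OF X] cX])
  define Z where "Z = X \<circ> r"
  have Z: "Z n \<in> form_domain V" for n by (simp add: Z_def X)
  have cZ: "Q.ip_cauchy Z" unfolding Z_def by (rule Q.ip_cauchy_subseq[OF c r])
  have Zu: "L2sp.ip_lim Z u"
    using LIMSEQ_subseq_LIMSEQ[OF \<open>L2sp.ip_lim X u\<close>[unfolded L2sp.ip_lim_def] r]
    by (simp add: L2sp.ip_lim_def Z_def o_def)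
  have cV: "L2sp.ip_cauchy (\<lambda>n. sqrtV (Z n))"
    by (rule transfer[OF _ cZ]) (use components_le(3)[OF Q.diff_mem[OF Z Z]] in \<open>simp add: sqrtV_diff\<close>)
  obtain h r' where h: "h \<in> L2" and Zh: "L2sp.ip_lim (\<lambda>n. sqrtV (Z n)) h" and r': "strict_mono r'"
    and AEh: "AE x in lebesgue. (\<lambda>n. sqrtV (Z (r' n)) x) \<longlonglongrightarrow> h x"
    by (rule L2_complete[OF form_domainD(3)[OF Z] cV])
  have hu: "AE x in lebesgue. h x = sqrtV u x"
    using AEu AEh
  proof eventually_elim
    case (elim x)
    have "(\<lambda>n. Z (r' n) x) \<longlonglongrightarrow> u x"
      using LIMSEQ_subseq_LIMSEQ[OF elim(1) r'] by (simp add: Z_def o_def)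
    then have "(\<lambda>n. sqrtV (Z (r' n)) x) \<longlonglongrightarrow> sqrtV u x" unfolding sqrtV_def by (intro tendsto_intros)
    then show ?case using elim(2) LIMSEQ_unique by blast
  qed
  have sVu: "sqrtV u \<in> L2" by (rule L2_AE_cong[OF h sqrtV_measurable[OF L2_measurable[OF u]] hu])
  have "\<exists>g. g \<in> L2 \<and> L2sp.ip_lim (\<lambda>n. weak_partial_deriv i (Z n)) g" for i
  proof -
    have "L2sp.ip_cauchy (\<lambda>n. weak_partial_deriv i (Z n))"
      by (rule transfer[OF _ cZ]) (use components_le(4)[OF Q.diff_mem[OF Z Z]] in
          \<open>simp add: nrm_weak_partial_deriv_diff Z\<close>)
    then obtain g r where "g \<in> L2" "L2sp.ip_lim (\<lambda>n. weak_partial_deriv i (Z n)) g"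
        "strict_mono (r :: nat \<Rightarrow> nat)" "AE x in lebesgue. (\<lambda>n. weak_partial_deriv i (Z (r n)) x) \<longlonglongrightarrow> g x"
      by (rule L2_complete[OF form_domainD(4)[OF Z]])
    then show ?thesis by blast
  qed
  then obtain g where g: "\<And>i. g i \<in> L2" and Zg: "\<And>i. L2sp.ip_lim (\<lambda>n. weak_partial_deriv i (Z n)) (g i)" by metis
  have ug: "has_weak_partial_deriv i u (g i)" for i
    by (rule has_weak_partial_deriv_L2_limit[OF form_domainD(2)[OF Z] form_domainD(4)[OF Z]
        form_domainD(5)[OF Z] u g Zu Zg])
  have uF: "u \<in> form_domain V"
    using u g ug sVu by (auto simp: form_domain_iff H1_def)
  have lim0: "(\<lambda>n. L2sp.sqn (\<lambda>x. Y n x - y x)) \<longlonglongrightarrow> 0"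
    if "L2sp.ip_lim Y y" "\<And>n. Y n \<in> L2" "y \<in> L2" for Y and y :: "real^'n \<Rightarrow> complex"
    using tendsto_power[OF that(1)[unfolded L2sp.ip_lim_def], of 2] that(2,3)
    by (simp add: L2sp.nrm_sq L2sp.diff_mem)
  have "Q.sqn (\<lambda>x. Z n x - u x) = (\<Sum>i\<in>UNIV. L2sp.sqn (\<lambda>x. weak_partial_deriv i (Z n) x - g i x))
      + L2sp.sqn (\<lambda>x. sqrtV (Z n) x - h x) + L2sp.sqn (\<lambda>x. Z n x - u x)" for n
  proof -
    have d: "(\<lambda>x. Z n x - u x) \<in> form_domain V" by (intro Q.diff_mem Z uF)
    have "L2sp.sqn (weak_partial_deriv i (\<lambda>x. Z n x - u x)) = L2sp.sqn (\<lambda>x. weak_partial_deriv i (Z n) x - g i x)" for i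
    proof -
      have eq: "AE x in lebesgue. weak_partial_deriv i (\<lambda>x. Z n x - u x) x = weak_partial_deriv i (Z n) x - g i x"
        using weak_partial_deriv_diff[OF Z[of n] uF, of i] weak_partial_deriv_unique[OF ug[of i] form_domainD(5)[OF uF]]
        by eventually_elim simp
      have m: "weak_partial_deriv i (\<lambda>x. Z n x - u x) \<in> L2" "(\<lambda>x. weak_partial_deriv i (Z n) x - g i x) \<in> L2"
        by (intro form_domainD d, intro L2sp.diff_mem form_domainD Z g)
      show ?thesis using L2_inner_cong_AE[OF m m eq eq] by (simp add: L2sp.sqn_def)
    qed
    moreover have "L2sp.sqn (sqrtV (\<lambda>x. Z n x - u x)) = L2sp.sqn (\<lambda>x. sqrtV (Z n) x - h x)"
    proof -
      have eq: "AE x in lebesgue. sqrtV (\<lambda>x. Z n x - u x) x = sqrtV (Z n) x - h x"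
        using hu by eventually_elim (simp add: sqrtV_diff)
      have m: "sqrtV (\<lambda>x. Z n x - u x) \<in> L2" "(\<lambda>x. sqrtV (Z n) x - h x) \<in> L2"
        by (intro form_domainD d, intro L2sp.diff_mem form_domainD Z h)
      show ?thesis using L2_inner_cong_AE[OF m m eq eq] by (simp add: L2sp.sqn_def)
    qed
    ultimately show ?thesis by (simp add: Q_sqn_eq d)
  qed
  moreover have "(\<lambda>n. (\<Sum>i\<in>UNIV. L2sp.sqn (\<lambda>x. weak_partial_deriv i (Z n) x - g i x))
      + L2sp.sqn (\<lambda>x. sqrtV (Z n) x - h x) + L2sp.sqn (\<lambda>x. Z n x - u x)) \<longlonglongrightarrow> (\<Sum>i\<in>(UNIV::'n set). 0) + 0 + 0"
    by (intro tendsto_intros lim0 Zg Zh Zu g h u form_domainD Z)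
  ultimately have "(\<lambda>n. Q.sqn (\<lambda>x. Z n x - u x)) \<longlonglongrightarrow> 0" by simp
  then have "Q.ip_lim Z u"
    unfolding Q.ip_lim_def Q.nrm_def using tendsto_real_sqrt by fastforce
  then have "Q.ip_lim X u" unfolding Z_def by (rule Q.ip_lim_of_subseq[OF X uF c r])
  with uF show ?thesis by blast
qed

text \<open>A diagonal argument makes the integrals over all cubes of all grids converge. If the resulting
subsequence were not Cauchy, differences of arbitrarily late members would stay away from 0 in norm,
although their cube integrals tend to 0 and their energies are bounded.\<close>

lemma form_bounded_precompact:
  fixes X :: "nat \<Rightarrow> real^'n \<Rightarrow> complex"
  assumes X: "\<And>n. X n \<in> form_domain V" and C: "\<And>n. Q.sqn (X n) \<le> C"
  shows "\<exists>r. strict_mono r \<and> L2sp.ip_cauchy (X \<circ> r)"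
proof -
  have nC: "Q.nrm (X n) \<le> sqrt C" for n unfolding Q.nrm_def using C by simp
  define F where "F n z = (LINT x|lebesgue. indicator (cube (fst z) (snd z)) x *\<^sub>R X n x)" for n :: nat and z ::
      "nat \<times> ('n \<Rightarrow> int)"
  have Fb: "cmod (F n z) \<le> sqrt C" for n z
    unfolding F_def
    using cube_integral_bound[OF form_domainD(2)[OF X]] components_le(2)[OF X] nC order_trans by metis
  obtain r where r: "strict_mono (r :: nat \<Rightarrow> nat)"
    and conv': "\<And>z. z \<in> UNIV \<Longrightarrow> \<exists>l. (\<lambda>n. F (r n) z) \<longlonglongrightarrow> l"
    by (rule function_convergent_subsequence[of "UNIV :: (nat \<times> ('n \<Rightarrow> int)) set" F "sqrt C", OF _ Fb]) simp_all
  have conv: "\<exists>l. (\<lambda>n. F (r n) z) \<longlonglongrightarrow> l" for z by (rule conv'[OF UNIV_I])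
  have "L2sp.ip_cauchy (X \<circ> r)"
  proof (rule ccontr)
    assume "\<not> L2sp.ip_cauchy (X \<circ> r)"
    then obtain \<epsilon> where e: "\<epsilon> > 0" and "\<forall>N. \<exists>m\<ge>N. \<exists>n\<ge>N. \<not> L2sp.nrm (\<lambda>x. (X \<circ> r) m x - (X \<circ> r) n x) < \<epsilon>"
      unfolding L2sp.ip_cauchy_def by blast
    then obtain m n :: "nat \<Rightarrow> nat" where m: "\<And>N. N \<le> m N" and n: "\<And>N. N \<le> n N"
      and big: "\<And>N. \<not> L2sp.nrm (\<lambda>x. (X \<circ> r) (m N) x - (X \<circ> r) (n N) x) < \<epsilon>" by metis
    define w where "w N = (\<lambda>x. X (r (m N)) x - X (r (n N)) x)" for N
    have w: "w N \<in> form_domain V" for N unfolding w_def by (intro Q.diff_mem X)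
    define S where "S = 2 * sqrt C"
    have wS: "Q.nrm (w N) \<le> S" for N
    proof -
      have "Q.nrm (w N) \<le> Q.nrm (X (r (m N))) + Q.nrm (X (r (n N)))"
        using Q.nrm_triangle[OF X Q.scale_mem[OF X, of "-1"], of "r (m N)" "r (n N)"] Q.nrm_scale[OF X, of "-1"]
        by (simp add: w_def)
      then show ?thesis using nC[of "r (m N)"] nC[of "r (n N)"] by (simp add: S_def)
    qed
    have S0: "0 \<le> S" using order_trans[OF Q.nrm_nonneg[OF w] wS] .
    \<comment> \<open>one bound for the sum over the coordinates and for the single terms\<close>
    have SC: "S \<le> real CARD('n) * S"
    proof -
      have "1 \<le> CARD('n)" by (simp add: Suc_leI)
      then have "1 * S \<le> real CARD('n) * S" using S0 by (intro mult_right_mono) auto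
      then show ?thesis by simp
    qed
    have "(\<lambda>N. L2sp.sqn (w N)) \<longlonglongrightarrow> 0"
    proof (rule energy_bounded_vanishing[where g = "\<lambda>N i. weak_partial_deriv i (w N)" and S = "real CARD('n) * S"])
      fix N
      show "w N \<in> L2" "sqrtV (w N) \<in> L2" by (intro form_domainD w)+
      show "L2sp.nrm (w N) \<le> real CARD('n) * S" "L2sp.nrm (sqrtV (w N)) \<le> real CARD('n) * S"
        using components_le(2,3)[OF w, of N] wS[of N] SC by linarith+
      show "weak_partial_deriv i (w N) \<in> L2" "has_weak_partial_deriv i (w N) (weak_partial_deriv i (w N))" for i
        by (intro form_domainD w)+
      have "L2sp.nrm (weak_partial_deriv i (w N)) \<le> S" for i
        using components_le(4)[OF w, of i N] wS[of N] by linarith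
      then show "(\<Sum>i\<in>UNIV. L2sp.nrm (weak_partial_deriv i (w N))) \<le> real CARD('n) * S"
        by (intro sum_bounded_above) auto
    next
      fix k z
      obtain l where l: "(\<lambda>n. F (r n) (k, z)) \<longlonglongrightarrow> l" using conv by blast
      have "(\<lambda>N. F (r (m N)) (k, z) - F (r (n N)) (k, z)) \<longlonglongrightarrow> l - l"
        by (intro tendsto_diff filterlim_compose[OF l] filterlim_at_top_mono[OF filterlim_ident])
           (simp_all add: m n)
      moreover have "F (r (m N)) (k, z) - F (r (n N)) (k, z)
          = (LINT x|lebesgue. indicator (cube k z) x *\<^sub>R w N x)" for N
      proof -
        have i: "integrable lebesgue (\<lambda>x. indicator (cube k z) x *\<^sub>R X j x)" for j
          by (intro L2_integrable_on_lmeasurable form_domainD X cube_lmeasurable)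
        show ?thesis
          unfolding F_def w_def fst_conv snd_conv scaleR_diff_right
          by (rule Bochner_Integration.integral_diff[OF i i, symmetric])
      qed
      ultimately show "(\<lambda>N. LINT x|lebesgue. indicator (cube k z) x *\<^sub>R w N x) \<longlonglongrightarrow> 0" by simp
    qed
    then have "\<forall>\<^sub>F N in sequentially. L2sp.sqn (w N) < \<epsilon>\<^sup>2" using e by (intro order_tendstoD(2)) auto
    then obtain N where "L2sp.sqn (w N) < \<epsilon>\<^sup>2" unfolding eventually_sequentially by blast
    then have "L2sp.nrm (w N) < \<epsilon>" unfolding L2sp.nrm_def using e by (intro real_less_lsqrt) auto
    then show False using big[of N] by (simp add: w_def)
  qed
  with r show ?thesis by blast
qed

sublocale form: compactly_embedded_form L2 L2_inner "form_domain V" q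
proof
  show "form_domain V \<subseteq> L2" using form_domainD(2) by blast
  show "L2sp.sqn u \<le> Q.sqn u" if "u \<in> form_domain V" for u using components_le(1)[OF that] .
  show "\<exists>u\<in>form_domain V. Q.ip_lim X u"
    if "\<And>n::nat. X n \<in> form_domain V" "Q.ip_cauchy X" for X using form_norm_complete[OF that] .
  show "\<exists>r. strict_mono r \<and> L2sp.ip_cauchy (X \<circ> r)"
    if "\<And>n::nat. X n \<in> form_domain V" "\<And>n. Q.sqn (X n) \<le> C" for X C using form_bounded_precompact[OF that] .
qed

text \<open>The spectral parameter \<open>z\<close> of \<open>H\<close> becomes the parameter \<open>z + 1\<close> of the shifted form.\<close>

lemma schrodinger_operator_iff:
  assumes f: "f \<in> L2"
  shows "(u, \<lambda>x. f x + z * u x) \<in> schrodinger_operator V \<longleftrightarrow>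
    u \<in> form_domain V \<and> (\<forall>v\<in>form_domain V. q u v = L2_inner (\<lambda>x. f x + (z + 1) * u x) v)"
proof (cases "u \<in> form_domain V")
  case u: True
  have "schrodinger_form V u v = L2_inner (\<lambda>x. f x + z * u x) v \<longleftrightarrow> q u v = L2_inner (\<lambda>x. f x + (z + 1) * u x) v"
    if v: "v \<in> form_domain V" for v
    unfolding q_def L2sp.ip_comb_left[OF f form_domainD(2)[OF u] form_domainD(2)[OF v]]
    by (simp add: algebra_simps)
  then show ?thesis using u L2_comb[OF f form_domainD(2)[OF u], of z] by (auto simp: schrodinger_operator_def)
qed (simp add: schrodinger_operator_def)

lemma eigenspace_iff:
  "u \<in> eigenspace (schrodinger_operator V) z \<longleftrightarrow>
    u \<in> form_domain V \<and> (\<forall>v\<in>form_domain V. q u v = (z + 1) * L2_inner u v)"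
proof -
  have "u \<in> eigenspace (schrodinger_operator V) z \<longleftrightarrow>
      u \<in> form_domain V \<and> (\<forall>v\<in>form_domain V. q u v = L2_inner (\<lambda>x. (z + 1) * u x) v)"
    using schrodinger_operator_iff[OF L2sp.zero_mem, of u z] by (simp add: eigenspace_def)
  then show ?thesis by (auto simp: L2sp.ip_scale_left form_domainD(2))
qed

lemma spectrum_below:
  assumes E: "form.orthonormal_eigensystem E"
    and low: "\<And>v. v \<in> form.perp E \<Longrightarrow> \<Lambda> * L2sp.sqn v \<le> Q.sqn v"
    and z: "cmod (z + 1) < \<Lambda>" and spec: "z \<in> op_spectrum (schrodinger_operator V)"
  shows "\<exists>e\<in>E. z + 1 = of_real (Q.sqn e)"
proof (rule ccontr)
  assume contra: "\<not> ?thesis"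
  have "\<exists>C. \<forall>f\<in>L2. \<exists>u\<in>form_domain V. (\<forall>v\<in>form_domain V. q u v = L2_inner (\<lambda>x. f x + (z + 1) * u x) v) \<and>
      L2sp.nrm u \<le> C * L2sp.nrm f \<and>
      (\<forall>w\<in>form_domain V. (\<forall>v\<in>form_domain V. q w v = L2_inner (\<lambda>x. f x + (z + 1) * w x) v)
          \<longrightarrow> L2sp.nrm (\<lambda>x. w x - u x) = 0)"
    by (rule form.resolvent_bound[OF E low z]) (use contra in auto)
  then obtain C where C: "\<And>f. f \<in> L2 \<Longrightarrow> \<exists>u\<in>form_domain V. (\<forall>v\<in>form_domain V. q u v = L2_inner (\<lambda>x. f x + (z
      + 1) * u x) v) \<and>
      L2sp.nrm u \<le> C * L2sp.nrm f \<and>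
      (\<forall>w\<in>form_domain V. (\<forall>v\<in>form_domain V. q w v = L2_inner (\<lambda>x. f x + (z + 1) * w x) v)
          \<longrightarrow> L2sp.nrm (\<lambda>x. w x - u x) = 0)"
    by blast
  have "z \<in> resolvent_set (schrodinger_operator V)"
    unfolding resolvent_set_def
  proof (intro CollectI exI[of _ C] ballI)
    fix f :: "real^'n \<Rightarrow> complex" assume f: "f \<in> L2"
    obtain u where u: "u \<in> form_domain V" "\<forall>v\<in>form_domain V. q u v = L2_inner (\<lambda>x. f x + (z + 1) * u x) v"
      "L2sp.nrm u \<le> C * L2sp.nrm f"
      and uniq: "\<And>w. w \<in> form_domain V \<Longrightarrow> \<forall>v\<in>form_domain V. q w v = L2_inner (\<lambda>x. f x + (z + 1) * w x) v
          \<Longrightarrow> L2sp.nrm (\<lambda>x. w x - u x) = 0"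
      using C[OF f] by blast
    have "AE x in lebesgue. w x = u x" if w: "(w, \<lambda>x. f x + z * w x) \<in> schrodinger_operator V" for w
    proof -
      have wF: "w \<in> form_domain V" and "L2sp.nrm (\<lambda>x. w x - u x) = 0"
        using w uniq unfolding schrodinger_operator_iff[OF f] by auto
      then have "AE x in lebesgue. w x - u x = 0"
        using L2_nrm_zero_iff[OF L2sp.diff_mem[OF form_domainD(2)[OF wF] form_domainD(2)[OF u(1)]]] by blast
      then show ?thesis by eventually_elim simp
    qed
    then show "\<exists>u. (u, \<lambda>x. f x + z * u x) \<in> schrodinger_operator V \<and> L2_norm u \<le> C * L2_norm f \<and>
        (\<forall>w. (w, \<lambda>x. f x + z * w x) \<in> schrodinger_operator V \<longrightarrow> (AE x in lebesgue. w x = u x))"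
      using u unfolding schrodinger_operator_iff[OF f] L2_norm_eq_nrm by blast
  qed
  then show False using spec by (simp add: op_spectrum_def)
qed

text \<open>With \<open>\<Lambda> = \<bar>z + 1\<bar> + 1\<close> the unit disc about a spectral point \<open>z\<close> stays below level \<open>\<Lambda>\<close>. There the spectrum is
contained in the finite set given by the eigensystem, so \<open>z\<close> is isolated and one of its
eigenvalues, and its eigenvectors lie in the span of the eigensystem.\<close>

lemma purely_discrete: "purely_discrete_spectrum (schrodinger_operator V)"
  unfolding purely_discrete_spectrum_def essential_spectrum_def Diff_eq_empty_iff
proof
  let ?H = "schrodinger_operator V"
  fix z assume z: "z \<in> op_spectrum ?H"
  define \<Lambda> where "\<Lambda> = cmod (z + 1) + 1"
  obtain E where E: "form.orthonormal_eigensystem E" and low: "\<And>v. v \<in> form.perp E \<Longrightarrow> \<Lambda> * L2sp.sqn v \<le> Q.sqn v"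
    using form.eigensystem_exhausts_low_energies[of \<Lambda>] by blast
  have z\<Lambda>: "cmod (z + 1) < \<Lambda>" by (simp add: \<Lambda>_def)
  note fin = form.ons_finite[OF E] and ED = form.ons_D[OF E]
  have "z isolated_in op_spectrum ?H"
  proof -
    define F where "F = (\<lambda>e. of_real (Q.sqn e) - 1 :: complex) ` E - {z}"
    define T where "T = ball z 1 - F"
    have "open T" unfolding T_def F_def using fin by (intro open_Diff open_ball finite_imp_closed) auto
    moreover have "T \<inter> op_spectrum ?H = {z}"
    proof
      show "{z} \<subseteq> T \<inter> op_spectrum ?H" using z by (simp add: T_def F_def)
      show "T \<inter> op_spectrum ?H \<subseteq> {z}"
      proof
        fix y assume y: "y \<in> T \<inter> op_spectrum ?H"
        then have "cmod (y - z) < 1" by (simp add: T_def dist_norm norm_minus_commute)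
        then have "cmod (y + 1) < \<Lambda>"
          using norm_triangle_ineq[of "y - z" "z + 1"] by (simp add: \<Lambda>_def)
        then obtain e where "e \<in> E" "y + 1 = of_real (Q.sqn e)"
          using spectrum_below[OF E low, of y] y by blast
        then have "y \<in> (\<lambda>e. of_real (Q.sqn e) - 1 :: complex) ` E" by (auto simp: algebra_simps intro!: image_eqI)
        then show "y \<in> {z}" using y by (auto simp: T_def F_def)
      qed
    qed
    ultimately show ?thesis using z unfolding isolated_in_def by blast
  qed
  moreover have "is_eigenvalue ?H z"
  proof -
    obtain e where e: "e \<in> E" "z + 1 = of_real (Q.sqn e)" using spectrum_below[OF E low z\<Lambda> z] by blast
    have eF: "e \<in> form_domain V" using e ED by blast
    have "e \<in> eigenspace ?H z" unfolding eigenspace_iff using eF form.ons_eig[OF E e(1)] e(2) by simp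
    moreover have "\<not> (AE x in lebesgue. e x = 0)"
      using form.ons_sqn[OF E e(1)] L2_nrm_zero_iff[OF form_domainD(2)[OF eF]] by (auto simp: L2sp.nrm_def)
    ultimately show ?thesis unfolding is_eigenvalue_def by blast
  qed
  moreover have "L2_finite_dim (eigenspace ?H z)"
    unfolding L2_finite_dim_def
  proof (intro exI[of _ E] conjI ballI)
    show "finite E" "E \<subseteq> L2" using fin ED form_domainD(2) by auto
    fix u assume "u \<in> eigenspace ?H z"
    then have u: "u \<in> form_domain V" and uq: "\<And>v. v \<in> form_domain V \<Longrightarrow> q u v = (z + 1) * L2_inner u v"
      unfolding eigenspace_iff by auto
    have m: "(\<lambda>x. u x - (\<Sum>e\<in>E. L2_inner u e * e x)) \<in> L2"
      using ED form_domainD(2) by (intro L2sp.diff_mem form_domainD(2)[OF u] L2sp.sum_mem fin) auto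
    have "L2sp.sqn (\<lambda>x. u x - (\<Sum>e\<in>E. L2_inner u e * e x)) = 0"
      by (rule form.eigenvector_in_span(1)[OF E low z\<Lambda> u uq])
    then have "AE x in lebesgue. u x - (\<Sum>e\<in>E. L2_inner u e * e x) = 0"
      using L2_nrm_zero_iff[OF m] by (simp add: L2sp.nrm_def)
    then have "AE x in lebesgue. u x = (\<Sum>b\<in>E. L2_inner u b * b x)" by eventually_elim simp
    then show "\<exists>c. AE x in lebesgue. u x = (\<Sum>b\<in>E. c b * b x)" by blast
  qed
  ultimately show "z \<in> discrete_spectrum ?H" by (simp add: discrete_spectrum_def)
qed

end

theorem theorem1:
  fixes V :: "real^'n \<Rightarrow> real"
  assumes "locally_integrable V"
    and "AE x in lebesgue. 0 \<le> V x"
    and "\<And>M. M > 0 \<Longrightarrow> emeasure lebesgue (Omega M V) < \<infinity>"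
  shows "purely_discrete_spectrum (schrodinger_operator V)"
proof -
  interpret confining_potential V
    using assms by unfold_locales (auto intro: locally_integrable_measurable)
  show ?thesis by (rule purely_discrete)
qed

end
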